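(* Let $G=\mathrm{SL}(2,\mathbb R)$, let $W\subseteq\mathfrak{sl}(2,\mathbb R)$ be a non-empty open convex $\operatorname{Ad}(G)$-invariant elliptic pointed cone, and let $S=G\exp(iW)\subseteq\mathrm{SL}(2,\mathbb C)$ be the associated complex Ol'shanskiĭ semigroup. Then for every subgroup $\Gamma<\mathrm{SL}(2,\mathbb Z)$ the quotient $\Gamma\backslash S$ is a Stein manifold.
   Context: An element $X\in\mathfrak{sl}(2,\mathbb R)$ is elliptic if $\operatorname{ad}X$ is semisimple with purely imaginary spectrum; a cone is elliptic if all its elements are, and pointed if it contains no affine lines. The polar map $G\times W\to S$, $(g,X)\mapsto g\exp(iX)$ is a homeomorphism onto the open subsemigroup $S$ of $\mathrm{SL}(2,\mathbb C)$. Up to sign the only such cone is $W=\operatorname{Ad}(G).\mathbb R^-U$ with $U=\begin{pmatrix}0&1\\-1&0\end{pmatrix}$ and $\mathbb R^-=\,]-\infty,0[$, for which $S=\{g\in\mathrm{SL}(2,\mathbb C):g.\overline{\Pi^+}\subseteq\Pi^+\}$, $\Pi^+$ being the upper half plane with the action by Möbius transformations. The discrete group $\Gamma$ acts on $S$ by left multiplication, freely and properly discontinuously, so $\Gamma\backslash S$ is a complex manifold. A second countable complex manifold $M$ is Stein if $\operatorname{Hol}(M)$ separates points and, for every compact $K\subseteq M$, the hull $\{z\in M:|f(z)|\le\sup_K|f|\ \forall f\in\operatorname{Hol}(M)\}$ is compact. *)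

theory Defs
  imports "HOL-Analysis.Analysis" "HOL-Algebra.Group"
begin

section \<open>Matrix groups and Lie algebras\<close>

definition SL :: "('a::comm_ring_1 ^ 'n ^ 'n) monoid" where
  "SL = \<lparr>carrier = {A. det A = 1}, mult = (**), one = mat 1\<rparr>"

definition sl :: "('a::comm_ring_1 ^ 'n ^ 'n) set" where
  "sl = {A. trace A = 0}"

lemma group_SL: "group (SL :: ('a::field ^ 'n ^ 'n) monoid)"
proof (rule groupI)
  fix x :: "'a ^ 'n ^ 'n"
  assume "x \<in> carrier SL"
  then have x: "det x = 1" by (simp add: SL_def)
  then obtain y where y: "y ** x = mat 1"
    using invertible_det_nz[of x] by (auto simp: invertible_def)
  then have "det y = 1" using det_mul[of y x] x by simp
  then show "\<exists>y\<in>carrier SL. y \<otimes>\<^bsub>SL\<^esub> x = \<one>\<^bsub>SL\<^esub>"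
    using y by (auto simp: SL_def)
qed (auto simp: SL_def det_mul matrix_mul_assoc)

definition ad :: "'a::comm_ring_1 ^ 'n ^ 'n \<Rightarrow> 'a ^ 'n ^ 'n \<Rightarrow> 'a ^ 'n ^ 'n" where
  "ad X Y = X ** Y - Y ** X"

abbreviation complexify :: "real ^ 'n ^ 'n \<Rightarrow> complex ^ 'n ^ 'n" where
  "complexify \<equiv> map_matrix complex_of_real"

text \<open>Complex scalar multiplication of matrices; \<open>scaleR\<close> only provides the real one.\<close>

abbreviation cscale :: "complex \<Rightarrow> complex ^ 'n ^ 'n \<Rightarrow> complex ^ 'n ^ 'n" where
  "cscale c \<equiv> map_matrix ((*) c)"

text \<open>The library's \<open>exp\<close> is not available: the type class instance for vectors
  multiplies componentwise.\<close>

definition matrix_exp :: "complex ^ 'n ^ 'n \<Rightarrow> complex ^ 'n ^ 'n" where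
  "matrix_exp A = (\<Sum>k. (((**) A ^^ k) (mat 1)) /\<^sub>R fact k)"

section \<open>Elliptic cones and the semigroup\<close>

text \<open>An endomorphism \<open>f\<close> of the real vector space \<open>V\<close> is semisimple if every invariant
  subspace has an invariant complement.\<close>

definition semisimple_on :: "'v::real_vector set \<Rightarrow> ('v \<Rightarrow> 'v) \<Rightarrow> bool" where
  "semisimple_on V f \<longleftrightarrow>
     (\<forall>U. subspace U \<and> U \<subseteq> V \<and> f ` U \<subseteq> U \<longrightarrow>
       (\<exists>U'. subspace U' \<and> U' \<subseteq> V \<and> f ` U' \<subseteq> U' \<and>
             U \<inter> U' = {0} \<and> {u + u' |u u'. u \<in> U \<and> u' \<in> U'} = V))"

text \<open>The spectrum of \<open>ad X\<close> on the real Lie algebra is the set of eigenvalues of its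
  complexification.\<close>

definition ad_spectrum :: "real ^ 'n ^ 'n \<Rightarrow> complex set" where
  "ad_spectrum X = {c. \<exists>Y\<in>sl. Y \<noteq> 0 \<and> ad (complexify X) Y = cscale c Y}"

definition elliptic :: "real ^ 'n ^ 'n \<Rightarrow> bool" where
  "elliptic X \<longleftrightarrow> semisimple_on sl (ad X) \<and> (\<forall>c\<in>ad_spectrum X. Re c = 0)"

text \<open>The library's \<open>cone\<close> and \<open>conic\<close> force \<open>0\<close> to belong to a nonempty cone, which is
  impossible for an open cone without affine lines.\<close>

definition closed_under_pos_scaling :: "'v::real_vector set \<Rightarrow> bool" where
  "closed_under_pos_scaling W \<longleftrightarrow> (\<forall>X\<in>W. \<forall>t>0. t *\<^sub>R X \<in> W)"

definition contains_no_line :: "'v::real_vector set \<Rightarrow> bool" where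
  "contains_no_line W \<longleftrightarrow> \<not> (\<exists>X Y. Y \<noteq> 0 \<and> (\<forall>t. X + t *\<^sub>R Y \<in> W))"

definition Ad_invariant :: "(real ^ 'n ^ 'n) set \<Rightarrow> bool" where
  "Ad_invariant W \<longleftrightarrow> (\<forall>g\<in>carrier SL. \<forall>X\<in>W. g ** X ** matrix_inv g \<in> W)"

definition olshanskii :: "(real ^ 'n ^ 'n) set \<Rightarrow> (complex ^ 'n ^ 'n) set" where
  "olshanskii W =
     {complexify g ** matrix_exp (cscale \<i> (complexify X)) |g X. g \<in> carrier SL \<and> X \<in> W}"

section \<open>Complex manifolds\<close>

definition holomorphic_Cn :: "(complex ^ 'n) set \<Rightarrow> (complex ^ 'n \<Rightarrow> complex) \<Rightarrow> bool" where
  "holomorphic_Cn D f \<longleftrightarrow> open D \<and>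
     (\<forall>z\<in>D. \<exists>f'. (f has_derivative f') (at z) \<and> (\<forall>c v. f' (c *s v) = c * f' v))"

type_synonym ('a, 'n) atlas = "('a set \<times> ('a \<Rightarrow> complex ^ 'n)) set"

definition complex_manifold :: "'a topology \<Rightarrow> ('a, 'n::finite) atlas \<Rightarrow> bool" where
  "complex_manifold M \<A> \<longleftrightarrow>
     Hausdorff_space M \<and>
     topspace M \<subseteq> (\<Union>(U, \<phi>)\<in>\<A>. U) \<and>
     (\<forall>(U, \<phi>)\<in>\<A>. openin M U \<and> open (\<phi> ` U) \<and>
        homeomorphic_map (subtopology M U) (top_of_set (\<phi> ` U)) \<phi>) \<and>
     (\<forall>(U, \<phi>)\<in>\<A>. \<forall>(V, \<psi>)\<in>\<A>. \<forall>i.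
        holomorphic_Cn (\<phi> ` (U \<inter> V)) (\<lambda>z. \<psi> (inv_into U \<phi> z) $ i))"

text \<open>Values outside \<open>topspace M\<close> are unconstrained and never used.\<close>

definition Hol :: "('a, 'n::finite) atlas \<Rightarrow> ('a \<Rightarrow> complex) set" where
  "Hol \<A> = {f. \<forall>(U, \<phi>)\<in>\<A>. holomorphic_Cn (\<phi> ` U) (\<lambda>z. f (inv_into U \<phi> z))}"

definition holomorphic_hull :: "'a topology \<Rightarrow> ('a, 'n::finite) atlas \<Rightarrow> 'a set \<Rightarrow> 'a set" where
  "holomorphic_hull M \<A> K =
     {z \<in> topspace M. \<forall>f\<in>Hol \<A>. cmod (f z) \<le> (SUP w\<in>K. cmod (f w))}"

text \<open>If \<open>K\<close> is empty, \<open>SUP\<close> is some fixed real number, and testing against constant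
  functions shows that the hull is empty, as it should be.\<close>

definition Stein_manifold :: "'a topology \<Rightarrow> ('a, 'n::finite) atlas \<Rightarrow> bool" where
  "Stein_manifold M \<A> \<longleftrightarrow>
     complex_manifold M \<A> \<and> second_countable M \<and>
     (\<forall>x\<in>topspace M. \<forall>y\<in>topspace M. x \<noteq> y \<longrightarrow> (\<exists>f\<in>Hol \<A>. f x \<noteq> f y)) \<and>
     (\<forall>K. compactin M K \<longrightarrow> compactin M (holomorphic_hull M \<A> K))"

section \<open>Quotients\<close>

definition quotient_topology :: "'a topology \<Rightarrow> ('a \<Rightarrow> 'b) \<Rightarrow> 'b topology" where
  "quotient_topology M q =
     topology (\<lambda>U. U \<subseteq> q ` topspace M \<and> openin M {x \<in> topspace M. q x \<in> U})"

lemma openin_quotient_topology: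
  "openin (quotient_topology M q) U \<longleftrightarrow>
     U \<subseteq> q ` topspace M \<and> openin M {x \<in> topspace M. q x \<in> U}"
proof -
  have "istopology (\<lambda>U. U \<subseteq> q ` topspace M \<and> openin M {x \<in> topspace M. q x \<in> U})"
    unfolding istopology_def
  proof (intro conjI allI impI)
    fix U V
    assume "U \<subseteq> q ` topspace M \<and> openin M {x \<in> topspace M. q x \<in> U}"
      and "V \<subseteq> q ` topspace M \<and> openin M {x \<in> topspace M. q x \<in> V}"
    moreover have "{x \<in> topspace M. q x \<in> U \<inter> V} =
        {x \<in> topspace M. q x \<in> U} \<inter> {x \<in> topspace M. q x \<in> V}"
      by auto
    ultimately show "U \<inter> V \<subseteq> q ` topspace M" "openin M {x \<in> topspace M. q x \<in> U \<inter> V}"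
      by auto
  next
    fix \<K>
    assume K: "\<forall>U\<in>\<K>. U \<subseteq> q ` topspace M \<and> openin M {x \<in> topspace M. q x \<in> U}"
    then show "\<Union>\<K> \<subseteq> q ` topspace M" by auto
    have "{x \<in> topspace M. q x \<in> \<Union>\<K>} = (\<Union>U\<in>\<K>. {x \<in> topspace M. q x \<in> U})"
      by auto
    then show "openin M {x \<in> topspace M. q x \<in> \<Union>\<K>}"
      using K by auto
  qed
  then show ?thesis by (simp add: quotient_topology_def topology_inverse')
qed

lemma topspace_quotient_topology: "topspace (quotient_topology M q) = q ` topspace M"
proof
  show "topspace (quotient_topology M q) \<subseteq> q ` topspace M"
    using openin_quotient_topology[of M q "topspace (quotient_topology M q)"] by simp
  have "{x \<in> topspace M. q x \<in> q ` topspace M} = topspace M" by auto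
  then show "q ` topspace M \<subseteq> topspace (quotient_topology M q)"
    by (intro openin_subset) (simp add: openin_quotient_topology)
qed

lemma quotient_map_quotient_topology: "quotient_map M (quotient_topology M q) q"
  by (auto simp: quotient_map_def topspace_quotient_topology openin_quotient_topology)

text \<open>For \<open>M\<close> an open part of a manifold with atlas \<open>\<A>\<close>, and \<open>q\<close> the projection to the
  orbits of a free and properly discontinuous action by biholomorphic maps: every small
  open set \<open>V\<close> maps bijectively onto its image, which inherits the charts of \<open>V\<close>.\<close>

definition quotient_atlas ::
    "'a topology \<Rightarrow> ('a, 'n::finite) atlas \<Rightarrow> ('a \<Rightarrow> 'b) \<Rightarrow> ('b, 'n) atlas" where
  "quotient_atlas M \<A> q =
     {(q ` V, \<phi> \<circ> inv_into V q) |V \<phi>.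
        openin M V \<and> inj_on q V \<and> (\<exists>U. (U, \<phi>) \<in> \<A> \<and> V \<subseteq> U)}"

text \<open>The complex structure of \<open>SL(2,\<complex>)\<close> as a hypersurface in \<open>\<complex>\<^sup>4\<close>: where an entry of the
  first row does not vanish, \<open>det A = 1\<close> can be solved for the entry diagonally opposite to
  it, and the remaining three entries are coordinates.  The first row of an element of
  \<open>SL(2,\<complex>)\<close> is nonzero, so the two charts cover.\<close>

definition SL2C_atlas :: "(complex ^ 2 ^ 2, 3) atlas" where
  "SL2C_atlas =
     {({A \<in> carrier SL. A $ 1 $ 1 \<noteq> 0}, \<lambda>A. vector [A $ 1 $ 1, A $ 1 $ 2, A $ 2 $ 1]),
      ({A \<in> carrier SL. A $ 1 $ 2 \<noteq> 0}, \<lambda>A. vector [A $ 1 $ 1, A $ 1 $ 2, A $ 2 $ 2])}"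

definition left_orbit ::
    "(int ^ 'n ^ 'n) set \<Rightarrow> complex ^ 'n ^ 'n \<Rightarrow> (complex ^ 'n ^ 'n) set" where
  "left_orbit \<Gamma> s = {map_matrix of_int \<gamma> ** s |\<gamma>. \<gamma> \<in> \<Gamma>}"

end

theory Submission
  imports Defs "HOL-Complex_Analysis.Conformal_Mappings"
begin

text \<open>
  Up to the sign \<open>\<epsilon>\<close>, the semigroup \<open>S\<close> consists of the matrices \<open>g\<close> of determinant 1 with
  \<open>Re (p11 g) > 1\<close> and positively oriented columns (\<open>Sset\<close>, \<open>olshanskii_eq_Sset\<close>).  For such \<open>g\<close> and a
  real vector \<open>v \<noteq> 0\<close> the two coordinates of \<open>g v\<close> are linearly independent over the reals, because
  \<open>g\<close> moves the closed half-plane into the open one.  So they span a lattice \<open>\<Lambda>\<^sub>v\<close> in \<open>\<complex>\<close>, and left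
  multiplication of \<open>g\<close> by \<open>SL(2,\<int>)\<close> only changes the basis.  Functions of lattices thus give
  invariant holomorphic functions on \<open>S\<close>.

  Holomorphic convexity rests on one device.  If \<open>\<Gamma>\<close> permutes a countable family of holomorphic
  functions \<open>a\<^sub>i\<close>, then the power sums of the family are invariant, and a bound for all of them on the
  hull of a compact set \<open>K\<close> bounds every single \<open>a\<^sub>i\<close> there by its supremum over \<open>K\<close> and \<open>i\<close>
  (\<open>power_sums_bound\<close>): the largest term dominates the Cesaro means of the normalised power sums.
  It is applied to three families.

  \<^item> \<open>1/\<lambda>\<close> for \<open>\<lambda>\<close> in \<open>\<Lambda>\<^sub>v\<close> nonzero, with Eisenstein series as power sums.  On the hull the shortest
    vector of \<open>\<Lambda>\<^sub>v\<close> stays bounded below, uniformly in the unit vector \<open>v\<close>; hence so does the covolume,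
    and \<open>g\<close> stays away from the boundary of \<open>S\<close>.
  \<^item> \<open>1/A\<^sub>t\<close> for the 3-torsion points \<open>t\<close> of \<open>\<complex>/\<Lambda>\<^sub>v\<close>, where \<open>A\<^sub>t\<close> is the sum of \<open>(t+\<lambda>)\<^bsup>-3\<^esup>\<close> over \<open>\<Lambda>\<^sub>v\<close>, up to a
    factor the derivative of the Weierstrass function.  It does not vanish at \<open>t\<close>
    (\<open>eisenstein3_nonzero\<close>, by Liouville), and it tends to 0 for some \<open>t\<close> when the lattice becomes long.
    So on the hull \<open>\<Lambda>\<^sub>v\<close> has a bounded basis (\<open>bounded_basis\<close>), which means that some \<open>\<sigma>\<close> in
    \<open>SL(2,\<int>)\<close> moves \<open>g\<close> into a fixed compact set.  Functions of this kind, growing under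
    scaling of the lattice, exist only because \<open>SL(2,\<int>)\<close> has a cusp.
  \<^item> \<open>1/(\<ell> \<delta> g v)\<close> for a suitable row vector \<open>\<ell>\<close> and \<open>\<delta>\<close> in the coset \<open>\<sigma> \<Gamma>\<close>, with Poincare series as
    power sums.  On \<open>K\<close> these functions are at most a constant divided by the norm of the smallest
    element of \<open>\<sigma> \<Gamma>\<close>, while at \<open>g\<close> the one with \<open>\<delta> = \<sigma>\<close> is bounded below.  So \<open>\<sigma>\<close> differs
    from an element of \<open>\<Gamma>\<close> by a bounded factor, and the hull is the image of a compact set
    (\<open>hull_relatively_compact\<close>).

  The same Poincare series separate orbits: equal power sums have a common largest term, so for every
  pair \<open>(\<ell>, v)\<close> two elements of \<open>\<Gamma>\<close> satisfy \<open>\<ell> \<gamma> s v = \<ell> \<delta> t v\<close>, and since \<open>\<Gamma>\<close> is countable one such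
  pair of elements serves infinitely many points of a curve of \<open>(\<ell>, v)\<close> spanning all matrices
  (\<open>Hol_separates\<close>).  The manifold structure of the quotient comes from the discreteness of the
  integer matrices in which the products \<open>t s\<^sup>-\<^sup>1\<close> of equivalent points lie.
\<close>

section \<open>Complex differentiability in several variables\<close>

definition cdiff :: "(complex ^ 'n \<Rightarrow> complex) \<Rightarrow> complex ^ 'n \<Rightarrow> bool" where
  "cdiff F z \<longleftrightarrow> (\<exists>F'. (F has_derivative F') (at z) \<and> (\<forall>c v. F' (c *s v) = c * F' v))"

lemma holomorphic_Cn_iff_cdiff: "holomorphic_Cn D f \<longleftrightarrow> open D \<and> (\<forall>z\<in>D. cdiff f z)"
  by (simp add: holomorphic_Cn_def cdiff_def)

lemma cdiffI:
  assumes "(F has_derivative F') (at z)" "\<And>c v. F' (c *s v) = c * F' v"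
  shows "cdiff F z"
  using assms by (auto simp: cdiff_def)

lemma cdiff_const: "cdiff (\<lambda>z. a) z"
  by (rule cdiffI[where F' = "\<lambda>_. 0"]) (auto intro: derivative_eq_intros)

lemma cdiff_nth: "cdiff (\<lambda>z. z $ i) z"
  by (rule cdiffI[where F' = "\<lambda>h. h $ i"])
     (auto intro!: bounded_linear_imp_has_derivative bounded_linear_vec_nth)

lemma cdiff_add: "cdiff f z \<Longrightarrow> cdiff g z \<Longrightarrow> cdiff (\<lambda>z. f z + g z) z"
  unfolding cdiff_def
  by (elim exE conjE, rename_tac f' g', rule_tac x = "\<lambda>h. f' h + g' h" in exI)
     (auto intro: has_derivative_add simp: algebra_simps)

lemma cdiff_mult: "cdiff f z \<Longrightarrow> cdiff g z \<Longrightarrow> cdiff (\<lambda>z. f z * g z) z"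
  unfolding cdiff_def
  by (elim exE conjE, rename_tac f' g', rule_tac x = "\<lambda>h. f z * g' h + f' h * g z" in exI)
     (intro conjI, erule (1) has_derivative_mult, simp add: algebra_simps)

lemma cdiff_diff: "cdiff f z \<Longrightarrow> cdiff g z \<Longrightarrow> cdiff (\<lambda>z. f z - g z) z"
  using cdiff_add[of f z "\<lambda>z. (- 1) * g z"] cdiff_mult[OF cdiff_const[of "-1"], of g z] by simp

lemma cdiff_compose_deriv:
  assumes "cdiff f z" "(g has_field_derivative d) (at (f z))"
  shows "cdiff (\<lambda>z. g (f z)) z"
proof -
  obtain f' where f': "(f has_derivative f') (at z)" "\<And>c v. f' (c *s v) = c * f' v"
    using assms(1) by (auto simp: cdiff_def)
  have "(g has_derivative (\<lambda>h. d * h)) (at (f z))"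
    using assms(2) by (simp add: has_field_derivative_def)
  from has_derivative_compose[OF f'(1) this]
  show ?thesis by (rule cdiffI) (simp add: f' algebra_simps)
qed

lemma cdiff_inverse: "cdiff f z \<Longrightarrow> f z \<noteq> 0 \<Longrightarrow> cdiff (\<lambda>z. inverse (f z)) z"
  by (rule cdiff_compose_deriv[where g = inverse]) (auto intro!: derivative_eq_intros)

lemma cdiff_power: "cdiff f z \<Longrightarrow> cdiff (\<lambda>z. f z ^ k) z"
  by (rule cdiff_compose_deriv[where g = "\<lambda>x. x ^ k"]) (auto intro!: derivative_eq_intros)

lemma cdiff_divide:
  assumes "cdiff f z" "cdiff g z" "g z \<noteq> 0"
  shows "cdiff (\<lambda>z. f z / g z) z"
  unfolding divide_inverse using assms by (intro cdiff_mult cdiff_inverse)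

lemma cdiff_sum: "(\<And>i. i \<in> I \<Longrightarrow> cdiff (f i) z) \<Longrightarrow> cdiff (\<lambda>z. \<Sum>i\<in>I. f i z) z"
  by (induction I rule: infinite_finite_induct) (auto intro: cdiff_const cdiff_add)

lemma cdiff_isCont: "cdiff f z \<Longrightarrow> isCont f z"
  by (auto simp: cdiff_def intro: has_derivative_continuous)

lemma has_derivative_vec:
  fixes f :: "'a::real_normed_vector \<Rightarrow> 'b::real_normed_vector ^ 'n"
  assumes "\<And>i. ((\<lambda>x. f x $ i) has_derivative (\<lambda>h. f' h $ i)) (at x)"
  shows "(f has_derivative f') (at x)"
proof -
  have lin: "bounded_linear (\<lambda>h. f' h $ i)" for i
    using assms has_derivative_bounded_linear by blast
  have "\<forall>i. \<exists>K. \<forall>h. norm (f' h $ i) \<le> norm h * K"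
    using lin by (meson bounded_linear.bounded)
  then obtain K where K: "\<And>i h. norm (f' h $ i) \<le> norm h * K i" by metis
  have bl: "bounded_linear f'"
  proof (rule bounded_linear_intro[where K = "\<Sum>i\<in>UNIV. K i"])
    show "f' (a + b) = f' a + f' b" for a b
      by (simp add: vec_eq_iff linear_simps(1)[OF lin])
    show "f' (r *\<^sub>R a) = r *\<^sub>R f' a" for r a
      by (simp add: vec_eq_iff linear_simps(5)[OF lin])
    show "norm (f' h) \<le> norm h * (\<Sum>i\<in>UNIV. K i)" for h
    proof -
      have "norm (f' h) \<le> (\<Sum>i\<in>UNIV. norm (f' h $ i))"
        unfolding norm_vec_def by (rule L2_set_le_sum) auto
      also have "\<dots> \<le> (\<Sum>i\<in>UNIV. norm h * K i)" by (intro sum_mono K)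
      finally show ?thesis by (simp add: sum_distrib_left)
    qed
  qed
  show ?thesis
    unfolding has_derivative_def
  proof (intro conjI bl)
    show "((\<lambda>y. (f y - f (Lim (at x) (\<lambda>x. x)) - f' (y - Lim (at x) (\<lambda>x. x))) /\<^sub>R
        norm (y - Lim (at x) (\<lambda>x. x))) \<longlongrightarrow> 0) (at x)"
      by (rule vec_tendstoI) (use assms in \<open>simp add: has_derivative_def\<close>)
  qed
qed

lemma cdiff_compose:
  fixes F :: "complex ^ 'm \<Rightarrow> complex" and G :: "complex ^ 'n \<Rightarrow> complex ^ 'm"
  assumes "cdiff F (G z)" "\<And>i. cdiff (\<lambda>z. G z $ i) z"
  shows "cdiff (\<lambda>z. F (G z)) z"
proof -
  obtain F' where F': "(F has_derivative F') (at (G z))" "\<And>c v. F' (c *s v) = c * F' v"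
    using assms(1) by (auto simp: cdiff_def)
  have "\<forall>i. \<exists>g. ((\<lambda>z. G z $ i) has_derivative g) (at z) \<and> (\<forall>c v. g (c *s v) = c * g v)"
    using assms(2) by (auto simp: cdiff_def)
  then obtain g where g: "\<And>i. ((\<lambda>z. G z $ i) has_derivative g i) (at z)"
    "\<And>i c v. g i (c *s v) = c * g i v" by metis
  have "(G has_derivative (\<lambda>h. \<chi> i. g i h)) (at z)"
    by (rule has_derivative_vec) (simp add: g(1))
  from has_derivative_compose[OF this F'(1)] show ?thesis
  proof (rule cdiffI)
    fix c v
    have "(\<chi> i. g i (c *s v)) = c *s (\<chi> i. g i v)"
      by (simp add: vec_eq_iff g(2))
    then show "F' (\<chi> i. g i (c *s v)) = c * F' (\<chi> i. g i v)" by (simp add: F'(2))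
  qed
qed

lemma cdiff_transform:
  assumes "cdiff f z" "open N" "z \<in> N" "\<And>w. w \<in> N \<Longrightarrow> f w = g w"
  shows "cdiff g z"
  using assms has_derivative_transform_within_open unfolding cdiff_def by blast

section \<open>Sums of inverse powers of linear forms\<close>

definition bil :: "complex ^ 'n \<Rightarrow> complex ^ 'n \<Rightarrow> complex" where
  "bil \<rho> u = (\<Sum>i\<in>UNIV. \<rho> $ i * u $ i)"

lemma norm_bil_le: "norm (bil \<rho> u) \<le> norm \<rho> * norm u"
proof -
  have "norm (bil \<rho> u) \<le> (\<Sum>i\<in>UNIV. \<bar>norm (\<rho> $ i)\<bar> * \<bar>norm (u $ i)\<bar>)"
    unfolding bil_def by (rule order_trans[OF norm_sum]) (simp add: norm_mult)
  also have "\<dots> \<le> norm \<rho> * norm u" unfolding norm_vec_def by (rule L2_set_mult_ineq)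
  finally show ?thesis .
qed

lemma bil_add_left: "bil (\<rho> + \<sigma>) u = bil \<rho> u + bil \<sigma> u"
  by (simp add: bil_def algebra_simps sum.distrib)
lemma bil_add_right: "bil \<rho> (u + v) = bil \<rho> u + bil \<rho> v"
  by (simp add: bil_def algebra_simps sum.distrib)
lemma bil_smult_right: "bil \<rho> (c *s u) = c * bil \<rho> u"
  by (simp add: bil_def algebra_simps sum_distrib_left)
lemma bil_smult_left: "bil (c *s \<rho>) u = c * bil \<rho> u"
  by (simp add: bil_def algebra_simps sum_distrib_left)
lemma bil_scaleR_left: "bil (c *\<^sub>R \<rho>) u = c *\<^sub>R bil \<rho> u"
  by (simp add: bil_def algebra_simps scaleR_sum_right)
lemma bil_scaleR_right: "bil \<rho> (c *\<^sub>R u) = c *\<^sub>R bil \<rho> u"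
  by (simp add: bil_def algebra_simps scaleR_sum_right)

lemma bounded_linear_bil_right: "bounded_linear (\<lambda>u. bil \<rho> u)"
  by (rule bounded_linear_intro[where K = "norm \<rho>"])
     (auto simp: bil_add_right bil_scaleR_right norm_bil_le mult.commute[of _ "norm \<rho>"])
lemma bounded_linear_bil_left: "bounded_linear (\<lambda>\<rho>. bil \<rho> u)"
  by (rule bounded_linear_intro[where K = "norm u"])
     (auto simp: bil_add_left bil_scaleR_left norm_bil_le)

lemma norm_smult: "norm (c *s (x :: complex ^ 'n)) = norm c * norm x"
  unfolding norm_vec_def by (simp add: norm_mult L2_set_right_distrib)

text \<open>The remainder \<open>e\<^sub>k\<close> satisfies \<open>(1 + w) e\<^sub>k\<^sub>+\<^sub>1 = e\<^sub>k + (k + 1) w\<^sup>2\<close>, which gives the constant by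
  induction.\<close>

lemma inverse_power_second_order:
  fixes k :: nat
  shows "\<exists>C\<ge>0. \<forall>w::complex. norm w \<le> 1/2 \<longrightarrow>
    norm (1 / (1 + w) ^ k - 1 + of_nat k * w) \<le> C * norm w ^ 2"
proof (induction k)
  case 0 then show ?case by (intro exI[of _ 0]) auto
next
  case (Suc k)
  then obtain C where C: "C \<ge> 0"
    "\<And>w::complex. norm w \<le> 1/2 \<Longrightarrow> norm (1 / (1 + w) ^ k - 1 + of_nat k * w) \<le> C * norm w ^ 2"
    by blast
  show ?case
  proof (intro exI[of _ "2 * (C + (real k + 1))"] conjI allI impI)
    show "0 \<le> 2 * (C + (real k + 1))" using C by simp
    fix w :: complex assume w: "norm w \<le> 1/2"
    define e where "e = 1 / (1 + w) ^ k - 1 + of_nat k * w"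
    have n: "norm (1 + w) \<ge> 1/2"
      using norm_triangle_ineq2[of 1 "-w"] w by simp
    then have nz: "1 + w \<noteq> 0" by auto
    have "e + (of_nat k + 1) * w^2 = 1 / (1 + w) ^ k + (1 + w) * (of_nat (Suc k) * w - 1)"
      by (simp add: e_def algebra_simps power2_eq_square)
    then have "1 / (1 + w) ^ Suc k - 1 + of_nat (Suc k) * w = (e + (of_nat k + 1) * w^2) / (1 + w)"
      using nz by (simp add: add_divide_distrib)
    also have "norm \<dots> \<le> (C * norm w ^ 2 + (real k + 1) * norm w ^ 2) / (1/2)"
      unfolding norm_divide
    proof (rule frac_le)
      have "norm (e + (of_nat k + 1) * w^2) \<le> norm e + norm ((of_nat k + 1) * w^2)"
        by (rule norm_triangle_ineq)
      also have "norm ((of_nat k + 1) * w^2) = (real k + 1) * norm w ^ 2"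
      proof -
        have "norm (of_nat k + 1 :: complex) = real k + 1"
          by (metis norm_of_nat of_nat_Suc add.commute)
        then show ?thesis by (simp add: norm_mult norm_power)
      qed
      finally show "norm (e + (of_nat k + 1) * w^2) \<le> C * norm w ^ 2 + (real k + 1) * norm w ^ 2"
        using C(2)[OF w] by (simp add: e_def)
    qed (use n C in auto)
    finally show "norm (1 / (1 + w) ^ Suc k - 1 + of_nat (Suc k) * w)
       \<le> 2 * (C + (real k + 1)) * norm w ^ 2" by (simp add: algebra_simps)
  qed
qed

lemma has_sum_minus:
  fixes f g :: "'i \<Rightarrow> 'a::real_normed_vector"
  assumes "(f has_sum a) A" "(g has_sum b) A"
  shows "((\<lambda>x. f x - g x) has_sum (a - b)) A"
  using has_sum_add[OF assms(1), of "\<lambda>x. - g x" "- b"] assms(2) by (simp add: has_sum_uminus)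

lemma summable_on_minus:
  fixes f g :: "'i \<Rightarrow> 'a::real_normed_vector"
  assumes "f summable_on A" "g summable_on A"
  shows "(\<lambda>x. f x - g x) summable_on A"
  using has_sum_minus[OF has_sum_infsum[OF assms(1)] has_sum_infsum[OF assms(2)]]
  by (rule has_sum_imp_summable)

lemma infsum_minus:
  fixes f g :: "'i \<Rightarrow> 'a::real_normed_vector"
  assumes "f summable_on A" "g summable_on A"
  shows "(\<Sum>\<^sub>\<infinity>x\<in>A. f x - g x) = infsum f A - infsum g A"
  by (intro infsumI has_sum_minus has_sum_infsum assms)

definition inv_power_sum :: "nat \<Rightarrow> (complex ^ 'n) set \<Rightarrow> complex ^ 'n \<Rightarrow> complex" where
  "inv_power_sum k R u = (\<Sum>\<^sub>\<infinity>\<rho>\<in>R. 1 / bil \<rho> u ^ k)"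

text \<open>A linear form \<open>\<rho>\<close> may be as small at \<open>u\<close> as its norm permits; this condition excludes it, uniformly
  over the family, and holds for real forms exactly when \<open>u\<close> has coordinates independent over the reals.\<close>

definition separated_from :: "(complex ^ 'n) set \<Rightarrow> complex ^ 'n \<Rightarrow> bool" where
  "separated_from R u \<longleftrightarrow> (\<exists>c>0. \<forall>\<rho>\<in>R. c * norm \<rho> \<le> norm (bil \<rho> u))"

lemma inv_power_sum_abs_summable:
  assumes "(\<lambda>\<rho>. 1 / norm \<rho> ^ k) summable_on R" "separated_from R u" "0 \<notin> R"
  shows "(\<lambda>\<rho>. norm (1 / bil \<rho> u ^ k)) summable_on R"
proof -
  obtain c where c: "c > 0" "\<And>\<rho>. \<rho> \<in> R \<Longrightarrow> c * norm \<rho> \<le> norm (bil \<rho> u)"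
    using assms(2) by (auto simp: separated_from_def)
  show ?thesis
  proof (rule summable_on_comparison_test)
    show "(\<lambda>\<rho>. (1 / c ^ k) * (1 / norm \<rho> ^ k)) summable_on R"
      by (intro summable_on_cmult_right assms)
    fix \<rho> assume \<rho>: "\<rho> \<in> R"
    then have "\<rho> \<noteq> 0" using assms(3) by auto
    then have "0 < c * norm \<rho>" using c(1) by simp
    moreover from this have "0 < norm (bil \<rho> u)" using c(2)[OF \<rho>] by linarith
    ultimately have "1 / norm (bil \<rho> u) ^ k \<le> 1 / (c * norm \<rho>) ^ k"
      using c(2)[OF \<rho>] by (intro divide_left_mono power_mono mult_pos_pos[OF zero_less_power zero_less_power]) auto
    then show "norm (1 / bil \<rho> u ^ k) \<le> (1 / c ^ k) * (1 / norm \<rho> ^ k)"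
      by (simp add: norm_divide norm_power power_mult_distrib)
  qed auto
qed

text \<open>Term by term, the inverse power of a linear form differs from its first order expansion at \<open>u\<close> by
  at most a constant times \<open>norm h ^ 2 / norm \<rho> ^ k\<close>, because separation makes the form comparable
  to \<open>norm \<rho>\<close> near \<open>u\<close>.  Summing these estimates differentiates the series without any theorem on
  uniform limits in several variables.\<close>

lemma cdiff_inv_power_sum:
  fixes u :: "complex ^ 'n"
  assumes sm: "(\<lambda>\<rho>. 1 / norm \<rho> ^ k) summable_on R" and sep: "separated_from R u" and "0 \<notin> R"
  shows "cdiff (inv_power_sum k R) u"
proof -
  obtain c where c: "c > 0" "\<And>\<rho>. \<rho> \<in> R \<Longrightarrow> c * norm \<rho> \<le> norm (bil \<rho> u)"
    using sep by (auto simp: separated_from_def)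
  obtain C where C: "C \<ge> 0"
    "\<And>w::complex. norm w \<le> 1/2 \<Longrightarrow> norm (1 / (1 + w) ^ k - 1 + of_nat k * w) \<le> C * norm w ^ 2"
    using inverse_power_second_order[of k] by blast
  define S where "S = (\<Sum>\<^sub>\<infinity>\<rho>\<in>R. 1 / norm \<rho> ^ k)"
  have Spos: "S \<ge> 0" unfolding S_def by (rule infsum_nonneg) auto
  define d :: "complex ^ 'n \<Rightarrow> complex ^ 'n" where "d \<rho> = (- of_nat k / bil \<rho> u ^ Suc k) *s \<rho>" for \<rho>
  define N where "N = (\<Sum>\<^sub>\<infinity>\<rho>\<in>R. d \<rho>)"
  have pos: "norm \<rho> > 0" "norm (bil \<rho> u) > 0" if "\<rho> \<in> R" for \<rho>
  proof -
    show a: "norm \<rho> > 0" using that assms(3) by auto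
    show "norm (bil \<rho> u) > 0" using mult_pos_pos[OF c(1) a] c(2)[OF that] by linarith
  qed
  have inv: "1 / norm (bil \<rho> u) ^ j \<le> 1 / (c ^ j * norm \<rho> ^ j)" if "\<rho> \<in> R" for \<rho> j
    using c(2)[OF that] pos[OF that] c(1) power_mono[of "c * norm \<rho>" "norm (bil \<rho> u)" j]
    by (intro divide_left_mono) (auto simp: power_mult_distrib)
  have sd: "(\<lambda>\<rho>. norm (d \<rho>)) summable_on R"
  proof (rule summable_on_comparison_test)
    show "(\<lambda>\<rho>. (k / c ^ Suc k) * (1 / norm \<rho> ^ k)) summable_on R"
      by (intro summable_on_cmult_right sm)
    fix \<rho> assume \<rho>: "\<rho> \<in> R"
    have "norm (d \<rho>) = k * norm \<rho> * (1 / norm (bil \<rho> u) ^ Suc k)"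
      by (simp add: d_def norm_smult norm_divide norm_power norm_mult)
    also have "\<dots> \<le> k * norm \<rho> * (1 / (c ^ Suc k * norm \<rho> ^ Suc k))"
      by (rule mult_left_mono[OF inv[OF \<rho>]]) auto
    also have "\<dots> = (k / c ^ Suc k) * (1 / norm \<rho> ^ k)"
      using pos[OF \<rho>] c by (simp add: field_simps)
    finally show "norm (d \<rho>) \<le> (k / c ^ Suc k) * (1 / norm \<rho> ^ k)" .
  qed auto
  have sd': "d summable_on R" by (rule abs_summable_summable[OF sd])
  have Nh: "bil N h = (\<Sum>\<^sub>\<infinity>\<rho>\<in>R. bil (d \<rho>) h)" for h
    unfolding N_def
    by (rule infsum_bounded_linear_strong[symmetric, OF _ bounded_linear_bil_left])
       (use sd' summable_on_bounded_linear[OF bounded_linear_bil_left sd'] in blast)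
  have sep': "separated_from R (u + h)" if h: "norm h < c / 2" for h
    unfolding separated_from_def
  proof (intro exI[of _ "c / 2"] conjI ballI)
    fix \<rho> assume \<rho>: "\<rho> \<in> R"
    have "norm (bil \<rho> h) \<le> norm \<rho> * (c / 2)"
      using norm_bil_le[of \<rho> h] mult_left_mono[of "norm h" "c/2" "norm \<rho>"] h by auto
    then show "c / 2 * norm \<rho> \<le> norm (bil \<rho> (u + h))"
      using c(2)[OF \<rho>] norm_triangle_ineq2[of "bil \<rho> u" "- bil \<rho> h"]
      by (simp add: bil_add_right algebra_simps)
  qed (use c in auto)
  have main: "norm (inv_power_sum k R (u + h) - inv_power_sum k R u - bil N h) \<le> (C / c ^ (k + 2) * S) * norm h ^ 2"
    if h: "norm h < c / 2" for h
  proof -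
    let ?a = "\<lambda>\<rho>. 1 / bil \<rho> (u + h) ^ k" and ?b = "\<lambda>\<rho>. 1 / bil \<rho> u ^ k"
    let ?e = "\<lambda>\<rho>. ?a \<rho> - ?b \<rho> - bil (d \<rho>) h"
    have s1: "?a summable_on R"
      by (rule abs_summable_summable[OF inv_power_sum_abs_summable[OF sm sep'[OF h] assms(3)]])
    have s2: "?b summable_on R"
      by (rule abs_summable_summable[OF inv_power_sum_abs_summable[OF sm sep assms(3)]])
    have s3: "(\<lambda>\<rho>. bil (d \<rho>) h) summable_on R"
      by (rule summable_on_bounded_linear[OF bounded_linear_bil_left sd'])
    have s12: "(\<lambda>\<rho>. ?a \<rho> - ?b \<rho>) summable_on R" by (intro summable_on_minus s1 s2)
    have eq: "inv_power_sum k R (u + h) - inv_power_sum k R u - bil N h = (\<Sum>\<^sub>\<infinity>\<rho>\<in>R. ?e \<rho>)"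
      unfolding inv_power_sum_def Nh
      by (subst infsum_minus[OF s12 s3], subst infsum_minus[OF s1 s2]) simp
    have eb: "norm (?e \<rho>) \<le> (C / c ^ (k + 2) * norm h ^ 2) * (1 / norm \<rho> ^ k)" if \<rho>: "\<rho> \<in> R" for \<rho>
    proof -
      define x y where "x = bil \<rho> u" and "y = bil \<rho> h"
      have x: "x \<noteq> 0" using pos[OF \<rho>] by (auto simp: x_def)
      have yb: "norm y \<le> norm \<rho> * norm h" unfolding y_def by (rule norm_bil_le)
      have "norm (y / x) \<le> norm \<rho> * norm h / (c * norm \<rho>)"
        unfolding norm_divide using yb c(2)[OF \<rho>] pos[OF \<rho>] c(1)
        by (intro frac_le) (auto simp: x_def)
      then have w: "norm (y / x) \<le> norm h / c" using pos[OF \<rho>] by (simp add: field_simps)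
      have hc: "norm h / c \<le> 1/2" using h c(1) by (simp add: field_simps)
      have xy: "x + y = x * (1 + y / x)" using x by (simp add: field_simps)
      have "1 / (x + y) ^ k = 1 / x ^ k * (1 / (1 + y / x) ^ k)"
        unfolding xy power_mult_distrib by simp
      moreover have "bil (d \<rho>) h = 1 / x ^ k * (- (of_nat k * (y / x)))"
      proof -
        have "bil (d \<rho>) h = (- of_nat k / x ^ Suc k) * y"
          by (simp only: d_def bil_smult_left x_def y_def)
        then show ?thesis using x by (simp add: field_simps)
      qed
      ultimately have "?e \<rho> = 1 / x ^ k * (1 / (1 + y / x) ^ k - 1 + of_nat k * (y / x))"
        by (simp add: bil_add_right x_def[symmetric] y_def[symmetric] algebra_simps)
      then have "norm (?e \<rho>) = 1 / norm x ^ k * norm (1 / (1 + y / x) ^ k - 1 + of_nat k * (y / x))"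
        by (simp add: norm_mult norm_divide norm_power)
      also have "\<dots> \<le> (1 / (c ^ k * norm \<rho> ^ k)) * (C * (norm h / c) ^ 2)"
      proof (rule mult_mono)
        show "1 / norm x ^ k \<le> 1 / (c ^ k * norm \<rho> ^ k)" using inv[OF \<rho>] by (simp add: x_def)
        have "norm (1 / (1 + y / x) ^ k - 1 + of_nat k * (y / x)) \<le> C * norm (y / x) ^ 2"
          using w hc by (intro C(2)) linarith
        also have "\<dots> \<le> C * (norm h / c) ^ 2"
          by (intro mult_left_mono power_mono w C) auto
        finally show "norm (1 / (1 + y / x) ^ k - 1 + of_nat k * (y / x)) \<le> C * (norm h / c) ^ 2" .
      qed (use c in auto)
      also have "\<dots> = (C / c ^ (k + 2) * norm h ^ 2) * (1 / norm \<rho> ^ k)"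
        by (simp add: power_add power2_eq_square field_simps)
      finally show ?thesis .
    qed
    have se: "(\<lambda>\<rho>. norm (?e \<rho>)) summable_on R"
      by (rule summable_on_comparison_test[OF summable_on_cmult_right[OF sm] eb]) auto
    have "norm (\<Sum>\<^sub>\<infinity>\<rho>\<in>R. ?e \<rho>) \<le> (\<Sum>\<^sub>\<infinity>\<rho>\<in>R. norm (?e \<rho>))"
      by (rule norm_infsum_bound[OF se])
    also have "\<dots> \<le> (\<Sum>\<^sub>\<infinity>\<rho>\<in>R. (C / c ^ (k + 2) * norm h ^ 2) * (1 / norm \<rho> ^ k))"
      by (rule infsum_mono[OF se summable_on_cmult_right[OF sm] eb])
    also have "\<dots> = (C / c ^ (k + 2) * norm h ^ 2) * S"
      unfolding S_def by (rule infsum_cmult_right) (use sm in auto)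
    finally show ?thesis unfolding eq by (simp add: mult_ac)
  qed
  have "(inv_power_sum k R has_derivative (\<lambda>h. bil N h)) (at u)"
    unfolding has_derivative_at_alt
  proof (intro conjI allI impI bounded_linear_bil_right)
    fix e :: real assume e: "e > 0"
    define D where "D = C / c ^ (k + 2) * S"
    have D: "D \<ge> 0" using C c Spos by (simp add: D_def)
    show "\<exists>d>0. \<forall>y. norm (y - u) < d \<longrightarrow>
       norm (inv_power_sum k R y - inv_power_sum k R u - bil N (y - u)) \<le> e * norm (y - u)"
    proof (intro exI[of _ "min (c / 2) (e / (D + 1))"] conjI allI impI)
      show "0 < min (c / 2) (e / (D + 1))" using c e D by auto
      fix y assume y: "norm (y - u) < min (c / 2) (e / (D + 1))"
      have "norm (inv_power_sum k R y - inv_power_sum k R u - bil N (y - u)) \<le> D * norm (y - u) ^ 2"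
        using main[of "y - u"] y by (simp add: D_def)
      also have "\<dots> \<le> e * norm (y - u)"
      proof -
        have "(D + 1) * norm (y - u) \<le> e" using y D by (simp add: field_simps)
        then have "D * norm (y - u) \<le> e" using norm_ge_zero[of "y - u"] D
          by (smt (verit) mult_right_mono)
        then show ?thesis by (simp add: power2_eq_square mult_right_mono flip: mult.assoc)
      qed
      finally show "norm (inv_power_sum k R y - inv_power_sum k R u - bil N (y - u)) \<le> e * norm (y - u)" .
    qed
  qed
  then show ?thesis by (rule cdiffI) (simp add: bil_smult_right)
qed

section \<open>Power sums and their largest terms\<close>

lemma infsum_dominated_tendsto_0:
  fixes f :: "nat \<Rightarrow> 'i \<Rightarrow> complex"
  assumes lim: "\<And>i. i \<in> I \<Longrightarrow> (\<lambda>n. f n i) \<longlonglongrightarrow> 0"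
    and bd: "\<And>n i. i \<in> I \<Longrightarrow> norm (f n i) \<le> g i" and g: "g summable_on I"
  shows "(\<lambda>n. infsum (f n) I) \<longlonglongrightarrow> 0"
proof (rule LIMSEQ_I)
  fix e :: real assume e: "e > 0"
  obtain F where F: "finite F" "F \<subseteq> I" "dist (sum g F) (infsum g I) \<le> e / 2"
    using infsum_finite_approximation[OF g, of "e/2"] e by auto
  have g0: "g i \<ge> 0" if "i \<in> I" for i using bd[OF that, of 0] norm_ge_zero order_trans by blast
  have gF: "g summable_on F" and gr: "g summable_on (I - F)" using F(1) summable_on_subset[OF g] by auto
  have "infsum g (F \<union> (I - F)) = infsum g F + infsum g (I - F)"
    by (rule infsum_Un_disjoint[OF gF gr]) auto
  then have tail: "infsum g (I - F) \<le> e / 2"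
    using F by (simp add: Un_absorb1 dist_real_def abs_if split: if_splits)
  have nf: "(\<lambda>i. norm (f n i)) summable_on A" if "A \<subseteq> I" for n A
    by (rule summable_on_comparison_test[OF summable_on_subset[OF g that]]) (use bd that in auto)
  have "(\<lambda>n. \<Sum>i\<in>F. norm (f n i)) \<longlonglongrightarrow> (\<Sum>i\<in>F. norm (0::complex))"
    by (intro tendsto_intros lim) (use F in auto)
  then have "\<forall>\<^sub>F n in sequentially. (\<Sum>i\<in>F. norm (f n i)) < e / 2"
    using e by (auto dest: order_tendstoD(2)[of _ _ _ "e/2"])
  then obtain N where N: "\<And>n. n \<ge> N \<Longrightarrow> (\<Sum>i\<in>F. norm (f n i)) < e / 2"
    by (auto simp: eventually_sequentially)
  show "\<exists>N. \<forall>n\<ge>N. norm (infsum (f n) I - 0) < e"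
  proof (intro exI[of _ N] allI impI)
    fix n assume n: "n \<ge> N"
    have "norm (infsum (f n) I) \<le> (\<Sum>\<^sub>\<infinity>i\<in>I. norm (f n i))" by (rule norm_infsum_bound[OF nf]) simp
    also have "\<dots> = (\<Sum>\<^sub>\<infinity>i\<in>F \<union> (I - F). norm (f n i))" using F by (simp add: Un_absorb1)
    also have "\<dots> = (\<Sum>\<^sub>\<infinity>i\<in>F. norm (f n i)) + (\<Sum>\<^sub>\<infinity>i\<in>I-F. norm (f n i))"
      by (rule infsum_Un_disjoint[OF nf nf]) (use F in auto)
    also have "(\<Sum>\<^sub>\<infinity>i\<in>I-F. norm (f n i)) \<le> infsum g (I - F)"
      by (rule infsum_mono[OF nf gr]) (use bd in auto)
    finally show "norm (infsum (f n) I - 0) < e" using N[OF n] tail F(1) by simp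
  qed
qed

lemma mean_of_powers_tendsto:
  assumes "norm (c::complex) \<le> 1"
  shows "(\<lambda>n. (\<Sum>k<n. c ^ k) / of_nat n) \<longlonglongrightarrow> (if c = 1 then 1 else 0)"
proof (cases "c = 1")
  case True
  have "\<forall>\<^sub>F n in sequentially. 1 = (\<Sum>k<n. c ^ k) / of_nat n"
    using eventually_gt_at_top[of 0] by eventually_elim (use True in auto)
  then show ?thesis using True by (auto intro: Lim_transform_eventually)
next
  case False
  have "(\<lambda>n. (\<Sum>k<n. c ^ k) / of_nat n) \<longlonglongrightarrow> 0"
  proof (rule Lim_null_comparison)
    show "\<forall>\<^sub>F n in sequentially. norm ((\<Sum>k<n. c ^ k) / of_nat n) \<le> (2 / norm (1 - c)) * (1 / real n)"
    proof (rule always_eventually, rule allI)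
      fix n
      have "(\<Sum>k<n. c ^ k) = (1 - c ^ n) / (1 - c)" using False by (simp add: sum_gp_strict)
      moreover have "norm (1 - c ^ n) \<le> 2"
        using norm_triangle_ineq4[of 1 "c ^ n"] power_le_one[of "norm c" n] assms
        by (simp add: norm_power)
      ultimately show "norm ((\<Sum>k<n. c ^ k) / of_nat n) \<le> (2 / norm (1 - c)) * (1 / real n)"
        by (auto simp: norm_divide norm_mult intro!: divide_right_mono)
    qed
    show "(\<lambda>n. (2 / norm (1 - c)) * (1 / real n)) \<longlonglongrightarrow> 0"
      by (rule tendsto_mult_right_zero) (rule lim_1_over_n)
  qed
  then show ?thesis using False by simp
qed

text \<open>Of all the terms \<open>c\<^sub>i\<close> of modulus at most 1, averaging over the exponent retains only those equal to 1;
  the limit counts them.\<close>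

lemma cesaro_power_sums:
  fixes c :: "'i \<Rightarrow> complex"
  assumes le: "\<And>i. i \<in> I \<Longrightarrow> norm (c i) \<le> 1" and sm: "(\<lambda>i. norm (c i) ^ k0) summable_on I"
  shows "(\<lambda>n. (\<Sum>k<n. \<Sum>\<^sub>\<infinity>i\<in>I. c i ^ (k0 + k)) / of_nat n) \<longlonglongrightarrow>
    of_real (\<Sum>\<^sub>\<infinity>i\<in>I. if c i = 1 then 1 else 0)"
    and "(\<lambda>i. if c i = 1 then 1 else 0 :: real) summable_on I"
proof -
  have le': "norm (c i) ^ (k0 + k) \<le> norm (c i) ^ k0" if "i \<in> I" for i k
    using le[OF that] by (simp add: power_decreasing)
  have s: "(\<lambda>i. c i ^ (k0 + k)) summable_on I" for k
    by (rule abs_summable_summable, rule summable_on_comparison_test[OF sm])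
       (use le' in \<open>auto simp: norm_power\<close>)
  show d: "(\<lambda>i. if c i = 1 then 1 else 0 :: real) summable_on I"
    by (rule summable_on_comparison_test[OF sm]) auto
  define D where "D = (\<Sum>\<^sub>\<infinity>i\<in>I. if c i = 1 then 1 else 0 :: real)"
  have hD: "((\<lambda>i. if c i = 1 then 1 else 0 :: complex) has_sum of_real D) I"
    using has_sum_of_real[OF has_sum_infsum[OF d], where 'a = complex]
    by (simp add: D_def if_distrib cong: if_cong)
  define f where "f n i = c i ^ k0 * ((\<Sum>k<n. c i ^ k) / of_nat n - (if c i = 1 then 1 else 0))" for n i
  have h1: "((\<lambda>i. \<Sum>k<n. c i ^ (k0 + k)) has_sum (\<Sum>k<n. \<Sum>\<^sub>\<infinity>i\<in>I. c i ^ (k0 + k))) I" for n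
    by (induction n) (auto intro!: has_sum_add has_sum_infsum s)
  have hf: "(f n has_sum ((\<Sum>k<n. \<Sum>\<^sub>\<infinity>i\<in>I. c i ^ (k0 + k)) / of_nat n - of_real D)) I" for n
  proof -
    have "((\<lambda>i. (1 / of_nat n) * (\<Sum>k<n. c i ^ (k0 + k)) - (if c i = 1 then 1 else 0)) has_sum
        ((1 / of_nat n) * (\<Sum>k<n. \<Sum>\<^sub>\<infinity>i\<in>I. c i ^ (k0 + k)) - of_real D)) I"
      by (intro has_sum_minus has_sum_cmult_right h1 hD)
    moreover have "(\<lambda>i. (1 / of_nat n) * (\<Sum>k<n. c i ^ (k0 + k)) - (if c i = 1 then 1 else 0)) = f n"
      by (auto simp: f_def fun_eq_iff power_add sum_distrib_left algebra_simps sum_divide_distrib)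
    ultimately show ?thesis by simp
  qed
  have "(\<lambda>n. infsum (f n) I) \<longlonglongrightarrow> 0"
  proof (rule infsum_dominated_tendsto_0)
    show "(\<lambda>i. 2 * norm (c i) ^ k0) summable_on I" by (intro summable_on_cmult_right sm)
    fix i assume i: "i \<in> I"
    have "(\<lambda>n. f n i) \<longlonglongrightarrow> c i ^ k0 * ((if c i = 1 then 1 else 0) - (if c i = 1 then 1 else 0))"
      unfolding f_def by (intro tendsto_intros mean_of_powers_tendsto le i)
    then show "(\<lambda>n. f n i) \<longlonglongrightarrow> 0" by simp
    fix n
    have "norm (\<Sum>k<n. c i ^ k) \<le> (\<Sum>k<n. 1)"
      by (rule order_trans[OF norm_sum sum_mono]) (auto simp: norm_power le[OF i] power_le_one)
    then have "norm ((\<Sum>k<n. c i ^ k) / of_nat n) \<le> 1"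
      by (auto simp: norm_divide divide_le_eq)
    moreover have "norm (if c i = 1 then 1 else 0 :: complex) \<le> 1" by auto
    ultimately have "norm ((\<Sum>k<n. c i ^ k) / of_nat n - (if c i = 1 then 1 else 0)) \<le> 2"
      using norm_triangle_ineq4[of "(\<Sum>k<n. c i ^ k) / of_nat n" "if c i = 1 then 1 else 0"] by linarith
    then show "norm (f n i) \<le> 2 * norm (c i) ^ k0"
      unfolding f_def norm_mult norm_power by (subst mult.commute) (rule mult_right_mono, auto)
  qed
  then have "(\<lambda>n. (\<Sum>k<n. \<Sum>\<^sub>\<infinity>i\<in>I. c i ^ (k0 + k)) / of_nat n - of_real D) \<longlonglongrightarrow> 0"
    by (simp add: infsumI[OF hf])
  then show "(\<lambda>n. (\<Sum>k<n. \<Sum>\<^sub>\<infinity>i\<in>I. c i ^ (k0 + k)) / of_nat n) \<longlonglongrightarrow> of_real D"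
    by (simp add: LIM_zero_iff)
qed

lemma summable_on_finite_superlevel:
  fixes g :: "'i \<Rightarrow> real"
  assumes "g summable_on I" "\<And>i. i \<in> I \<Longrightarrow> g i \<ge> 0" "t > 0"
  shows "finite {i\<in>I. g i \<ge> t}"
proof (rule ccontr)
  assume inf: "infinite {i\<in>I. g i \<ge> t}"
  obtain n :: nat where n: "real n * t > infsum g I"
    using assms(3) reals_Archimedean3 by blast
  obtain A where A: "A \<subseteq> {i\<in>I. g i \<ge> t}" "finite A" "card A = n"
    using infinite_arbitrarily_large[OF inf] by blast
  have "real n * t \<le> sum g A" using sum_mono[of A "\<lambda>_. t" g] A by auto
  also have "\<dots> \<le> infsum g I" by (rule finite_sum_le_infsum) (use A assms in auto)
  finally show False using n by simp
qed

lemma summable_power_max: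
  fixes a :: "'i \<Rightarrow> complex"
  assumes "(\<lambda>i. norm (a i) ^ k0) summable_on I" "i0 \<in> I" "a i0 \<noteq> 0"
  obtains i where "i \<in> I" "\<And>j. j \<in> I \<Longrightarrow> norm (a j) \<le> norm (a i)"
proof -
  let ?F = "{i\<in>I. norm (a i) ^ k0 \<ge> norm (a i0) ^ k0}"
  have "finite ?F" by (rule summable_on_finite_superlevel[OF assms(1)]) (use assms in auto)
  moreover have i0F: "i0 \<in> ?F" using assms by auto
  ultimately have fin: "finite ((\<lambda>i. norm (a i)) ` ?F)" and "(\<lambda>i. norm (a i)) ` ?F \<noteq> {}" by auto
  from Max_in[OF this] obtain i where "i \<in> ?F" "Max ((\<lambda>i. norm (a i)) ` ?F) = norm (a i)" by blast
  with Max_ge[OF fin] have i: "i \<in> ?F" "\<And>j. j \<in> ?F \<Longrightarrow> norm (a j) \<le> norm (a i)" by auto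
  have "norm (a j) \<le> norm (a i)" if "j \<in> I" for j
  proof (cases "j \<in> ?F")
    case False
    then have "norm (a j) ^ k0 < norm (a i0) ^ k0" using that by auto
    then have "norm (a j) < norm (a i0)" by (rule power_less_imp_less_base) simp
    then show ?thesis using i(2)[OF i0F] by linarith
  qed (use i in auto)
  then show ?thesis using i(1) that by auto
qed

lemma infsum_power_scale:
  fixes a :: "'i \<Rightarrow> complex"
  shows "(\<Sum>\<^sub>\<infinity>i\<in>I. (a i / \<beta>) ^ k) = (\<Sum>\<^sub>\<infinity>i\<in>I. a i ^ k) / \<beta> ^ k"
  using infsum_cmult_left'[of "\<lambda>i. a i ^ k" "1 / \<beta> ^ k" I] by (simp add: power_divide)

lemma multiplicity_pos:
  assumes "(\<lambda>i. if c i = (1::complex) then 1 else 0 :: real) summable_on I" "i \<in> I" "c i = 1"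
  shows "(\<Sum>\<^sub>\<infinity>i\<in>I. if c i = 1 then 1 else 0 :: real) > 0"
proof -
  have "(\<Sum>i\<in>{i}. if c i = 1 then 1 else 0 :: real) \<le> (\<Sum>\<^sub>\<infinity>i\<in>I. if c i = 1 then 1 else 0 :: real)"
    by (rule finite_sum_le_infsum) (use assms in auto)
  then show ?thesis using assms by simp
qed

text \<open>After division by a term of largest modulus the Cesaro means tend to the positive multiplicity of
  that term.  If it were larger than \<open>M\<close>, the assumed bound would decay geometrically and force the
  means to 0.\<close>

lemma power_sums_bound:
  fixes a :: "'i \<Rightarrow> complex"
  assumes sm: "(\<lambda>i. norm (a i) ^ k0) summable_on I"
    and bd: "\<And>k. k \<ge> k0 \<Longrightarrow> norm (\<Sum>\<^sub>\<infinity>i\<in>I. a i ^ k) \<le> B * M ^ k"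
    and "M \<ge> 0" "i \<in> I"
  shows "norm (a i) \<le> M"
proof (rule ccontr)
  assume less: "\<not> norm (a i) \<le> M"
  then have "a i \<noteq> 0" using assms(3) by auto
  then obtain j where j: "j \<in> I" "\<And>l. l \<in> I \<Longrightarrow> norm (a l) \<le> norm (a j)"
    using summable_power_max[OF sm \<open>i \<in> I\<close>] by blast
  define \<beta> where "\<beta> = a j"
  have \<beta>: "norm \<beta> > M" using less j(2)[OF \<open>i \<in> I\<close>] by (simp add: \<beta>_def)
  then have \<beta>0: "norm \<beta> > 0" "\<beta> \<noteq> 0" using assms(3) by auto
  define c where "c l = a l / \<beta>" for l
  have c1: "norm (c l) \<le> 1" if "l \<in> I" for l
    using j(2)[OF that] \<beta>0 by (simp add: c_def norm_divide \<beta>_def)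
  have sc: "(\<lambda>l. norm (c l) ^ k0) summable_on I"
    using summable_on_cmult_right[OF sm, of "1 / norm \<beta> ^ k0"]
    by (simp add: c_def norm_divide power_divide)
  define q where "q = M / norm \<beta>"
  have q: "0 \<le> q" "q < 1" using \<beta> \<beta>0 assms(3) by (auto simp: q_def)
  have U: "norm (\<Sum>\<^sub>\<infinity>l\<in>I. c l ^ (k0 + k)) \<le> \<bar>B\<bar> * q ^ k" for k
  proof -
    have "norm (\<Sum>\<^sub>\<infinity>l\<in>I. c l ^ (k0 + k)) = norm (\<Sum>\<^sub>\<infinity>l\<in>I. a l ^ (k0 + k)) / norm \<beta> ^ (k0 + k)"
      unfolding c_def infsum_power_scale by (simp add: norm_divide norm_power)
    also have "\<dots> \<le> (B * M ^ (k0 + k)) / norm \<beta> ^ (k0 + k)"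
      by (intro divide_right_mono bd) auto
    also have "\<dots> = B * q ^ (k0 + k)" by (simp add: q_def power_divide)
    also have "\<dots> \<le> \<bar>B\<bar> * q ^ (k0 + k)" using q by (intro mult_right_mono) auto
    also have "\<dots> \<le> \<bar>B\<bar> * q ^ k" using q by (intro mult_left_mono power_decreasing) auto
    finally show ?thesis .
  qed
  have "(\<lambda>n. (\<Sum>k<n. \<Sum>\<^sub>\<infinity>l\<in>I. c l ^ (k0 + k)) / of_nat n) \<longlonglongrightarrow> 0"
  proof (rule Lim_null_comparison)
    show "\<forall>\<^sub>F n in sequentially. norm ((\<Sum>k<n. \<Sum>\<^sub>\<infinity>l\<in>I. c l ^ (k0 + k)) / of_nat n)
        \<le> (\<bar>B\<bar> / (1 - q)) * (1 / real n)"
    proof (rule always_eventually, rule allI)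
      fix n
      have "norm (\<Sum>k<n. \<Sum>\<^sub>\<infinity>l\<in>I. c l ^ (k0 + k)) \<le> (\<Sum>k<n. \<bar>B\<bar> * q ^ k)"
        by (rule order_trans[OF norm_sum sum_mono]) (rule U)
      also have "\<dots> = \<bar>B\<bar> * ((1 - q ^ n) / (1 - q))"
        using q by (simp add: sum_gp_strict flip: sum_distrib_left)
      also have "\<dots> \<le> \<bar>B\<bar> * (1 / (1 - q))"
        using q by (intro mult_left_mono divide_right_mono) auto
      finally show "norm ((\<Sum>k<n. \<Sum>\<^sub>\<infinity>l\<in>I. c l ^ (k0 + k)) / of_nat n)
        \<le> (\<bar>B\<bar> / (1 - q)) * (1 / real n)"
        using divide_right_mono[of _ "\<bar>B\<bar> * (1 / (1 - q))" "real n"] by (simp add: norm_divide)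
    qed
    show "(\<lambda>n. (\<bar>B\<bar> / (1 - q)) * (1 / real n)) \<longlonglongrightarrow> 0"
      by (rule tendsto_mult_right_zero) (rule lim_1_over_n)
  qed
  from LIMSEQ_unique[OF this cesaro_power_sums(1)[OF c1 sc]]
  have "(\<Sum>\<^sub>\<infinity>i\<in>I. if c i = 1 then 1 else 0 :: real) = 0" by simp
  moreover have "(\<Sum>\<^sub>\<infinity>i\<in>I. if c i = 1 then 1 else 0 :: real) > 0"
    by (rule multiplicity_pos[OF cesaro_power_sums(2)[OF c1 sc] j(1)]) (use \<beta>0 in \<open>auto simp: c_def \<beta>_def\<close>)
  ultimately show False by simp
qed

text \<open>Equal power sums give the common largest value the same multiplicity in both families.\<close>

lemma equal_power_sums_max:
  fixes a :: "'i \<Rightarrow> complex" and b :: "'j \<Rightarrow> complex"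
  assumes sa: "(\<lambda>i. norm (a i) ^ k0) summable_on I" and sb: "(\<lambda>j. norm (b j) ^ k0) summable_on J"
    and eq: "\<And>k. k \<ge> k0 \<Longrightarrow> (\<Sum>\<^sub>\<infinity>i\<in>I. a i ^ k) = (\<Sum>\<^sub>\<infinity>j\<in>J. b j ^ k)"
    and i: "i \<in> I" "a i \<noteq> 0" "\<And>l. l \<in> I \<Longrightarrow> norm (a l) \<le> norm (a i)" "\<And>l. l \<in> J \<Longrightarrow> norm (b l) \<le> norm (a i)"
  shows "\<exists>j\<in>J. b j = a i"
proof (rule ccontr)
  assume none: "\<not> (\<exists>j\<in>J. b j = a i)"
  have 1: "norm (a l / a i) \<le> 1" if "l \<in> I" for l using i(2) i(3)[OF that] by (simp add: norm_divide)
  have 2: "norm (b l / a i) \<le> 1" if "l \<in> J" for l using i(2) i(4)[OF that] by (simp add: norm_divide)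
  have s1: "(\<lambda>l. norm (a l / a i) ^ k0) summable_on I"
    using summable_on_cmult_right[OF sa, of "1 / norm (a i) ^ k0"] by (simp add: norm_divide power_divide)
  have s2: "(\<lambda>l. norm (b l / a i) ^ k0) summable_on J"
    using summable_on_cmult_right[OF sb, of "1 / norm (a i) ^ k0"] by (simp add: norm_divide power_divide)
  have "(\<Sum>\<^sub>\<infinity>l\<in>I. (a l / a i) ^ (k0 + k)) = (\<Sum>\<^sub>\<infinity>l\<in>J. (b l / a i) ^ (k0 + k))" for k
    unfolding infsum_power_scale using eq[of "k0 + k"] by simp
  then have "complex_of_real (\<Sum>\<^sub>\<infinity>l\<in>I. if a l / a i = 1 then 1 else 0)
      = of_real (\<Sum>\<^sub>\<infinity>l\<in>J. if b l / a i = 1 then 1 else 0)"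
    by (intro LIMSEQ_unique[OF _ cesaro_power_sums(1)[OF 2 s2]])
       (use cesaro_power_sums(1)[OF 1 s1] in simp)
  then have "(\<Sum>\<^sub>\<infinity>l\<in>I. if a l / a i = 1 then 1 else 0 :: real) = (\<Sum>\<^sub>\<infinity>l\<in>J. if b l / a i = 1 then 1 else 0 :: real)"
    by (simp only: of_real_eq_iff)
  also have "\<dots> = 0" by (rule infsum_0) (use none i(2) in auto)
  finally show False using multiplicity_pos[OF cesaro_power_sums(2)[OF 1 s1] i(1)] i(2) by simp
qed

lemma equal_power_sums_common:
  fixes a :: "'i \<Rightarrow> complex" and b :: "'j \<Rightarrow> complex"
  assumes sa: "(\<lambda>i. norm (a i) ^ k0) summable_on I" and sb: "(\<lambda>j. norm (b j) ^ k0) summable_on J"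
    and eq: "\<And>k. k \<ge> k0 \<Longrightarrow> (\<Sum>\<^sub>\<infinity>i\<in>I. a i ^ k) = (\<Sum>\<^sub>\<infinity>j\<in>J. b j ^ k)"
    and "i0 \<in> I" "a i0 \<noteq> 0" "j0 \<in> J" "b j0 \<noteq> 0"
  shows "\<exists>i\<in>I. \<exists>j\<in>J. a i = b j"
proof -
  obtain i where i: "i \<in> I" "\<And>j. j \<in> I \<Longrightarrow> norm (a j) \<le> norm (a i)"
    using summable_power_max[OF sa assms(4,5)] by blast
  obtain j where j: "j \<in> J" "\<And>l. l \<in> J \<Longrightarrow> norm (b l) \<le> norm (b j)"
    using summable_power_max[OF sb assms(6,7)] by blast
  have nz: "a i \<noteq> 0" "b j \<noteq> 0" using i(2)[OF assms(4)] j(2)[OF assms(6)] assms by auto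
  show ?thesis
  proof (cases "norm (b j) \<le> norm (a i)")
    case True
    have "\<exists>j\<in>J. b j = a i"
      by (rule equal_power_sums_max[OF sa sb eq i(1) nz(1) i(2)]) (use True j(2) in force)+
    then show ?thesis using i(1) by metis
  next
    case False
    have "\<exists>i\<in>I. a i = b j"
      by (rule equal_power_sums_max[OF sb sa eq[symmetric] j(1) nz(2) j(2)]) (use False i(2) in force)+
    then show ?thesis using j(1) by metis
  qed
qed

section \<open>Summability over lattices\<close>

lemma summable_int_powr:
  assumes "s > 1"
  shows "(\<lambda>n::int. (1 + \<bar>real_of_int n\<bar>) powr (-s)) summable_on UNIV"
proof -
  have "summable (\<lambda>n. of_nat (n + 1) powr (-s) :: real)"
    using assms summable_real_powr_iff[of "-s"] by (subst summable_iff_shift) simp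
  then have nat: "(\<lambda>n::nat. (1 + real n) powr (-s)) summable_on UNIV"
    by (subst summable_on_UNIV_nonneg_real_iff) (auto simp: add.commute)
  let ?f = "\<lambda>n::int. (1 + \<bar>real_of_int n\<bar>) powr (-s)"
  have 1: "?f summable_on range int"
    using nat by (subst summable_on_reindex) (auto simp: o_def)
  have 2: "?f summable_on range (\<lambda>n. - int n)"
    using nat by (subst summable_on_reindex) (auto simp: o_def inj_def)
  have "x \<in> range int \<union> range (\<lambda>n. - int n)" for x :: int
    by (cases x rule: int_cases2) auto
  then have "range int \<union> range (\<lambda>n. - int n) = UNIV" by blast
  then show ?thesis using summable_on_union[OF 1 2] by simp
qed

lemma summable_on_prod_mult:
  fixes f :: "'i \<Rightarrow> real" and g :: "'j \<Rightarrow> real"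
  assumes "f summable_on UNIV" "g summable_on UNIV" "\<And>x. f x \<ge> 0" "\<And>x. g x \<ge> 0"
  shows "(\<lambda>(x, y). f x * g y) summable_on UNIV"
proof -
  have "(\<lambda>(x, y). f x * g y) summable_on Sigma UNIV (\<lambda>_. UNIV)"
  proof (rule summable_on_SigmaI)
    show "((\<lambda>y. case (x, y) of (x, y) \<Rightarrow> f x * g y) has_sum f x * infsum g UNIV) UNIV" for x
      by (auto intro: has_sum_cmult_right has_sum_infsum assms)
    show "(\<lambda>x. f x * infsum g UNIV) summable_on UNIV"
      by (intro summable_on_cmult_left assms)
  qed (use assms in auto)
  then show ?thesis by simp
qed

lemma summable_int_pair_powr:
  assumes "s > 2"
  shows "(\<lambda>(m::int, n::int). (1 + \<bar>real_of_int m\<bar> + \<bar>real_of_int n\<bar>) powr (-s)) summable_on UNIV"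
proof (rule summable_on_comparison_test)
  let ?f = "\<lambda>n::int. (1 + \<bar>real_of_int n\<bar>) powr (-(s/2))"
  show "(\<lambda>(m, n). ?f m * ?f n) summable_on UNIV"
    by (rule summable_on_prod_mult[OF summable_int_powr summable_int_powr]) (use assms in auto)
  fix p :: "int \<times> int"
  obtain m n where p: "p = (m, n)" by (cases p)
  let ?t = "1 + \<bar>real_of_int m\<bar> + \<bar>real_of_int n\<bar>"
  have "?t powr (-s) = ?t powr (-(s/2)) * ?t powr (-(s/2))" by (simp flip: powr_add)
  also have "\<dots> \<le> ?f m * ?f n"
    using assms by (intro mult_mono powr_mono2') auto
  finally show "(case p of (m, n) \<Rightarrow> (1 + \<bar>real_of_int m\<bar> + \<bar>real_of_int n\<bar>) powr (-s))
      \<le> (case p of (m, n) \<Rightarrow> ?f m * ?f n)" by (simp add: p)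
qed auto

section \<open>Pairs of complex numbers that are independent over the reals\<close>

text \<open>The signed covolume of the lattice spanned by the coordinates; it is nonzero if and only if they are
  independent over the reals.\<close>

definition orient :: "complex ^ 2 \<Rightarrow> real" where
  "orient u = Im (u $ 1 * cnj (u $ 2))"

definition rvec :: "real \<Rightarrow> real \<Rightarrow> complex ^ 2" where
  "rvec x y = vector [of_real x, of_real y]"

lemma norm_vec2: "norm (u :: complex ^ 2) = sqrt (norm (u $ 1) ^ 2 + norm (u $ 2) ^ 2)"
  by (simp add: norm_vec_def L2_set_def sum_2)

lemma norm_rvec: "norm (rvec x y) = sqrt (x ^ 2 + y ^ 2)"
  by (simp add: norm_vec2 rvec_def)

lemma rvec_nth [simp]: "rvec x y $ 1 = of_real x" "rvec x y $ 2 = of_real y"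
  by (simp_all add: rvec_def)

lemma rvec_eq_iff [simp]: "rvec x y = rvec x' y' \<longleftrightarrow> x = x' \<and> y = y'"
  by (auto simp: vec_eq_iff forall_2)

lemma rvec_eq_0_iff [simp]: "rvec x y = 0 \<longleftrightarrow> x = 0 \<and> y = 0"
  by (auto simp: vec_eq_iff forall_2)

lemma bil_2: "bil \<rho> (u :: complex ^ 2) = \<rho> $ 1 * u $ 1 + \<rho> $ 2 * u $ 2"
  by (simp add: bil_def sum_2)

lemma bil_rvec: "bil (rvec x y) u = of_real x * u $ 1 + of_real y * u $ 2"
  by (simp add: bil_2)

text \<open>For \<open>z = x u\<^sub>1 + y u\<^sub>2\<close> with real \<open>x, y\<close>, the imaginary parts of \<open>z\<close> times the conjugates of \<open>u\<^sub>2\<close> and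
  \<open>u\<^sub>1\<close> are \<open>x\<close> and \<open>- y\<close> times the orientation.\<close>

lemma norm_bil_rvec_ge: "\<bar>orient u\<bar> * norm (rvec x y) \<le> norm u * norm (bil (rvec x y) u)"
proof -
  define z where "z = bil (rvec x y) u"
  have z: "z = of_real x * u $ 1 + of_real y * u $ 2" by (simp add: z_def bil_rvec)
  have "Im (z * cnj (u $ 2)) = x * orient u" by (simp add: z orient_def algebra_simps)
  then have 1: "\<bar>x * orient u\<bar> \<le> norm z * norm (u $ 2)"
    using abs_Im_le_cmod[of "z * cnj (u $ 2)"] by (simp add: norm_mult)
  have "Im (z * cnj (u $ 1)) = - (y * orient u)" by (simp add: z orient_def algebra_simps)
  then have 2: "\<bar>y * orient u\<bar> \<le> norm z * norm (u $ 1)"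
    using abs_Im_le_cmod[of "z * cnj (u $ 1)"] by (simp add: norm_mult)
  have "(\<bar>orient u\<bar> * norm (rvec x y)) ^ 2 = \<bar>x * orient u\<bar> ^ 2 + \<bar>y * orient u\<bar> ^ 2"
    by (simp add: norm_rvec power_mult_distrib algebra_simps)
  also have "\<dots> \<le> (norm z * norm (u $ 2)) ^ 2 + (norm z * norm (u $ 1)) ^ 2"
    by (intro add_mono power_mono 1 2) auto
  also have "\<dots> = (norm u * norm z) ^ 2"
    by (simp add: norm_vec2 power_mult_distrib algebra_simps)
  finally show ?thesis unfolding z_def by (rule power2_le_imp_le) simp
qed

lemma norm_bil_rvec_ge':
  assumes "orient u \<noteq> 0"
  obtains c where "c > 0" "\<And>x y. c * norm (rvec x y) \<le> norm (bil (rvec x y) u)"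
proof
  have u: "norm u > 0" using assms by (auto simp: orient_def)
  then show "\<bar>orient u\<bar> / norm u > 0" using assms by simp
  show "\<bar>orient u\<bar> / norm u * norm (rvec x y) \<le> norm (bil (rvec x y) u)" for x y
    using norm_bil_rvec_ge[of u x y] u by (simp add: field_simps)
qed

lemma finite_int_rvec_bounded: "finite {(m::int, n::int). norm (rvec m n) \<le> K}"
proof (rule finite_subset)
  show "{(m::int, n::int). norm (rvec m n) \<le> K} \<subseteq> {-\<lfloor>K\<rfloor>..\<lfloor>K\<rfloor>} \<times> {-\<lfloor>K\<rfloor>..\<lfloor>K\<rfloor>}"
  proof safe
    fix m n :: int assume "norm (rvec m n) \<le> K"
    moreover have "\<bar>real_of_int m\<bar> \<le> norm (rvec m n)" "\<bar>real_of_int n\<bar> \<le> norm (rvec m n)"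
      unfolding norm_rvec by (auto intro!: real_le_rsqrt)
    ultimately have "\<bar>real_of_int m\<bar> \<le> K" "\<bar>real_of_int n\<bar> \<le> K" by auto
    then show "m \<in> {-\<lfloor>K\<rfloor>..\<lfloor>K\<rfloor>}" "n \<in> {-\<lfloor>K\<rfloor>..\<lfloor>K\<rfloor>}" by (auto simp: abs_le_iff) linarith+
  qed
qed simp

text \<open>A finite part of the family cannot destroy separation unless one of its forms vanishes at \<open>u\<close>.\<close>

lemma separated_from_finite:
  assumes "finite F" "separated_from (R - F) u" "\<And>\<rho>. \<rho> \<in> F \<inter> R \<Longrightarrow> bil \<rho> u \<noteq> 0"
  shows "separated_from R u"
proof -
  obtain c where c: "c > 0" "\<And>\<rho>. \<rho> \<in> R - F \<Longrightarrow> c * norm \<rho> \<le> norm (bil \<rho> u)"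
    using assms(2) by (auto simp: separated_from_def)
  define D where "D = insert c ((\<lambda>\<rho>. norm (bil \<rho> u) / (norm \<rho> + 1)) ` (F \<inter> R))"
  have "finite D" "D \<noteq> {}" using assms(1) by (auto simp: D_def)
  have "0 < norm (bil \<rho> u) / (norm \<rho> + 1)" if "\<rho> \<in> F \<inter> R" for \<rho>
    using assms(3)[OF that] by (intro divide_pos_pos) (auto intro: add_nonneg_pos)
  then have pos: "Min D > 0" using \<open>finite D\<close> \<open>D \<noteq> {}\<close> c(1) by (auto simp: D_def Min_gr_iff)
  show ?thesis unfolding separated_from_def
  proof (intro exI[of _ "Min D"] conjI ballI pos)
    fix \<rho> assume \<rho>: "\<rho> \<in> R"
    show "Min D * norm \<rho> \<le> norm (bil \<rho> u)"
    proof (cases "\<rho> \<in> F")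
      case True
      have "Min D \<le> norm (bil \<rho> u) / (norm \<rho> + 1)"
        using \<open>finite D\<close> True \<rho> by (intro Min_le) (auto simp: D_def)
      then have "Min D * (norm \<rho> + 1) \<le> norm (bil \<rho> u)" by (subst (asm) pos_le_divide_eq) (auto intro: add_nonneg_pos)
      then show ?thesis using pos by (simp add: algebra_simps)
    next
      case False
      have "Min D \<le> c" using \<open>finite D\<close> by (intro Min_le) (auto simp: D_def)
      then have "Min D * norm \<rho> \<le> c * norm \<rho>" by (rule mult_right_mono) simp
      then show ?thesis using c(2)[of \<rho>] False \<rho> by auto
    qed
  qed
qed

section \<open>The zeros of the derivative of the Weierstrass function\<close>

definition lat :: "complex \<Rightarrow> complex \<Rightarrow> complex set" where
  "lat \<alpha> \<beta> = {of_int m * \<alpha> + of_int n * \<beta> |m n. True}"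

text \<open>Rows on \<open>\<complex>\<^sup>3\<close> whose value at \<open>(z, \<alpha>, \<beta>)\<close> is \<open>z\<close> plus a lattice vector, so that a series in \<open>z\<close> over
  the lattice becomes a sum of inverse powers of linear forms.\<close>

definition arow :: "int \<times> int \<Rightarrow> complex ^ 3" where
  "arow p = vector [1, of_int (fst p), of_int (snd p)]"

text \<open>The sum of \<open>(z + \<lambda>)\<^bsup>-3\<^esup>\<close> over the lattice, that is, \<open>-1/2\<close> times the derivative of the Weierstrass
  function.\<close>

definition eisenstein3 :: "complex \<Rightarrow> complex \<Rightarrow> complex \<Rightarrow> complex" where
  "eisenstein3 \<alpha> \<beta> z = inv_power_sum 3 (range arow) (vector [z, \<alpha>, \<beta>])"

lemma bil_arow: "bil (arow (m, n)) (vector [z, \<alpha>, \<beta>]) = z + of_int m * \<alpha> + of_int n * \<beta>"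
  by (simp add: bil_def sum_3 arow_def)

lemma inj_arow: "inj arow"
  by (auto simp: inj_def arow_def vec_eq_iff forall_3)

lemma arow_nonzero: "0 \<notin> arow ` I"
  by (auto simp: arow_def vec_eq_iff forall_3)

lemma norm_arow: "norm (arow (m, n)) = sqrt (1 + real_of_int m ^ 2 + real_of_int n ^ 2)"
  by (simp add: norm_vec_def L2_set_def sum_3 arow_def)

lemma arow_summable: "(\<lambda>\<rho>. 1 / norm \<rho> ^ 3) summable_on (arow ` I)"
proof -
  have "((\<lambda>\<rho>. 1 / norm \<rho> ^ 3) \<circ> arow) summable_on UNIV"
  proof (rule summable_on_comparison_test)
    show "(\<lambda>p. 27 * (case p of (m::int, n::int) \<Rightarrow>
        (1 + \<bar>real_of_int m\<bar> + \<bar>real_of_int n\<bar>) powr (-3))) summable_on UNIV"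
      by (intro summable_on_cmult_right summable_int_pair_powr) simp
    fix p :: "int \<times> int" obtain m n where p: "p = (m, n)" by (cases p)
    let ?t = "1 + \<bar>real_of_int m\<bar> + \<bar>real_of_int n\<bar>"
    have "\<bar>real_of_int m\<bar> \<le> norm (arow p)" "\<bar>real_of_int n\<bar> \<le> norm (arow p)" "1 \<le> norm (arow p)"
      unfolding p norm_arow by (auto intro!: real_le_rsqrt)
    then have "?t / 3 \<le> norm (arow p)" by simp
    then have "(?t / 3) ^ 3 \<le> norm (arow p) ^ 3" by (intro power_mono) auto
    then have "1 / norm (arow p) ^ 3 \<le> 1 / (?t / 3) ^ 3"
      by (intro divide_left_mono) (auto intro!: mult_pos_pos zero_less_power)
    also have "\<dots> = 27 * ?t powr (-3)"
    proof -
      have "1 / (t / 3) ^ 3 = 27 * t powr (-3)" if "t > 0" for t :: real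
        using that powr_realpow[of t 3] by (simp add: powr_minus_divide power_divide)
      then show ?thesis by this simp
    qed
    finally show "((\<lambda>\<rho>. 1 / norm \<rho> ^ 3) \<circ> arow) p \<le>
       27 * (case p of (m::int, n::int) \<Rightarrow> (1 + \<bar>real_of_int m\<bar> + \<bar>real_of_int n\<bar>) powr (-3))"
      by (simp add: p)
  qed auto
  then have "(\<lambda>\<rho>. 1 / norm \<rho> ^ 3) summable_on (range arow)"
    by (subst summable_on_reindex[OF inj_arow])
  then show ?thesis by (rule summable_on_subset) auto
qed

lemma cdiff_first_coordinate:
  assumes "cdiff F (vector [z, \<alpha>, \<beta>] :: complex ^ 3)"
  shows "(\<lambda>z. F (vector [z, \<alpha>, \<beta>])) field_differentiable (at z)"
proof -
  obtain F' where F': "(F has_derivative F') (at (vector [z, \<alpha>, \<beta>]))" "\<And>c v. F' (c *s v) = c * F' v"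
    using assms by (auto simp: cdiff_def)
  have "((\<lambda>z. vector [z, \<alpha>, \<beta>] :: complex ^ 3) has_derivative (\<lambda>h. h *s vector [1, 0, 0])) (at z)"
  proof (rule has_derivative_vec)
    fix i :: 3
    show "((\<lambda>x. (vector [x, \<alpha>, \<beta>] :: complex ^ 3) $ i) has_derivative
          (\<lambda>h. (h *s vector [1, 0, 0] :: complex ^ 3) $ i)) (at z)"
      using exhaust_3[of i] by (auto intro!: derivative_eq_intros)
  qed
  from has_derivative_compose[OF this F'(1)]
  have "((\<lambda>z. F (vector [z, \<alpha>, \<beta>])) has_derivative (\<lambda>h. F' (vector [1, 0, 0]) * h)) (at z)"
    by (simp add: F'(2) mult.commute)
  then show ?thesis
    unfolding field_differentiable_def has_field_derivative_def by blast
qed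

context
  fixes \<alpha> \<beta> :: complex
  assumes nondeg: "Im (\<alpha> * cnj \<beta>) \<noteq> 0"
begin

lemma lat_bound:
  obtains c where "c > 0" "\<And>m n :: int. c * norm (rvec m n) \<le> norm (of_int m * \<alpha> + of_int n * \<beta>)"
proof -
  have "orient (vector [\<alpha>, \<beta>]) \<noteq> 0" using nondeg by (simp add: orient_def)
  then obtain c where "c > 0" "\<And>x y. c * norm (rvec x y) \<le> norm (bil (rvec x y) (vector [\<alpha>, \<beta>]))"
    using norm_bil_rvec_ge' by blast
  moreover have "c * norm (rvec m n) \<le> norm (of_int m * \<alpha> + of_int n * \<beta>)" for m n :: int
    using calculation(2)[of "of_int m" "of_int n"] by (simp add: bil_rvec)
  ultimately show ?thesis using that by blast
qed

lemma lat_add: "x \<in> lat \<alpha> \<beta> \<Longrightarrow> y \<in> lat \<alpha> \<beta> \<Longrightarrow> x + y \<in> lat \<alpha> \<beta>"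
proof -
  assume "x \<in> lat \<alpha> \<beta>" "y \<in> lat \<alpha> \<beta>"
  then obtain m n m' n' where "x = of_int m * \<alpha> + of_int n * \<beta>" "y = of_int m' * \<alpha> + of_int n' * \<beta>"
    by (auto simp: lat_def)
  then have "x + y = of_int (m + m') * \<alpha> + of_int (n + n') * \<beta>" by (simp add: algebra_simps)
  then show ?thesis unfolding lat_def by blast
qed

lemma lat_uminus: "x \<in> lat \<alpha> \<beta> \<Longrightarrow> - x \<in> lat \<alpha> \<beta>"
proof -
  assume "x \<in> lat \<alpha> \<beta>"
  then obtain m n where "x = of_int m * \<alpha> + of_int n * \<beta>"
    by (auto simp: lat_def)
  then have "- x = of_int (- m) * \<alpha> + of_int (- n) * \<beta>" by (simp add: algebra_simps)
  then show ?thesis unfolding lat_def by blast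
qed

lemma lat_diff: "x \<in> lat \<alpha> \<beta> \<Longrightarrow> y \<in> lat \<alpha> \<beta> \<Longrightarrow> x - y \<in> lat \<alpha> \<beta>"
  using lat_add[of x "- y"] lat_uminus[of y] by simp

lemma countable_lat: "countable (lat \<alpha> \<beta>)"
proof -
  have "lat \<alpha> \<beta> = range (\<lambda>(m, n). of_int m * \<alpha> + of_int n * \<beta>)" by (auto simp: lat_def)
  then show ?thesis by simp
qed

lemma lat_discrete:
  obtains d where "d > 0" "\<And>x. x \<in> lat \<alpha> \<beta> \<Longrightarrow> x \<noteq> 0 \<Longrightarrow> norm x \<ge> d"
proof -
  obtain c where c: "c > 0" "\<And>m n :: int. c * norm (rvec m n) \<le> norm (of_int m * \<alpha> + of_int n * \<beta>)"
    using lat_bound by blast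
  have "norm x \<ge> c" if x: "x \<in> lat \<alpha> \<beta>" "x \<noteq> 0" for x
  proof -
    obtain m n where mn: "x = of_int m * \<alpha> + of_int n * \<beta>" using x by (auto simp: lat_def)
    then have "m \<noteq> 0 \<or> n \<noteq> 0" using x by auto
    then have "0 < m ^ 2 + n ^ 2" by (simp add: sum_power2_gt_zero_iff)
    then have "1 \<le> real_of_int (m ^ 2 + n ^ 2)" by linarith
    then have "1 \<le> real_of_int m ^ 2 + real_of_int n ^ 2" by simp
    then have "1 \<le> norm (rvec m n)" by (simp add: norm_rvec)
    then have "c \<le> c * norm (rvec m n)" using c(1) by simp
    then show ?thesis using c(2)[of m n] mn by simp
  qed
  then show ?thesis using that c(1) by blast
qed

lemma closed_lat_subset: "A \<subseteq> lat \<alpha> \<beta> \<Longrightarrow> closed A"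
proof -
  assume A: "A \<subseteq> lat \<alpha> \<beta>"
  obtain d where d: "d > 0" "\<And>x. x \<in> lat \<alpha> \<beta> \<Longrightarrow> x \<noteq> 0 \<Longrightarrow> norm x \<ge> d" using lat_discrete by blast
  show "closed A"
  proof (rule discrete_imp_closed[OF d(1)], intro ballI impI)
    fix x y assume "x \<in> A" "y \<in> A" "dist y x < d"
    then show "y = x" using d(2)[of "y - x"] lat_diff[of y x] A by (auto simp: dist_norm subset_iff)
  qed
qed

lemma separated_arow:
  assumes "\<And>m n. (m, n) \<in> I \<Longrightarrow> z + of_int m * \<alpha> + of_int n * \<beta> \<noteq> 0"
  shows "separated_from (arow ` I) (vector [z, \<alpha>, \<beta>])"
proof -
  obtain c where c: "c > 0" "\<And>m n :: int. c * norm (rvec m n) \<le> norm (of_int m * \<alpha> + of_int n * \<beta>)"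
    using lat_bound by blast
  define K where "K = max 1 (2 * norm z / c)"
  define F where "F = arow ` {(m::int, n::int). norm (rvec m n) \<le> K}"
  show ?thesis
  proof (rule separated_from_finite)
    show "finite F" unfolding F_def by (intro finite_imageI finite_int_rvec_bounded)
    show "bil \<rho> (vector [z, \<alpha>, \<beta>]) \<noteq> 0" if "\<rho> \<in> F \<inter> arow ` I" for \<rho>
      using that assms by (auto simp: bil_arow)
    show "separated_from (arow ` I - F) (vector [z, \<alpha>, \<beta>])"
      unfolding separated_from_def
    proof (intro exI[of _ "c / 4"] conjI ballI)
      fix \<rho> assume "\<rho> \<in> arow ` I - F"
      then obtain m n where \<rho>: "\<rho> = arow (m, n)" "norm (rvec m n) > K"
        unfolding F_def by (force simp: not_le)
      have K1: "norm (rvec m n) \<ge> 1" and K2: "norm z \<le> c / 2 * norm (rvec m n)"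
        using \<rho>(2) c(1) by (auto simp: K_def field_simps)
      have "norm (arow (m, n)) \<le> 2 * norm (rvec m n)"
      proof (rule power2_le_imp_le)
        have "1 \<le> (norm (rvec m n))\<^sup>2" using K1 by (simp add: one_le_power)
        then show "(norm (arow (m, n)))\<^sup>2 \<le> (2 * norm (rvec m n))\<^sup>2"
          by (simp add: norm_arow norm_rvec power_mult_distrib)
      qed simp
      then have "c / 4 * norm \<rho> \<le> c / 2 * norm (rvec m n)" using c(1) \<rho>(1) by simp
      also have "\<dots> \<le> norm (of_int m * \<alpha> + of_int n * \<beta>) - norm z"
        using c(2)[of m n] K2 by simp
      also have "\<dots> \<le> norm (z + of_int m * \<alpha> + of_int n * \<beta>)"
        using norm_triangle_ineq2[of "of_int m * \<alpha> + of_int n * \<beta>" "- z"] by (simp add: algebra_simps)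
      finally show "c / 4 * norm \<rho> \<le> norm (bil \<rho> (vector [z, \<alpha>, \<beta>]))" by (simp add: \<rho>(1) bil_arow)
    qed (use c in auto)
  qed
qed

lemma lat_avoid:
  assumes "z \<notin> lat \<alpha> \<beta>"
  shows "z + of_int m * \<alpha> + of_int n * \<beta> \<noteq> 0"
proof
  assume "z + of_int m * \<alpha> + of_int n * \<beta> = 0"
  then have "z = - (of_int m * \<alpha> + of_int n * \<beta>)" by (simp add: algebra_simps eq_neg_iff_add_eq_0)
  then show False using assms lat_uminus[of "of_int m * \<alpha> + of_int n * \<beta>"] by (auto simp: lat_def)
qed

lemma holomorphic_eisenstein3: "eisenstein3 \<alpha> \<beta> holomorphic_on - lat \<alpha> \<beta>"
proof -
  have "eisenstein3 \<alpha> \<beta> field_differentiable (at z)" if "z \<notin> lat \<alpha> \<beta>" for z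
    unfolding eisenstein3_def
    by (rule cdiff_first_coordinate, rule cdiff_inv_power_sum[OF arow_summable separated_arow arow_nonzero])
       (use lat_avoid[OF that] in auto)
  then show ?thesis
    by (auto simp: holomorphic_on_def intro: field_differentiable_at_within)
qed

lemma eisenstein3_eq: "eisenstein3 \<alpha> \<beta> z = (\<Sum>\<^sub>\<infinity>(m, n)\<in>UNIV. 1 / (z + of_int m * \<alpha> + of_int n * \<beta>) ^ 3)"
  unfolding eisenstein3_def inv_power_sum_def infsum_reindex[OF inj_arow]
  by (rule infsum_cong) (clarsimp simp: bil_arow)

lemma eisenstein3_periodic:
  assumes "w \<in> lat \<alpha> \<beta>" shows "eisenstein3 \<alpha> \<beta> (z + w) = eisenstein3 \<alpha> \<beta> z"
proof -
  obtain a b where w: "w = of_int a * \<alpha> + of_int b * \<beta>" using assms by (auto simp: lat_def)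
  show ?thesis unfolding eisenstein3_eq
    by (rule infsum_reindex_bij_witness[where j = "\<lambda>(m, n). (m + a, n + b)" and i = "\<lambda>(m, n). (m - a, n - b)"])
       (auto simp: w algebra_simps)
qed

lemma eisenstein3_odd: "eisenstein3 \<alpha> \<beta> (- z) = - eisenstein3 \<alpha> \<beta> z"
proof -
  have "eisenstein3 \<alpha> \<beta> (- z) = (\<Sum>\<^sub>\<infinity>(m, n)\<in>UNIV. - (1 / (z + of_int m * \<alpha> + of_int n * \<beta>) ^ 3))"
    unfolding eisenstein3_eq
  proof (rule infsum_reindex_bij_witness[where j = "\<lambda>(m, n). (- m, - n)" and i = "\<lambda>(m, n). (- m, - n)"])
    fix p :: "int \<times> int" obtain m n where p: "p = (m, n)" by (cases p)
    have X: "- z + of_int m * \<alpha> + of_int n * \<beta> = - (z + of_int (- m) * \<alpha> + of_int (- n) * \<beta>)"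
      by (simp add: algebra_simps)
    have "1 / (- X) ^ 3 = - (1 / X ^ 3)" for X :: complex by (simp add: power3_eq_cube)
    then show "(case case p of (m, n) \<Rightarrow> (- m, - n) of (m, n) \<Rightarrow> - (1 / (z + of_int m * \<alpha> + of_int n * \<beta>) ^ 3)) =
         (case p of (m, n) \<Rightarrow> 1 / (- z + of_int m * \<alpha> + of_int n * \<beta>) ^ 3)"
      unfolding p prod.case X by (rule sym)
  qed auto
  also have "\<dots> = - eisenstein3 \<alpha> \<beta> z"
    unfolding eisenstein3_eq by (subst infsum_uminus[symmetric]) (auto simp: case_prod_unfold)
  finally show ?thesis .
qed

text \<open>The function is odd and periodic.\<close>

lemma eisenstein3_half_period:
  assumes "w + w \<in> lat \<alpha> \<beta>" shows "eisenstein3 \<alpha> \<beta> w = 0"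
  using eisenstein3_periodic[OF assms, of "- w"] eisenstein3_odd[of w] by simp

lemma eisenstein3_pole_at_0:
  obtains g where "g holomorphic_on - (lat \<alpha> \<beta> - {0})"
    "\<And>z. z \<notin> lat \<alpha> \<beta> \<Longrightarrow> eisenstein3 \<alpha> \<beta> z = 1 / z ^ 3 + g z"
proof
  define g where "g z = inv_power_sum 3 (arow ` (- {(0, 0)})) (vector [z, \<alpha>, \<beta>])" for z
  have "g field_differentiable (at z)" if z: "z \<notin> lat \<alpha> \<beta> - {0}" for z
  proof -
    have "z + of_int m * \<alpha> + of_int n * \<beta> \<noteq> 0" if "(m, n) \<noteq> (0, 0)" for m n :: int
    proof (cases "z = 0")
      case True
      obtain c where c: "c > 0" "\<And>m n :: int. c * norm (rvec m n) \<le> norm (of_int m * \<alpha> + of_int n * \<beta>)"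
        using lat_bound by blast
      have "c * norm (rvec m n) > 0" using that c(1) by auto
      then show ?thesis using c(2)[of m n] True by auto
    qed (use lat_avoid z in auto)
    then show ?thesis unfolding g_def
      by (intro cdiff_first_coordinate cdiff_inv_power_sum[OF arow_summable separated_arow arow_nonzero]) auto
  qed
  then show "g holomorphic_on - (lat \<alpha> \<beta> - {0})"
    by (auto simp: holomorphic_on_def intro: field_differentiable_at_within)
  fix z assume z: "z \<notin> lat \<alpha> \<beta>"
  have sep: "separated_from (arow ` I) (vector [z, \<alpha>, \<beta>])" for I
    using lat_avoid[OF z] by (intro separated_arow) auto
  have s: "(\<lambda>\<rho>. 1 / bil \<rho> (vector [z, \<alpha>, \<beta>]) ^ 3) summable_on (arow ` I)" for I
    by (rule abs_summable_summable[OF inv_power_sum_abs_summable[OF arow_summable sep arow_nonzero]])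
  have "range arow = arow ` {(0, 0)} \<union> arow ` (- {(0, 0)})" by blast
  then have "eisenstein3 \<alpha> \<beta> z = inv_power_sum 3 (arow ` {(0, 0)}) (vector [z, \<alpha>, \<beta>]) + g z"
    unfolding eisenstein3_def g_def inv_power_sum_def
    by (simp only:) (rule infsum_Un_disjoint[OF s s], use inj_arow in \<open>auto dest: injD\<close>)
  then show "eisenstein3 \<alpha> \<beta> z = 1 / z ^ 3 + g z"
    by (simp add: inv_power_sum_def bil_arow)
qed

end

lemma holomorphic_factor_zero:
  assumes "f holomorphic_on ball 0 r" "f 0 = 0" "r > 0"
  obtains g where "g holomorphic_on ball 0 r" "\<And>z. z \<in> ball 0 r \<Longrightarrow> f z = z * g z"
proof
  show "(\<lambda>z. if z = 0 then deriv f 0 else (f z - f 0) / (z - 0)) holomorphic_on ball 0 r"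
    by (rule pole_lemma) (use assms in auto)
  show "f z = z * (if z = 0 then deriv f 0 else (f z - f 0) / (z - 0))" for z
    using assms by auto
qed

text \<open>The half periods account for all zeros.  The product of the translates of the function by the four half
  periods has no poles, since at each half period the triple pole of one factor meets simple zeros of
  the three others; it is periodic, hence bounded, hence constant.  A zero elsewhere would make this
  constant 0, which is impossible because the function is not identically 0 and so has countably many zeros.\<close>

theorem eisenstein3_nonzero:
  fixes \<alpha> \<beta> :: complex
  assumes nondeg: "Im (\<alpha> * cnj \<beta>) \<noteq> 0" and z0: "z0 + z0 \<notin> lat \<alpha> \<beta>"
  shows "eisenstein3 \<alpha> \<beta> z0 \<noteq> 0"
proof
  assume zero: "eisenstein3 \<alpha> \<beta> z0 = 0"
  define L where "L = lat \<alpha> \<beta>"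
  define H where "H = {z. z + z \<in> L}"
  define f where "f = eisenstein3 \<alpha> \<beta>"
  define a b where "a = \<alpha> / 2" and "b = \<beta> / 2"
  note L_add = lat_add[OF nondeg, folded L_def] and L_diff = lat_diff[OF nondeg, folded L_def]
  have memL: "of_int m * \<alpha> + of_int n * \<beta> \<in> L" for m n by (auto simp: L_def lat_def)
  have \<alpha>\<beta>: "\<alpha> \<in> L" "\<beta> \<in> L" "\<alpha> + \<beta> \<in> L" "0 \<in> L"
    using memL[of 1 0] memL[of 0 1] memL[of 1 1] memL[of 0 0] by auto
  have abH: "a \<in> H" "b \<in> H" "a + b \<in> H" "0 \<in> H"
    using \<alpha>\<beta> by (auto simp: H_def a_def b_def algebra_simps)
  have LH: "L \<subseteq> H" unfolding H_def using L_add by blast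
  have H_add: "x + y \<in> H" if "x \<in> H" "y \<in> H" for x y
    using L_add[of "x + x" "y + y"] that by (simp add: H_def algebra_simps)
  have H_diff: "x - y \<in> H" if "x \<in> H" "y \<in> H" for x y
    using L_diff[of "x + x" "y + y"] that by (simp add: H_def algebra_simps)
  have notH: "x + t \<notin> L" if "x \<notin> H" "t \<in> H" for x t
    using H_diff[of "x + t" t] LH that by auto
  have clH: "closed H"
  proof -
    have "closed L" unfolding L_def by (rule closed_lat_subset[OF nondeg order_refl])
    then have "closed ((\<lambda>z. z + z) -` L)" by (intro closed_vimage) (auto intro!: continuous_intros)
    then show ?thesis by (simp add: H_def vimage_def)
  qed
  have abL: "a \<notin> L" "b \<notin> L" "a + b \<notin> L"
  proof -
    obtain c where c: "c > 0" "\<And>m n :: int. c * norm (rvec m n) \<le> norm (of_int m * \<alpha> + of_int n * \<beta>)"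
      using lat_bound[OF nondeg] by blast
    have ne: "of_int m * \<alpha> + of_int n * \<beta> \<noteq> 0" if "m \<noteq> 0 \<or> n \<noteq> 0" for m n :: int
    proof -
      have "c * norm (rvec m n) > 0" using that c(1) by auto
      then show ?thesis using c(2)[of m n] by auto
    qed
    have key: "of_int i * a + of_int j * b \<notin> L" if "odd i \<or> odd j" for i j :: int
    proof
      assume "of_int i * a + of_int j * b \<in> L"
      then obtain m n where "of_int i * a + of_int j * b = of_int m * \<alpha> + of_int n * \<beta>"
        by (auto simp: L_def lat_def)
      then have "of_int (i - 2 * m) * \<alpha> + of_int (j - 2 * n) * \<beta> = 0"
        by (simp add: a_def b_def field_simps)
      moreover have "i - 2 * m \<noteq> 0 \<or> j - 2 * n \<noteq> 0" using that by presburger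
      ultimately show False using ne by blast
    qed
    show "a \<notin> L" "b \<notin> L" "a + b \<notin> L" using key[of 1 0] key[of 0 1] key[of 1 1] by auto
  qed
  have hol_f: "f holomorphic_on - L" unfolding f_def L_def by (rule holomorphic_eisenstein3[OF nondeg])
  have per: "f (z + w) = f z" if "w \<in> L" for z w
    using that eisenstein3_periodic[OF nondeg] by (simp add: f_def L_def)
  have hol_ft: "(\<lambda>z. f (z + t)) holomorphic_on A" if "\<And>z. z \<in> A \<Longrightarrow> z + t \<notin> L" for A t
  proof -
    have "f \<circ> (\<lambda>z. z + t) holomorphic_on A"
      by (rule holomorphic_on_compose_gen[OF _ hol_f]) (use that in \<open>auto intro!: holomorphic_intros\<close>)
    then show ?thesis by (simp add: o_def)
  qed
  define p where "p z = f z * f (z + a) * f (z + b) * f (z + (a + b))" for z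
  have hol_p: "p holomorphic_on - H"
  proof -
    have "(\<lambda>z. f (z + t)) holomorphic_on - H" if "t \<in> H" for t
      by (rule hol_ft) (use notH that in auto)
    from this[of a] this[of b] this[of "a + b"] this[of 0] show ?thesis
      unfolding p_def using abH by (intro holomorphic_on_mult) auto
  qed
  have p_a: "p (z + a) = p z" for z
  proof -
    have "f (z + a + a) = f z" using per[OF \<alpha>\<beta>(1), of z] by (simp add: a_def add.assoc)
    moreover have "f (z + a + (a + b)) = f (z + b)"
      using per[OF \<alpha>\<beta>(1), of "z + b"] by (simp add: a_def algebra_simps)
    ultimately show ?thesis by (simp add: p_def algebra_simps)
  qed
  have p_b: "p (z + b) = p z" for z
  proof -
    have "f (z + b + b) = f z" using per[OF \<alpha>\<beta>(2), of z] by (simp add: b_def add.assoc)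
    moreover have "f (z + b + (a + b)) = f (z + a)"
      using per[OF \<alpha>\<beta>(2), of "z + a"] by (simp add: b_def algebra_simps)
    ultimately show ?thesis by (simp add: p_def algebra_simps)
  qed
  have p_L: "p (z + w) = p z" if w: "w \<in> L" for z w
  proof -
    have "f (z + w + t) = f (z + t)" for t using per[OF w, of "z + t"] by (simp add: algebra_simps)
    then show ?thesis using per[OF w, of z] by (simp add: p_def)
  qed
  \<comment> \<open>translation by a half period permutes the factors\<close>
  have p_H: "p (z + h) = p z" if h: "h \<in> H" for z h
  proof -
    obtain m n where mn: "h + h = of_int m * \<alpha> + of_int n * \<beta>" using h by (auto simp: H_def L_def lat_def)
    define w where "w = of_int (m div 2) * \<alpha> + of_int (n div 2) * \<beta>"
    have m: "m = 2 * (m div 2) + m mod 2" and n: "n = 2 * (n div 2) + n mod 2" by auto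
    have "h + h = of_int (2 * (m div 2) + m mod 2) * \<alpha> + of_int (2 * (n div 2) + n mod 2) * \<beta>"
      using mn m n by simp
    also have "\<dots> = (w + of_int (m mod 2) * a + of_int (n mod 2) * b) + (w + of_int (m mod 2) * a + of_int (n mod 2) * b)"
      unfolding w_def a_def b_def of_int_add of_int_mult by (simp add: algebra_simps)
    finally have hh: "h + h = \<dots>" .
    have "x = y" if "x + x = y + y" for x y :: complex using that by (simp add: mult_2[symmetric])
    from this[OF hh] have h': "h = w + of_int (m mod 2) * a + of_int (n mod 2) * b" .
    have i: "m mod 2 = 0 \<or> m mod 2 = 1" "n mod 2 = 0 \<or> n mod 2 = 1" by auto
    have "p (z + h) = p (z + of_int (m mod 2) * a + of_int (n mod 2) * b)"
      using p_L[of w "z + of_int (m mod 2) * a + of_int (n mod 2) * b"] memL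
      by (simp add: h' w_def algebra_simps)
    also have "\<dots> = p z" using i by (elim disjE) (simp_all add: p_a p_b)
    finally show ?thesis .
  qed
  obtain d where d: "d > 0" "\<And>x. x \<in> L \<Longrightarrow> x \<noteq> 0 \<Longrightarrow> norm x \<ge> d"
    using lat_discrete[OF nondeg] unfolding L_def by blast
  define r where "r = d / 2"
  have r: "r > 0" using d by (simp add: r_def)
  have ballH: "x \<notin> H" if "x \<in> ball 0 r" "x \<noteq> 0" for x
    using d(2)[of "x + x"] norm_triangle_ineq[of x x] that by (auto simp: H_def r_def mult_2[symmetric])
  obtain g where g: "g holomorphic_on - (L - {0})" "\<And>z. z \<notin> L \<Longrightarrow> f z = 1 / z ^ 3 + g z"
    using eisenstein3_pole_at_0[OF nondeg] unfolding f_def L_def by blast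
  have g_ball: "g holomorphic_on ball 0 r"
    by (rule holomorphic_on_subset[OF g(1)]) (use ballH LH in auto)
  \<comment> \<open>the other half periods contribute a zero at the origin, cancelling one order of the pole\<close>
  have fac: "\<exists>q. q holomorphic_on ball 0 r \<and> (\<forall>z\<in>ball 0 r. f (z + t) = z * q z)"
    if t: "t \<in> H" "t \<notin> L" for t
  proof -
    have "f (0 + t) = 0" using eisenstein3_half_period[OF nondeg, of t] t by (simp add: f_def H_def L_def)
    moreover have "(\<lambda>z. f (z + t)) holomorphic_on ball 0 r"
    proof (rule hol_ft)
      fix z :: complex assume "z \<in> ball 0 r"
      then show "z + t \<notin> L" using notH[OF ballH t(1), of z] t(2) by (cases "z = 0") auto
    qed
    ultimately show ?thesis using holomorphic_factor_zero[of "\<lambda>z. f (z + t)" r] r by metis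
  qed
  obtain qa where qa: "qa holomorphic_on ball 0 r" "\<And>z. z \<in> ball 0 r \<Longrightarrow> f (z + a) = z * qa z"
    using fac[OF abH(1) abL(1)] by blast
  obtain qb where qb: "qb holomorphic_on ball 0 r" "\<And>z. z \<in> ball 0 r \<Longrightarrow> f (z + b) = z * qb z"
    using fac[OF abH(2) abL(2)] by blast
  obtain qc where qc: "qc holomorphic_on ball 0 r" "\<And>z. z \<in> ball 0 r \<Longrightarrow> f (z + (a + b)) = z * qc z"
    using fac[OF abH(3) abL(3)] by blast
  define q where "q z = (1 + z ^ 3 * g z) * qa z * qb z * qc z" for z
  have hol_q: "q holomorphic_on ball 0 r"
    unfolding q_def by (intro holomorphic_intros g_ball qa qb qc)
  have pq: "p z = q z" if z: "z \<in> ball 0 r" "z \<noteq> 0" for z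
  proof -
    have "z \<notin> L" using ballH[OF z] LH by auto
    from g(2)[OF this] have "f z = (1 + z ^ 3 * g z) / z ^ 3" using z by (simp add: field_simps)
    then have "p z = (1 + z ^ 3 * g z) / z ^ 3 * (z * qa z) * (z * qb z) * (z * qc z)"
      using z by (simp add: p_def qa qb qc)
    also have "\<dots> = q z" using z by (simp add: q_def power3_eq_cube)
    finally show ?thesis .
  qed
  \<comment> \<open>by periodicity the value of \<open>q\<close> at 0 fills all the gaps\<close>
  define P where "P z = (if z \<in> H then q 0 else p z)" for z
  have "P field_differentiable (at z)" for z
  proof (cases "z \<in> H")
    case True
    have "(\<lambda>x. q (x - z)) field_differentiable (at z)"
    proof -
      have "q field_differentiable (at (z - z))"
        using hol_q r by (auto simp: holomorphic_on_open field_differentiable_def)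
      then show ?thesis
        by (intro field_differentiable_compose[of "\<lambda>x. x - z" z q, unfolded o_def])
           (auto intro!: derivative_intros)
    qed
    then obtain D where "((\<lambda>x. q (x - z)) has_field_derivative D) (at z)"
      by (auto simp: field_differentiable_def)
    then have "(P has_field_derivative D) (at z)"
    proof (rule has_field_derivative_transform_within[OF _ r])
      fix x assume x: "dist x z < r"
      show "q (x - z) = P x"
      proof (cases "x = z")
        case False
        then have "x - z \<in> ball 0 r" "x - z \<noteq> 0" using x by (auto simp: dist_norm norm_minus_commute)
        moreover from this have "x \<notin> H" using ballH H_diff[of x z] True by blast
        ultimately show ?thesis using pq p_H[OF True, of "x - z"] by (simp add: P_def)
      qed (simp add: P_def True)
    qed auto
    then show ?thesis by (auto simp: field_differentiable_def)
  next
    case False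
    then obtain D where "(p has_field_derivative D) (at z)"
      using hol_p clH by (auto simp: holomorphic_on_open open_Compl)
    then have "(P has_field_derivative D) (at z)"
      by (rule has_field_derivative_transform_within_open[of _ _ _ "- H"])
         (use False clH in \<open>auto simp: P_def open_Compl\<close>)
    then show ?thesis by (auto simp: field_differentiable_def)
  qed
  then have hol_P: "P holomorphic_on UNIV"
    by (auto simp: holomorphic_on_def)
  have P_per: "P (z + w) = P z" if w: "w \<in> L" for z w
    using p_L[OF w, of z] H_add[of z w] H_diff[of "z + w" w] w LH by (auto simp: P_def)
  define Q where "Q = (\<lambda>(x, y). of_real x * \<alpha> + of_real y * \<beta>) ` ({0..1::real} \<times> {0..1::real})"
  have "compact Q"
    unfolding Q_def by (intro compact_continuous_image compact_Times)
      (auto intro!: continuous_intros simp: case_prod_unfold)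
  \<comment> \<open>every point is congruent to one of the closed period parallelogram \<open>Q\<close>\<close>
  have surj: "\<exists>w\<in>L. z - w \<in> Q" for z
  proof -
    define D where "D = Im (\<alpha> * cnj \<beta>)"
    define x y where "x = Im (z * cnj \<beta>) / D" and "y = - Im (z * cnj \<alpha>) / D"
    have "D \<noteq> 0" using nondeg by (simp add: D_def)
    have z: "z = of_real x * \<alpha> + of_real y * \<beta>"
    proof (rule complex_eqI)
      have "D * Re z = D * (x * Re \<alpha> + y * Re \<beta>)"
        using \<open>D \<noteq> 0\<close> by (simp add: x_def y_def distrib_left) (simp add: D_def algebra_simps)
      then show "Re z = Re (of_real x * \<alpha> + of_real y * \<beta>)" using \<open>D \<noteq> 0\<close> by simp
      have "D * Im z = D * (x * Im \<alpha> + y * Im \<beta>)"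
        using \<open>D \<noteq> 0\<close> by (simp add: x_def y_def distrib_left) (simp add: D_def algebra_simps)
      then show "Im z = Im (of_real x * \<alpha> + of_real y * \<beta>)" using \<open>D \<noteq> 0\<close> by simp
    qed
    have "z - (of_int \<lfloor>x\<rfloor> * \<alpha> + of_int \<lfloor>y\<rfloor> * \<beta>) = of_real (frac x) * \<alpha> + of_real (frac y) * \<beta>"
      by (subst z) (simp add: frac_def algebra_simps)
    moreover have "(frac x, frac y) \<in> {0..1::real} \<times> {0..1::real}"
      by (auto simp: frac_ge_0 less_imp_le[OF frac_lt_1])
    ultimately have "z - (of_int \<lfloor>x\<rfloor> * \<alpha> + of_int \<lfloor>y\<rfloor> * \<beta>) \<in> Q" unfolding Q_def by force
    then show ?thesis using memL by blast
  qed
  have "range P \<subseteq> P ` Q"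
  proof
    fix v assume "v \<in> range P"
    then obtain z where z: "v = P z" by auto
    obtain w where "w \<in> L" "z - w \<in> Q" using surj by blast
    then show "v \<in> P ` Q" using P_per[of w "z - w"] z by (auto intro!: image_eqI[of _ _ "z - w"])
  qed
  moreover have "compact (P ` Q)"
    using \<open>compact Q\<close> holomorphic_on_imp_continuous_on[OF hol_P]
    by (intro compact_continuous_image) (auto intro: continuous_on_subset)
  ultimately have "bounded (range P)" using bounded_subset compact_imp_bounded by blast
  from Liouville_theorem[OF hol_P this] obtain k where k: "\<And>z. P z = k" by (auto simp: constant_on_def)
  have "z0 \<notin> H" using z0 by (simp add: H_def L_def)
  then have "P z0 = 0" using zero by (simp add: P_def p_def f_def)
  then have P0: "P z = 0" for z using k by metis
  have cL: "countable L" unfolding L_def by (rule countable_lat[OF nondeg])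
  have cZ: "countable {z \<in> - L. f z = 0}"
  proof (rule holomorphic_countable_zeros[OF hol_f])
    show op: "open (- L)" unfolding L_def using closed_lat_subset[OF nondeg order_refl] by blast
    obtain C :: "nat \<Rightarrow> complex set" where C: "\<And>n. compact (C n)" "(\<Union>n. C n) = - L"
      using open_Union_compact_subsets[OF op] by metis
    show "fsigma (- L)"
      unfolding C(2)[symmetric] by (rule fsigma.intros) (use C(1) compact_imp_closed in blast)
    show "connected (- L)"
      by (rule path_connected_imp_connected, rule path_connected_complement_countable) (use cL in auto)
    show "\<not> f constant_on - L"
    proof
      assume "f constant_on - L"
      then have f0: "f z = 0" if "z \<notin> L" for z
        using zero LH \<open>z0 \<notin> H\<close> that unfolding constant_on_def f_def by (metis ComplI subsetD)
      have "(\<lambda>z. 1 + z ^ 3 * g z) \<midarrow>0\<rightarrow> 1 + 0 ^ 3 * g 0"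
        using holomorphic_on_imp_continuous_on[OF g_ball] r
        by (intro tendsto_intros) (auto simp: continuous_on_eq_continuous_at isCont_def)
      moreover have "\<forall>\<^sub>F z in at 0. 1 + z ^ 3 * g z = 0"
        unfolding eventually_at
      proof (intro exI[of _ r] conjI ballI impI r)
        fix z :: complex assume "z \<noteq> 0 \<and> dist z 0 < r"
        then have z: "z \<in> ball 0 r" "z \<noteq> 0" by (auto simp: dist_commute)
        then have "z \<notin> L" using ballH LH by blast
        with f0 g(2) have "1 / z ^ 3 + g z = 0" by metis
        then show "1 + z ^ 3 * g z = 0" using z by (simp add: field_simps add_eq_0_iff)
      qed
      ultimately have "(\<lambda>z::complex. 0) \<midarrow>0\<rightarrow> (1 + 0 ^ 3 * g 0)"
        by (rule Lim_transform_eventually)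
      from LIM_const_eq[OF this] show False by simp
    qed
  qed
  \<comment> \<open>a vanishing product at every point would make countably many zeros cover the plane\<close>
  have "UNIV \<subseteq> H \<union> (\<Union>t\<in>{0, a, b, a + b}. (\<lambda>z. z - t) ` {z \<in> - L. f z = 0})"
  proof
    fix z :: complex
    show "z \<in> H \<union> (\<Union>t\<in>{0, a, b, a + b}. (\<lambda>z. z - t) ` {z \<in> - L. f z = 0})"
    proof (cases "z \<in> H")
      case False
      then have "p z = 0" using P0[of z] by (simp add: P_def)
      then have "\<exists>t\<in>{0, a, b, a + b}. f (z + t) = 0" by (auto simp: p_def)
      then obtain t where t: "t \<in> {0, a, b, a + b}" "f (z + t) = 0" by blast
      then have "z + t \<notin> L" using notH[OF False] abH by blast
      then have "z \<in> (\<lambda>z. z - t) ` {z \<in> - L. f z = 0}" using t(2) by (auto intro!: image_eqI[of _ _ "z + t"])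
      then show ?thesis using t(1) by blast
    qed simp
  qed
  moreover have "countable H"
  proof -
    have "H \<subseteq> (\<lambda>z. z / 2) ` L"
    proof
      fix z assume "z \<in> H"
      then show "z \<in> (\<lambda>z. z / 2) ` L" by (intro image_eqI[of _ _ "z + z"]) (auto simp: H_def)
    qed
    then show ?thesis using cL countable_subset by blast
  qed
  moreover from this have "countable (H \<union> (\<Union>t\<in>{0, a, b, a + b}. (\<lambda>z. z - t) ` {z \<in> - L. f z = 0}))"
    using cZ by (intro countable_Un countable_UN countable_image) auto
  ultimately have "countable (UNIV :: complex set)" using countable_subset by blast
  then show False using uncountable_UNIV_complex by simp
qed

section \<open>The modular group and lattices\<close>

abbreviation cz :: "int ^ 2 ^ 2 \<Rightarrow> complex ^ 2 ^ 2" where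
  "cz \<equiv> map_matrix of_int"

lemma cz_mult: "cz (\<gamma> ** \<delta>) = cz \<gamma> ** cz \<delta>"
  by (simp add: matrix_matrix_mult_def vec_eq_iff map_matrix_def)

lemma cz_mat1: "cz (mat 1) = mat 1"
  by (simp add: vec_eq_iff map_matrix_def mat_def)

lemma cz_inject: "cz \<gamma> = cz \<delta> \<longleftrightarrow> \<gamma> = \<delta>"
  by (simp add: vec_eq_iff map_matrix_def)

lemma cz_nth: "cz \<gamma> $ i $ j = of_int (\<gamma> $ i $ j)"
  by (simp add: map_matrix_def)

lemma det1_inverse:
  fixes \<gamma> :: "int ^ 2 ^ 2"
  assumes "det \<gamma> = 1"
  obtains \<delta> where "det \<delta> = 1" "\<delta> ** \<gamma> = mat 1" "\<gamma> ** \<delta> = mat 1"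
proof
  let ?\<delta> = "vector [vector [\<gamma>$2$2, - \<gamma>$1$2], vector [- \<gamma>$2$1, \<gamma>$1$1]] :: int ^ 2 ^ 2"
  show "det ?\<delta> = 1" "?\<delta> ** \<gamma> = mat 1" "\<gamma> ** ?\<delta> = mat 1"
    using assms by (auto simp: det_2 vec_eq_iff forall_2 matrix_matrix_mult_def sum_2 mat_def algebra_simps)
qed

lemma bil_matrix_vector: "bil \<rho> (A *v u) = bil (\<rho> v* A) u"
  by (simp add: bil_def matrix_vector_mult_def vector_matrix_mult_def sum_distrib_left sum_distrib_right)
     (subst sum.swap, simp add: mult.assoc)

lemma vector_matrix_assoc: "(\<rho> v* A) v* B = \<rho> v* (A ** (B :: complex ^ 'n ^ 'n))"
  by (simp add: vector_matrix_mul_assoc)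

lemma rvec_cz:
  "rvec x y v* cz \<gamma> = rvec (x * \<gamma>$1$1 + y * \<gamma>$2$1) (x * \<gamma>$1$2 + y * \<gamma>$2$2)"
  by (simp add: vec_eq_iff forall_2 vector_matrix_mult_def sum_2 cz_nth)

text \<open>Rows transform from the right, so that applying \<open>\<gamma>\<close> to a vector amounts to moving the rows.\<close>

definition act :: "int ^ 2 ^ 2 \<Rightarrow> (complex ^ 2) set \<Rightarrow> (complex ^ 2) set" where
  "act \<gamma> R = (\<lambda>\<rho>. \<rho> v* cz \<gamma>) ` R"

lemma act_act: "act \<delta> (act \<gamma> R) = act (\<gamma> ** \<delta>) R"
  by (auto simp: act_def vector_matrix_assoc cz_mult image_image)

lemma act_mat1: "act (mat 1) R = R"
  by (simp add: act_def cz_mat1)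

lemma inj_row_action: "det \<gamma> = 1 \<Longrightarrow> inj (\<lambda>\<rho>. \<rho> v* cz \<gamma>)"
proof (rule injI)
  fix \<rho> \<sigma> assume "det \<gamma> = 1" and eq: "\<rho> v* cz \<gamma> = \<sigma> v* cz \<gamma>"
  then obtain \<delta> where "\<gamma> ** \<delta> = mat 1" using det1_inverse by blast
  then have "(\<rho> v* cz \<gamma>) v* cz \<delta> = \<rho>" for \<rho>
    by (simp add: vector_matrix_assoc cz_mult[symmetric] cz_mat1)
  then show "\<rho> = \<sigma>" using eq by metis
qed

lemma inv_power_sum_act: "det \<gamma> = 1 \<Longrightarrow> inv_power_sum k R (cz \<gamma> *v u) = inv_power_sum k (act \<gamma> R) u"
  unfolding inv_power_sum_def act_def
  by (subst infsum_reindex) (auto simp: bil_matrix_vector o_def intro: inj_on_subset[OF inj_row_action])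

lemma orient_cz: "orient (cz \<gamma> *v u) = of_int (det \<gamma>) * orient u"
  by (simp add: orient_def matrix_vector_mult_def sum_2 cz_nth det_2 algebra_simps)

lemma cz_row: "(cz \<gamma> *v u) $ i = bil (rvec (\<gamma>$i$1) (\<gamma>$i$2)) u"
  by (simp add: bil_rvec matrix_vector_mult_def sum_2 cz_nth)

definition lattice_rows :: "(complex ^ 2) set" where
  "lattice_rows = {rvec (of_int m) (of_int n) |m n :: int. m \<noteq> 0 \<or> n \<noteq> 0}"

definition torsion_rows :: "int \<Rightarrow> int \<Rightarrow> (complex ^ 2) set" where
  "torsion_rows p q = {rvec (of_int m + of_int p / 3) (of_int n + of_int q / 3) |m n :: int. True}"

definition torsion_cosets :: "(complex ^ 2) set set" where
  "torsion_cosets = {torsion_rows p q |p q. \<not> (3 dvd p \<and> 3 dvd q)}"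

text \<open>A common summable superset of the lattice rows and of the 3-torsion cosets.\<close>

definition third_rows :: "(complex ^ 2) set" where
  "third_rows = (\<lambda>(m::int, n::int). rvec (of_int m / 3) (of_int n / 3)) ` (- {(0, 0)})"

text \<open>One inclusion for all group elements suffices: apply it to the inverse.\<close>

lemma act_invariant:
  assumes "\<And>\<gamma>. det \<gamma> = 1 \<Longrightarrow> act \<gamma> R \<subseteq> R" "det \<gamma> = 1"
  shows "act \<gamma> R = R"
proof
  obtain \<delta> where \<delta>: "det \<delta> = 1" "\<delta> ** \<gamma> = mat 1" using det1_inverse[OF assms(2)] by blast
  have "R = act \<gamma> (act \<delta> R)" by (simp add: act_act \<delta> act_mat1)
  also have "\<dots> \<subseteq> act \<gamma> R" using assms(1)[OF \<delta>(1)] by (auto simp: act_def)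
  finally show "R \<subseteq> act \<gamma> R" .
qed (use assms in auto)

lemma det1_row_zero:
  fixes \<gamma> :: "int ^ 2 ^ 2"
  assumes "det \<gamma> = 1" "d dvd m * \<gamma>$1$1 + n * \<gamma>$2$1" "d dvd m * \<gamma>$1$2 + n * \<gamma>$2$2"
  shows "d dvd m" "d dvd n"
proof -
  have d: "\<gamma>$1$1 * \<gamma>$2$2 - \<gamma>$1$2 * \<gamma>$2$1 = 1" using assms(1) by (simp add: det_2)
  have "d dvd (m * \<gamma>$1$1 + n * \<gamma>$2$1) * \<gamma>$2$2 - (m * \<gamma>$1$2 + n * \<gamma>$2$2) * \<gamma>$2$1"
    using assms by (intro dvd_diff dvd_mult2) auto
  also have "\<dots> = m * (\<gamma>$1$1 * \<gamma>$2$2 - \<gamma>$1$2 * \<gamma>$2$1)" by (simp add: algebra_simps)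
  finally show "d dvd m" by (simp add: d)
  have "d dvd (m * \<gamma>$1$2 + n * \<gamma>$2$2) * \<gamma>$1$1 - (m * \<gamma>$1$1 + n * \<gamma>$2$1) * \<gamma>$1$2"
    using assms by (intro dvd_diff dvd_mult2) auto
  also have "\<dots> = n * (\<gamma>$1$1 * \<gamma>$2$2 - \<gamma>$1$2 * \<gamma>$2$1)" by (simp add: algebra_simps)
  finally show "d dvd n" by (simp add: d)
qed

lemma act_lattice_rows: "det \<gamma> = 1 \<Longrightarrow> act \<gamma> lattice_rows = lattice_rows"
proof (rule act_invariant)
  fix \<gamma> :: "int ^ 2 ^ 2" assume d: "det \<gamma> = 1"
  show "act \<gamma> lattice_rows \<subseteq> lattice_rows"
  proof
    fix \<rho> assume "\<rho> \<in> act \<gamma> lattice_rows"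
    then obtain m n :: int where mn: "m \<noteq> 0 \<or> n \<noteq> 0" and \<rho>: "\<rho> = rvec (of_int m) (of_int n) v* cz \<gamma>"
      by (auto simp: act_def lattice_rows_def)
    have "\<rho> = rvec (of_int (m * \<gamma>$1$1 + n * \<gamma>$2$1)) (of_int (m * \<gamma>$1$2 + n * \<gamma>$2$2))"
      by (simp add: \<rho> rvec_cz)
    moreover have "m * \<gamma>$1$1 + n * \<gamma>$2$1 \<noteq> 0 \<or> m * \<gamma>$1$2 + n * \<gamma>$2$2 \<noteq> 0"
      using det1_row_zero[OF d, of 0 m n] mn by auto
    ultimately show "\<rho> \<in> lattice_rows" unfolding lattice_rows_def by blast
  qed
qed

lemma torsion_rows_shift: "torsion_rows (p + 3 * a) (q + 3 * b) = torsion_rows p q"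
proof -
  have sub: "torsion_rows (p + 3 * a) (q + 3 * b) \<subseteq> torsion_rows p q" for p q a b
  proof
    fix \<rho> assume "\<rho> \<in> torsion_rows (p + 3 * a) (q + 3 * b)"
    then obtain m n :: int where "\<rho> = rvec (of_int m + of_int (p + 3 * a) / 3) (of_int n + of_int (q + 3 * b) / 3)"
      by (auto simp: torsion_rows_def)
    then have "\<rho> = rvec (of_int (m + a) + of_int p / 3) (of_int (n + b) + of_int q / 3)"
      by (simp add: field_simps)
    then show "\<rho> \<in> torsion_rows p q" unfolding torsion_rows_def by blast
  qed
  show ?thesis using sub[of p a q b] sub[of "p + 3 * a" "- a" "q + 3 * b" "- b"] by simp
qed

lemma act_torsion_rows:
  "det \<gamma> = 1 \<Longrightarrow> act \<gamma> (torsion_rows p q) = torsion_rows (p * \<gamma>$1$1 + q * \<gamma>$2$1) (p * \<gamma>$1$2 + q * \<gamma>$2$2)"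
proof -
  have sub: "act \<gamma> (torsion_rows p q) \<subseteq> torsion_rows (p * \<gamma>$1$1 + q * \<gamma>$2$1) (p * \<gamma>$1$2 + q * \<gamma>$2$2)"
    for \<gamma> p q
  proof
    fix \<rho> assume "\<rho> \<in> act \<gamma> (torsion_rows p q)"
    then obtain m n :: int where \<rho>: "\<rho> = rvec (of_int m + of_int p / 3) (of_int n + of_int q / 3) v* cz \<gamma>"
      by (auto simp: act_def torsion_rows_def)
    have "\<rho> = rvec (of_int (m * \<gamma>$1$1 + n * \<gamma>$2$1) + of_int (p * \<gamma>$1$1 + q * \<gamma>$2$1) / 3)
                  (of_int (m * \<gamma>$1$2 + n * \<gamma>$2$2) + of_int (p * \<gamma>$1$2 + q * \<gamma>$2$2) / 3)"
      by (simp add: \<rho> rvec_cz field_simps)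
    then show "\<rho> \<in> torsion_rows (p * \<gamma>$1$1 + q * \<gamma>$2$1) (p * \<gamma>$1$2 + q * \<gamma>$2$2)"
      unfolding torsion_rows_def by blast
  qed
  assume d: "det \<gamma> = 1"
  then obtain \<delta> where \<delta>: "det \<delta> = 1" "\<delta> ** \<gamma> = mat 1" "\<gamma> ** \<delta> = mat 1" using det1_inverse by blast
  let ?p = "p * \<gamma>$1$1 + q * \<gamma>$2$1" and ?q = "p * \<gamma>$1$2 + q * \<gamma>$2$2"
  have e: "(\<gamma> ** \<delta>) $ i $ j = (if i = j then 1 else 0)" for i j by (simp add: \<delta> mat_def)
  have pq: "?p * \<delta>$1$1 + ?q * \<delta>$2$1 = p" "?p * \<delta>$1$2 + ?q * \<delta>$2$2 = q"
  proof -
    have "?p * \<delta>$1$1 + ?q * \<delta>$2$1 = p * (\<gamma> ** \<delta>) $ 1 $ 1 + q * (\<gamma> ** \<delta>) $ 2 $ 1"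
      by (simp add: matrix_matrix_mult_def sum_2 algebra_simps)
    then show "?p * \<delta>$1$1 + ?q * \<delta>$2$1 = p" by (simp add: e)
    have "?p * \<delta>$1$2 + ?q * \<delta>$2$2 = p * (\<gamma> ** \<delta>) $ 1 $ 2 + q * (\<gamma> ** \<delta>) $ 2 $ 2"
      by (simp add: matrix_matrix_mult_def sum_2 algebra_simps)
    then show "?p * \<delta>$1$2 + ?q * \<delta>$2$2 = q" by (simp add: e)
  qed
  have "torsion_rows ?p ?q = act \<gamma> (act \<delta> (torsion_rows ?p ?q))" by (simp add: act_act \<delta> act_mat1)
  also have "\<dots> \<subseteq> act \<gamma> (torsion_rows p q)" using sub[of \<delta> ?p ?q] unfolding pq by (auto simp: act_def)
  finally show ?thesis using sub by blast
qed

text \<open>The 3-torsion cosets are permuted, although no single one of them need be preserved.\<close>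

lemma act_torsion_cosets:
  assumes "det \<gamma> = 1"
  shows "bij_betw (act \<gamma>) torsion_cosets torsion_cosets"
proof -
  have sub: "act \<gamma> R \<in> torsion_cosets" if d: "det \<gamma> = 1" and T: "R \<in> torsion_cosets" for \<gamma> R
  proof -
    obtain p q where R: "R = torsion_rows p q" "\<not> (3 dvd p \<and> 3 dvd q)"
      using T unfolding torsion_cosets_def by blast
    then show ?thesis
      unfolding torsion_cosets_def R(1) act_torsion_rows[OF d]
      using det1_row_zero[OF d, of 3 p q] by blast
  qed
  obtain \<delta> where \<delta>: "det \<delta> = 1" "\<delta> ** \<gamma> = mat 1" "\<gamma> ** \<delta> = mat 1" using det1_inverse[OF assms] by blast
  show ?thesis
    by (rule bij_betw_byWitness[where f' = "act \<delta>"]) (use sub assms \<delta> in \<open>auto simp: act_act act_mat1\<close>)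
qed

lemma finite_torsion_cosets: "finite torsion_cosets"
proof (rule finite_subset)
  show "torsion_cosets \<subseteq> (\<lambda>(p, q). torsion_rows p q) ` ({0..2} \<times> {0..2})"
  proof
    fix R assume "R \<in> torsion_cosets"
    then obtain p q where R: "R = torsion_rows p q" by (auto simp: torsion_cosets_def)
    have "R = torsion_rows (p mod 3 + 3 * (p div 3)) (q mod 3 + 3 * (q div 3))" by (simp add: R)
    also have "\<dots> = torsion_rows (p mod 3) (q mod 3)" by (rule torsion_rows_shift)
    finally show "R \<in> (\<lambda>(p, q). torsion_rows p q) ` ({0..2} \<times> {0..2})" by force
  qed
qed simp

lemma lattice_rows_third: "lattice_rows \<subseteq> third_rows"
proof
  fix \<rho> assume "\<rho> \<in> lattice_rows"
  then obtain m n :: int where mn: "m \<noteq> 0 \<or> n \<noteq> 0" and "\<rho> = rvec (of_int m) (of_int n)"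
    by (auto simp: lattice_rows_def)
  then have "\<rho> = (\<lambda>(m::int, n::int). rvec (of_int m / 3) (of_int n / 3)) (3 * m, 3 * n)" by simp
  then show "\<rho> \<in> third_rows"
    using mn unfolding third_rows_def by (intro image_eqI[where x = "(3 * m, 3 * n)"]) auto
qed

lemma torsion_rows_third: "\<not> (3 dvd p \<and> 3 dvd q) \<Longrightarrow> torsion_rows p q \<subseteq> third_rows"
proof
  fix \<rho> assume pq: "\<not> (3 dvd p \<and> 3 dvd q)" and "\<rho> \<in> torsion_rows p q"
  then obtain m n :: int where "\<rho> = rvec (of_int m + of_int p / 3) (of_int n + of_int q / 3)"
    by (auto simp: torsion_rows_def)
  then have "\<rho> = (\<lambda>(m::int, n::int). rvec (of_int m / 3) (of_int n / 3)) (3 * m + p, 3 * n + q)"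
    by (simp add: field_simps)
  moreover have "3 * m + p \<noteq> 0 \<or> 3 * n + q \<noteq> 0" using pq by presburger
  ultimately show "\<rho> \<in> third_rows"
    unfolding third_rows_def by (intro image_eqI[where x = "(3 * m + p, 3 * n + q)"]) auto
qed

lemma abs_le_norm_rvec: "\<bar>x\<bar> \<le> norm (rvec x y)" "\<bar>y\<bar> \<le> norm (rvec x y)"
  unfolding norm_rvec by (auto intro!: real_le_rsqrt)

lemma third_rows_summable:
  assumes "k \<ge> 3" shows "(\<lambda>\<rho>. 1 / norm \<rho> ^ k) summable_on third_rows"
  unfolding third_rows_def
proof (subst summable_on_reindex)
  let ?h = "\<lambda>(m::int, n::int). rvec (of_int m / 3) (of_int n / 3)"
  show "inj_on ?h (- {(0, 0)})" by (auto simp: inj_on_def)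
  show "((\<lambda>\<rho>. 1 / norm \<rho> ^ k) \<circ> ?h) summable_on - {(0, 0)}"
  proof (rule summable_on_comparison_test)
    have "(\<lambda>p. 12 ^ k * (case p of (m::int, n::int) \<Rightarrow>
        (1 + \<bar>real_of_int m\<bar> + \<bar>real_of_int n\<bar>) powr (- real k))) summable_on UNIV"
      by (intro summable_on_cmult_right summable_int_pair_powr) (use assms in simp)
    then show "(\<lambda>p. 12 ^ k * (case p of (m::int, n::int) \<Rightarrow>
        (1 + \<bar>real_of_int m\<bar> + \<bar>real_of_int n\<bar>) powr (- real k))) summable_on - {(0, 0)}"
      by (rule summable_on_subset) auto
    fix p :: "int \<times> int" assume "p \<in> - {(0, 0)}"
    then obtain m n where p: "p = (m, n)" "m \<noteq> 0 \<or> n \<noteq> 0" by (cases p) auto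
    define t where "t = 1 + \<bar>real_of_int m\<bar> + \<bar>real_of_int n\<bar>"
    have "1 \<le> \<bar>real_of_int m\<bar> + \<bar>real_of_int n\<bar>" using p(2) by linarith
    moreover have "\<bar>real_of_int m / 3\<bar> \<le> norm (?h p)" "\<bar>real_of_int n / 3\<bar> \<le> norm (?h p)"
      unfolding p prod.case by (rule abs_le_norm_rvec)+
    ultimately have t: "t / 12 \<le> norm (?h p)" "t > 0" by (simp_all add: t_def)
    then have "(t / 12) ^ k \<le> norm (?h p) ^ k" "0 < (t / 12) ^ k" by (auto intro: power_mono)
    then have "1 / norm (?h p) ^ k \<le> 1 / (t / 12) ^ k"
      by (intro divide_left_mono) (auto intro!: mult_pos_pos)
    also have "\<dots> = 12 ^ k * t powr (- real k)"
      using t(2) by (simp add: powr_minus_divide powr_realpow power_divide)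
    finally show "((\<lambda>\<rho>. 1 / norm \<rho> ^ k) \<circ> ?h) p \<le>
       12 ^ k * (case p of (m::int, n::int) \<Rightarrow> (1 + \<bar>real_of_int m\<bar> + \<bar>real_of_int n\<bar>) powr (- real k))"
      by (simp add: p(1) t_def)
  qed auto
qed

lemma third_rows_nonzero: "0 \<notin> third_rows"
  by (auto simp: third_rows_def)

lemma separated_real_rows:
  assumes "orient u \<noteq> 0" "R \<subseteq> third_rows" shows "separated_from R u"
proof -
  obtain c where c: "c > 0" "\<And>x y. c * norm (rvec x y) \<le> norm (bil (rvec x y) u)"
    using norm_bil_rvec_ge'[OF assms(1)] by blast
  show ?thesis unfolding separated_from_def
    by (intro exI[of _ c] conjI c(1)) (use assms(2) c(2) in \<open>auto simp: third_rows_def\<close>)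
qed

lemma inv_power_sum_torsion_eq:
  "inv_power_sum 3 (torsion_rows p q) u =
    (\<Sum>\<^sub>\<infinity>(m, n)\<in>UNIV. 1 / bil (rvec (of_int m + of_int p / 3) (of_int n + of_int q / 3)) u ^ 3)"
proof -
  let ?h = "\<lambda>(m::int, n::int). rvec (of_int m + of_int p / 3) (of_int n + of_int q / 3)"
  have eq: "torsion_rows p q = range ?h" by (auto simp: torsion_rows_def)
  have "inj ?h" by (auto simp: inj_def)
  then show ?thesis unfolding inv_power_sum_def eq by (subst infsum_reindex) (auto simp: o_def case_prod_unfold)
qed

text \<open>A nontrivial 3-torsion point is not a half period, since 3 is odd.\<close>

lemma inv_power_sum_torsion_nonzero:
  assumes "orient u \<noteq> 0" "R \<in> torsion_cosets"
  shows "inv_power_sum 3 R u \<noteq> 0"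
proof -
  obtain p q where R: "R = torsion_rows p q" and pq: "\<not> (3 dvd p \<and> 3 dvd q)"
    using assms(2) unfolding torsion_cosets_def by blast
  define z where "z = bil (rvec (of_int p / 3) (of_int q / 3)) u"
  have nd: "Im (u$1 * cnj (u$2)) \<noteq> 0" using assms(1) by (simp add: orient_def)
  have "inv_power_sum 3 R u = eisenstein3 (u$1) (u$2) z"
    unfolding R inv_power_sum_torsion_eq eisenstein3_eq[OF nd]
    by (rule infsum_cong) (auto simp: bil_rvec z_def algebra_simps)
  also have "\<dots> \<noteq> 0"
  proof (rule eisenstein3_nonzero[OF nd])
    show "z + z \<notin> lat (u$1) (u$2)"
    proof
      assume "z + z \<in> lat (u$1) (u$2)"
      then obtain m n :: int where "z + z = of_int m * u$1 + of_int n * u$2" by (auto simp: lat_def)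
      then have "bil (rvec (2 * of_int p / 3 - of_int m) (2 * of_int q / 3 - of_int n)) u = 0"
        by (simp add: bil_rvec z_def algebra_simps)
      then have "\<bar>orient u\<bar> * norm (rvec (2 * of_int p / 3 - of_int m) (2 * of_int q / 3 - of_int n)) \<le> 0"
        using norm_bil_rvec_ge[of u "2 * of_int p / 3 - of_int m" "2 * of_int q / 3 - of_int n"] by simp
      then have "rvec (2 * of_int p / 3 - of_int m) (2 * of_int q / 3 - of_int n) = 0"
        using assms(1) by (simp add: mult_le_0_iff)
      then have "2 * real_of_int p = 3 * real_of_int m" "2 * real_of_int q = 3 * real_of_int n"
        by (auto simp: field_simps)
      then have "2 * p = 3 * m" "2 * q = 3 * n" by linarith+
      then show False using pq by presburger
    qed
  qed
  finally show ?thesis .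
qed

lemma finite_bounded_matrices:
  "finite {\<gamma> :: int ^ 2 ^ 2. \<forall>i. norm (rvec (\<gamma>$i$1) (\<gamma>$i$2)) \<le> K}"
proof -
  let ?F = "{(m::int, n::int). norm (rvec m n) \<le> K}"
  let ?h = "\<lambda>((a, b), (c, d)). vector [vector [a, b], vector [c, d]] :: int ^ 2 ^ 2"
  have "{\<gamma> :: int ^ 2 ^ 2. \<forall>i. norm (rvec (\<gamma>$i$1) (\<gamma>$i$2)) \<le> K} \<subseteq> ?h ` (?F \<times> ?F)"
  proof
    fix \<gamma> :: "int ^ 2 ^ 2" assume "\<gamma> \<in> {\<gamma>. \<forall>i. norm (rvec (\<gamma>$i$1) (\<gamma>$i$2)) \<le> K}"
    moreover have "\<gamma> = ?h ((\<gamma>$1$1, \<gamma>$1$2), (\<gamma>$2$1, \<gamma>$2$2))" by (simp add: vec_eq_iff forall_2)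
    ultimately show "\<gamma> \<in> ?h ` (?F \<times> ?F)" by (intro image_eqI) auto
  qed
  then show ?thesis
    by (rule finite_subset) (intro finite_imageI finite_cartesian_product finite_int_rvec_bounded)
qed

section \<open>Reduced bases and a compactness criterion for lattices\<close>

text \<open>The two inequalities that are used of a reduced basis: it is almost orthogonal, and its covolume is
  comparable to the product of its lengths.  Both follow from the classical reduction inequalities
  (\<open>reducedI\<close>).\<close>

definition reduced :: "complex ^ 2 \<Rightarrow> bool" where
  "reduced w \<longleftrightarrow> (\<forall>x y. x\<^sup>2 * (norm (w$1))\<^sup>2 + y\<^sup>2 * (norm (w$2))\<^sup>2 \<le> 2 * (norm (bil (rvec x y) w))\<^sup>2)
    \<and> 3 * ((norm (w$1))\<^sup>2 * (norm (w$2))\<^sup>2) \<le> 4 * (orient w)\<^sup>2"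

lemma norm_bil_rvec_sq:
  "(norm (bil (rvec x y) w))\<^sup>2 =
    x\<^sup>2 * (norm (w$1))\<^sup>2 + y\<^sup>2 * (norm (w$2))\<^sup>2 + 2 * x * y * Re (w$1 * cnj (w$2))"
  unfolding cmod_power2 by (simp add: bil_rvec algebra_simps power2_eq_square)

lemma norm_vec2_sq: "(norm (u :: complex ^ 2))\<^sup>2 = (norm (u$1))\<^sup>2 + (norm (u$2))\<^sup>2"
  by (simp add: norm_vec2)

lemma reducedI:
  assumes "2 * \<bar>Re (w$1 * cnj (w$2))\<bar> \<le> (norm (w$1))\<^sup>2" "2 * \<bar>Re (w$1 * cnj (w$2))\<bar> \<le> (norm (w$2))\<^sup>2"
  shows "reduced w"
proof -
  define a b t where "a = norm (w$1)" and "b = norm (w$2)" and "t = Re (w$1 * cnj (w$2))"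
  have ab: "a \<ge> 0" "b \<ge> 0" by (auto simp: a_def b_def)
  have t: "2 * \<bar>t\<bar> \<le> a * b"
  proof (rule power2_le_imp_le)
    have "(2 * \<bar>t\<bar>) * (2 * \<bar>t\<bar>) \<le> a\<^sup>2 * b\<^sup>2"
      by (rule mult_mono) (use assms in \<open>auto simp: a_def b_def t_def\<close>)
    then show "(2 * \<bar>t\<bar>)\<^sup>2 \<le> (a * b)\<^sup>2" by (simp add: power2_eq_square mult_ac)
  qed (use ab in simp)
  have "a\<^sup>2 * b\<^sup>2 = (norm (w$1 * cnj (w$2)))\<^sup>2" by (simp add: norm_mult a_def b_def power_mult_distrib)
  then have "a\<^sup>2 * b\<^sup>2 = t\<^sup>2 + (orient w)\<^sup>2" by (simp only: cmod_power2 t_def orient_def)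
  moreover have "4 * t\<^sup>2 \<le> a\<^sup>2 * b\<^sup>2"
    using power_mono[OF t, of 2] by (simp add: power_mult_distrib)
  moreover have "x\<^sup>2 * a\<^sup>2 + y\<^sup>2 * b\<^sup>2 \<le> 2 * (x\<^sup>2 * a\<^sup>2 + y\<^sup>2 * b\<^sup>2 + 2 * x * y * t)" for x y
  proof -
    have "\<bar>4 * x * y * t\<bar> = 2 * \<bar>x * y\<bar> * (2 * \<bar>t\<bar>)" by (simp add: abs_mult)
    also have "\<dots> \<le> 2 * \<bar>x * y\<bar> * (a * b)" by (rule mult_left_mono[OF t]) simp
    also have "\<dots> = 2 * (\<bar>x\<bar> * a) * (\<bar>y\<bar> * b)" by (simp add: abs_mult)
    also have "\<dots> \<le> (\<bar>x\<bar> * a)\<^sup>2 + (\<bar>y\<bar> * b)\<^sup>2" by (rule sum_squares_bound)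
    finally have "- (4 * x * y * t) \<le> x\<^sup>2 * a\<^sup>2 + y\<^sup>2 * b\<^sup>2"
      by (simp add: power_mult_distrib abs_le_iff)
    then show ?thesis by (simp add: algebra_simps)
  qed
  ultimately show ?thesis
    unfolding reduced_def norm_bil_rvec_sq a_def[symmetric] b_def[symmetric] t_def[symmetric] by auto
qed

text \<open>Only finitely many bases are not longer than the given one.  A basis of minimal length is reduced,
  since adding one basis vector to the other, or subtracting it, does not shorten it.\<close>

lemma exists_reduced_basis:
  assumes "orient u \<noteq> 0"
  obtains \<gamma> :: "int ^ 2 ^ 2" where "det \<gamma> = 1" "reduced (cz \<gamma> *v u)"
proof -
  obtain c where c: "c > 0" "\<And>x y. c * norm (rvec x y) \<le> norm (bil (rvec x y) u)"
    using norm_bil_rvec_ge'[OF assms] by blast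
  define F where "F = {\<gamma> :: int ^ 2 ^ 2. det \<gamma> = 1 \<and> norm (cz \<gamma> *v u) \<le> norm u}"
  \<comment> \<open>the rows of a matrix yielding a short basis are bounded\<close>
  have "F \<subseteq> {\<gamma> :: int ^ 2 ^ 2. \<forall>i. norm (rvec (\<gamma>$i$1) (\<gamma>$i$2)) \<le> norm u / c}"
  proof safe
    fix \<gamma> i assume "\<gamma> \<in> F"
    then have "norm ((cz \<gamma> *v u) $ i) \<le> norm u"
      using Finite_Cartesian_Product.norm_nth_le[of "cz \<gamma> *v u" i] by (auto simp: F_def)
    then have "c * norm (rvec (\<gamma>$i$1) (\<gamma>$i$2)) \<le> norm u"
      using c(2)[of "\<gamma>$i$1" "\<gamma>$i$2"] by (simp add: cz_row)
    then show "norm (rvec (\<gamma>$i$1) (\<gamma>$i$2)) \<le> norm u / c" using c(1) by (simp add: field_simps)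
  qed
  then have fin: "finite F" using finite_bounded_matrices finite_subset by blast
  have "mat 1 \<in> F" by (simp add: F_def cz_mat1)
  then have fin': "finite ((\<lambda>\<gamma>. norm (cz \<gamma> *v u)) ` F)" and "(\<lambda>\<gamma>. norm (cz \<gamma> *v u)) ` F \<noteq> {}"
    using fin by auto
  from Min_in[OF this] obtain \<gamma> where "\<gamma> \<in> F" "Min ((\<lambda>\<gamma>. norm (cz \<gamma> *v u)) ` F) = norm (cz \<gamma> *v u)" by blast
  with Min_le[OF fin'] have \<gamma>: "\<gamma> \<in> F" "\<And>\<delta>. \<delta> \<in> F \<Longrightarrow> norm (cz \<gamma> *v u) \<le> norm (cz \<delta> *v u)" by auto
  have d: "det \<gamma> = 1" using \<gamma>(1) by (simp add: F_def)
  define w where "w = cz \<gamma> *v u"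
  have minw: "norm w \<le> norm (cz \<epsilon> *v w)" if "det \<epsilon> = 1" for \<epsilon>
  proof (cases "\<epsilon> ** \<gamma> \<in> F")
    case True
    from \<gamma>(2)[OF this] show ?thesis by (simp add: w_def cz_mult flip: matrix_vector_mul_assoc)
  next
    case False
    then have "norm u < norm (cz \<epsilon> *v w)"
      using d that by (simp add: F_def w_def cz_mult det_mul flip: matrix_vector_mul_assoc)
    moreover have "norm w \<le> norm u" using \<gamma>(1) by (simp add: F_def w_def)
    ultimately show ?thesis by simp
  qed
  have 1: "(norm (w$2))\<^sup>2 \<le> (norm (bil (rvec s 1) w))\<^sup>2" for s :: int
  proof -
    let ?e = "vector [vector [1, 0], vector [s, 1]] :: int ^ 2 ^ 2"
    have "(norm w)\<^sup>2 \<le> (norm (cz ?e *v w))\<^sup>2" by (intro power_mono minw) (auto simp: det_2)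
    then show ?thesis by (simp add: norm_vec2_sq cz_row) (simp add: bil_rvec)
  qed
  have 2: "(norm (w$1))\<^sup>2 \<le> (norm (bil (rvec 1 s) w))\<^sup>2" for s :: int
  proof -
    let ?e = "vector [vector [1, s], vector [0, 1]] :: int ^ 2 ^ 2"
    have "(norm w)\<^sup>2 \<le> (norm (cz ?e *v w))\<^sup>2" by (intro power_mono minw) (auto simp: det_2)
    then show ?thesis by (simp add: norm_vec2_sq cz_row) (simp add: bil_rvec)
  qed
  have "reduced w"
  proof (rule reducedI)
    define t where "t = Re (w$1 * cnj (w$2))"
    show "2 * \<bar>Re (w$1 * cnj (w$2))\<bar> \<le> (norm (w$1))\<^sup>2"
      using 1[of 1] 1[of "-1"] by (simp only: norm_bil_rvec_sq t_def[symmetric]) simp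
    show "2 * \<bar>Re (w$1 * cnj (w$2))\<bar> \<le> (norm (w$2))\<^sup>2"
      using 2[of 1] 2[of "-1"] by (simp only: norm_bil_rvec_sq t_def[symmetric]) simp
  qed
  then show ?thesis using that d by (simp add: w_def)
qed

text \<open>The exponent 3 is split as \<open>1/2 + 5/2\<close>: one factor gains decay in the length \<open>b\<close>, the other one keeps
  an exponent above 2, enough to sum over the lattice.  The shift \<open>1/3\<close> keeps the coefficient of \<open>b\<close>
  away from 0.\<close>

lemma torsion_term_bound:
  assumes c: "c > 0" "c \<le> a" "c \<le> b" and z: "m\<^sup>2 * a\<^sup>2 + (n + 1/3)\<^sup>2 * b\<^sup>2 \<le> 2 * z\<^sup>2"
    and "z \<ge> 0" and n: "n = real_of_int n'"
  shows "1 / z ^ 3 \<le> (b / 8) powr (-1/2) * (c / 8) powr (-5/2) * (1 + \<bar>m\<bar> + \<bar>n\<bar>) powr (-5/2)"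
proof -
  have b: "b > 0" and a: "a > 0" using c by auto
  have n3: "(1 + \<bar>n\<bar>) / 4 \<le> \<bar>n + 1/3\<bar>"
  proof (cases "n' \<ge> 0")
    case False
    then have "n \<le> -1" using n by linarith
    then show ?thesis by (simp add: abs_if)
  qed (use n in \<open>simp add: abs_if\<close>)
  define v where "v = \<bar>m\<bar> * a + \<bar>n + 1/3\<bar> * b"
  have "v\<^sup>2 \<le> 2 * ((\<bar>m\<bar> * a)\<^sup>2 + (\<bar>n + 1/3\<bar> * b)\<^sup>2)"
    using sum_squares_bound[of "\<bar>m\<bar> * a" "\<bar>n + 1/3\<bar> * b"] by (simp add: v_def power2_sum)
  also have "\<dots> \<le> (2 * z)\<^sup>2" using z by (simp add: power_mult_distrib)
  finally have vz: "v / 2 \<le> z" using power2_le_imp_le[of v "2 * z"] \<open>z \<ge> 0\<close> by simp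
  have bb: "(1 + \<bar>n\<bar>) / 4 * b \<le> \<bar>n + 1/3\<bar> * b" by (rule mult_right_mono[OF n3]) (use b in simp)
  have m0: "0 \<le> \<bar>m\<bar> * a" using a by simp
  have "b / 4 \<le> (1 + \<bar>n\<bar>) / 4 * b" using b by (simp add: field_simps)
  then have z1: "b / 8 \<le> z" using vz bb m0 by (simp add: v_def)
  have "(1 + \<bar>n\<bar>) / 4 * c \<le> (1 + \<bar>n\<bar>) / 4 * b" by (rule mult_left_mono) (use c in auto)
  moreover have "\<bar>m\<bar> / 4 * c \<le> \<bar>m\<bar> * a" using c by (intro mult_mono) auto
  ultimately have "(1 + \<bar>m\<bar> + \<bar>n\<bar>) * (c / 8) \<le> v / 2" using bb by (simp add: v_def field_simps)
  then have z2: "c / 8 * (1 + \<bar>m\<bar> + \<bar>n\<bar>) \<le> z" using vz by (simp add: mult.commute)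
  have z0: "z > 0" using z1 b by linarith
  have "1 / z ^ 3 = z powr (-1/2) * z powr (-5/2)"
  proof -
    have "z powr (-1/2) * z powr (-5/2) = z powr (- 3)" by (simp only: powr_add[symmetric]) simp
    also have "\<dots> = 1 / z powr (real 3)" by (simp only: powr_minus_divide of_nat_numeral)
    also have "\<dots> = 1 / z ^ 3" by (simp only: powr_realpow[OF z0])
    finally show ?thesis by simp
  qed
  also have "\<dots> \<le> (b / 8) powr (-1/2) * (c / 8 * (1 + \<bar>m\<bar> + \<bar>n\<bar>)) powr (-5/2)"
    using z0 z1 z2 b c(1) by (intro mult_mono powr_mono2') auto
  also have "\<dots> = (b / 8) powr (-1/2) * (c / 8) powr (-5/2) * (1 + \<bar>m\<bar> + \<bar>n\<bar>) powr (-5/2)"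
    using powr_mult[of "c / 8" "1 + \<bar>m\<bar> + \<bar>n\<bar>" "-5/2"] c(1) by (simp only: mult.assoc)
  finally show ?thesis .
qed

definition torsion_const :: real where
  "torsion_const = (\<Sum>\<^sub>\<infinity>(m::int, n::int)\<in>UNIV. (1 + \<bar>real_of_int m\<bar> + \<bar>real_of_int n\<bar>) powr (-5/2))"

lemma infsum_torsion_bound:
  fixes f :: "int \<times> int \<Rightarrow> complex"
  assumes "\<And>m n. norm (f (m, n)) \<le> B * (1 + \<bar>real_of_int m\<bar> + \<bar>real_of_int n\<bar>) powr (-5/2)"
  shows "norm (infsum f UNIV) \<le> B * torsion_const"
proof -
  let ?g = "\<lambda>(m::int, n::int). (1 + \<bar>real_of_int m\<bar> + \<bar>real_of_int n\<bar>) powr (-5/2)"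
  have g: "?g summable_on UNIV" using summable_int_pair_powr[of "5/2"] by simp
  have le: "norm (f x) \<le> B * ?g x" for x using assms[of "fst x" "snd x"] by (simp add: case_prod_unfold)
  have s: "(\<lambda>x. norm (f x)) summable_on UNIV"
    by (rule summable_on_comparison_test[OF summable_on_cmult_right[OF g] le]) auto
  have "norm (infsum f UNIV) \<le> (\<Sum>\<^sub>\<infinity>x\<in>UNIV. norm (f x))" by (rule norm_infsum_bound[OF s])
  also have "\<dots> \<le> (\<Sum>\<^sub>\<infinity>x\<in>UNIV. B * ?g x)" by (rule infsum_mono[OF s summable_on_cmult_right[OF g] le])
  also have "\<dots> = B * torsion_const" unfolding torsion_const_def by (rule infsum_cmult_right) (use g in auto)
  finally show ?thesis .
qed

lemma reduced_torsion_bound: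
  assumes red: "reduced w" and c: "c > 0" "c \<le> norm (w$1)" "c \<le> norm (w$2)"
  shows "norm (inv_power_sum 3 (torsion_rows 0 1) w) \<le> (norm (w$2) / 8) powr (-1/2) * (c / 8) powr (-5/2) * torsion_const"
    and "norm (inv_power_sum 3 (torsion_rows 1 0) w) \<le> (norm (w$1) / 8) powr (-1/2) * (c / 8) powr (-5/2) * torsion_const"
proof -
  have r: "x\<^sup>2 * (norm (w$1))\<^sup>2 + y\<^sup>2 * (norm (w$2))\<^sup>2 \<le> 2 * (norm (bil (rvec x y) w))\<^sup>2" for x y
    using red by (auto simp: reduced_def)
  show "norm (inv_power_sum 3 (torsion_rows 0 1) w) \<le> (norm (w$2) / 8) powr (-1/2) * (c / 8) powr (-5/2) * torsion_const"
    unfolding inv_power_sum_torsion_eq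
  proof (rule infsum_torsion_bound)
    fix m n :: int
    show "norm (case (m, n) of (m, n) \<Rightarrow> 1 / bil (rvec (of_int m + of_int 0 / 3) (of_int n + of_int 1 / 3)) w ^ 3)
       \<le> (norm (w$2) / 8) powr (-1/2) * (c / 8) powr (-5/2) * (1 + \<bar>real_of_int m\<bar> + \<bar>real_of_int n\<bar>) powr (-5/2)"
      using torsion_term_bound[OF c r[of "of_int m" "of_int n + 1/3"] norm_ge_zero refl]
      by (simp add: norm_divide norm_power)
  qed
  have r': "y\<^sup>2 * (norm (w$2))\<^sup>2 + x\<^sup>2 * (norm (w$1))\<^sup>2 \<le> 2 * (norm (bil (rvec x y) w))\<^sup>2" for x y
    using r[of x y] by simp
  show "norm (inv_power_sum 3 (torsion_rows 1 0) w) \<le> (norm (w$1) / 8) powr (-1/2) * (c / 8) powr (-5/2) * torsion_const"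
    unfolding inv_power_sum_torsion_eq
  proof (rule infsum_torsion_bound)
    fix m n :: int
    show "norm (case (m, n) of (m, n) \<Rightarrow> 1 / bil (rvec (of_int m + of_int 1 / 3) (of_int n + of_int 0 / 3)) w ^ 3)
       \<le> (norm (w$1) / 8) powr (-1/2) * (c / 8) powr (-5/2) * (1 + \<bar>real_of_int m\<bar> + \<bar>real_of_int n\<bar>) powr (-5/2)"
      using torsion_term_bound[OF c(1,3,2) r'[of "of_int n" "of_int m + 1/3"] norm_ge_zero refl]
      by (simp add: norm_divide norm_power add.commute add.left_commute)
  qed
qed

lemma lattice_row_bounds:
  assumes "\<And>\<rho>. \<rho> \<in> lattice_rows \<Longrightarrow> c \<le> norm (bil \<rho> u)" "det \<gamma> = 1"
  shows "c \<le> norm ((cz \<gamma> *v u) $ i)"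
proof -
  have "rvec (\<gamma>$i$1) (\<gamma>$i$2) \<in> lattice_rows"
  proof -
    have "\<gamma>$i$1 \<noteq> 0 \<or> \<gamma>$i$2 \<noteq> 0"
      using assms(2) exhaust_2[of i] by (auto simp: det_2)
    then show ?thesis unfolding lattice_rows_def by blast
  qed
  then show ?thesis using assms(1) by (simp add: cz_row)
qed

text \<open>The covolume of a lattice is at least a constant times the square of its shortest vector; a reduced
  basis shows this.\<close>

lemma orient_ge_of_shortest:
  assumes "orient u \<noteq> 0" "c > 0" "\<And>\<rho>. \<rho> \<in> lattice_rows \<Longrightarrow> c \<le> norm (bil \<rho> u)"
  shows "c\<^sup>2 / 2 \<le> \<bar>orient u\<bar>"
proof -
  obtain \<gamma> :: "int ^ 2 ^ 2" where \<gamma>: "det \<gamma> = 1" "reduced (cz \<gamma> *v u)" using exists_reduced_basis[OF assms(1)] by blast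
  let ?w = "cz \<gamma> *v u"
  have 1: "c\<^sup>2 \<le> (norm (?w $ i))\<^sup>2" for i
    by (intro power_mono lattice_row_bounds assms(3) \<gamma>(1)) (use assms(2) in auto)
  have "c\<^sup>2 * c\<^sup>2 \<le> (norm (?w $ 1))\<^sup>2 * (norm (?w $ 2))\<^sup>2" by (intro mult_mono 1) auto
  then have "3 * (c\<^sup>2 * c\<^sup>2) \<le> 4 * (orient ?w)\<^sup>2" using \<gamma>(2) by (simp add: reduced_def)
  moreover have "orient ?w = orient u" by (simp add: orient_cz \<gamma>)
  moreover have "0 \<le> c\<^sup>2 * c\<^sup>2" "(c\<^sup>2)\<^sup>2 = c\<^sup>2 * c\<^sup>2" by (simp_all add: power2_eq_square[of "c\<^sup>2"])
  moreover have "(2 * \<bar>orient u\<bar>)\<^sup>2 = 4 * (orient u)\<^sup>2" by (simp add: power_mult_distrib)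
  ultimately have "(c\<^sup>2)\<^sup>2 \<le> (2 * \<bar>orient u\<bar>)\<^sup>2" by (simp only:)
  then have "c\<^sup>2 \<le> 2 * \<bar>orient u\<bar>" by (rule power2_le_imp_le) simp
  then show ?thesis by simp
qed

lemma powr_bound_aux:
  fixes b D \<epsilon> :: real
  assumes "\<epsilon> > 0" "D \<ge> 0" "b > 0" "\<epsilon> \<le> (b / 8) powr (-1/2) * D"
  shows "b \<le> 8 * (D / \<epsilon>)\<^sup>2"
proof -
  have "(b / 8) powr (-1/2) = 1 / sqrt (b / 8)"
    using assms(3) by (simp add: powr_minus_divide powr_half_sqrt)
  then have "\<epsilon> \<le> D / sqrt (b / 8)" using assms(4) by (simp only:) simp
  then have "\<epsilon> * sqrt (b / 8) \<le> D" using assms(3) by (subst (asm) pos_le_divide_eq) auto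
  then have "sqrt (b / 8) \<le> D / \<epsilon>" using assms(1) by (simp add: field_simps)
  then have "(sqrt (b / 8))\<^sup>2 \<le> (D / \<epsilon>)\<^sup>2" using assms(3) by (intro power_mono) auto
  then show ?thesis using assms(3) by simp
qed

text \<open>A lattice whose shortest vector is bounded below has a bounded basis as soon as it has no long
  reduced basis vector.  If one of the two is long, then the 3-torsion point at a third of it is far from
  all lattice points, and the value of the series there is close to 0.\<close>

theorem bounded_basis:
  assumes "c > 0" "\<epsilon> > 0"
  obtains K where "\<And>u. \<lbrakk>orient u \<noteq> 0; \<And>\<rho>. \<rho> \<in> lattice_rows \<Longrightarrow> c \<le> norm (bil \<rho> u);
      \<And>R. R \<in> torsion_cosets \<Longrightarrow> \<epsilon> \<le> norm (inv_power_sum 3 R u)\<rbrakk> \<Longrightarrow>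
      \<exists>\<gamma>. det \<gamma> = 1 \<and> norm (cz \<gamma> *v u) \<le> K"
proof
  define D where "D = (c / 8) powr (-5/2) * torsion_const"
  have D: "D \<ge> 0" unfolding D_def torsion_const_def by (intro mult_nonneg_nonneg infsum_nonneg) auto
  define K where "K = 8 * (D / \<epsilon>)\<^sup>2"
  fix u assume u: "orient u \<noteq> 0" and l: "\<And>\<rho>. \<rho> \<in> lattice_rows \<Longrightarrow> c \<le> norm (bil \<rho> u)"
    and t: "\<And>R. R \<in> torsion_cosets \<Longrightarrow> \<epsilon> \<le> norm (inv_power_sum 3 R u)"
  obtain \<gamma> :: "int ^ 2 ^ 2" where \<gamma>: "det \<gamma> = 1" "reduced (cz \<gamma> *v u)" using exists_reduced_basis[OF u] by blast
  let ?w = "cz \<gamma> *v u"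
  have lw: "c \<le> norm (?w $ i)" for i by (rule lattice_row_bounds[OF l \<gamma>(1)])
  have tw: "\<epsilon> \<le> norm (inv_power_sum 3 (torsion_rows p q) ?w)" if "\<not> (3 dvd p \<and> 3 dvd q)" for p q
  proof -
    have "torsion_rows p q \<in> torsion_cosets" using that unfolding torsion_cosets_def by blast
    then have "act \<gamma> (torsion_rows p q) \<in> torsion_cosets"
      using act_torsion_cosets[OF \<gamma>(1)] by (auto simp: bij_betw_def)
    then show ?thesis using t by (simp add: inv_power_sum_act[OF \<gamma>(1)])
  qed
  have pos: "norm (?w $ i) > 0" for i using lw[of i] assms(1) by linarith
  have "\<epsilon> \<le> (norm (?w$2) / 8) powr (-1/2) * D" "\<epsilon> \<le> (norm (?w$1) / 8) powr (-1/2) * D"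
    using reduced_torsion_bound[OF \<gamma>(2) assms(1) lw lw] tw[of 0 1] tw[of 1 0]
    by (simp_all add: D_def mult.assoc)
  then have "norm (?w $ 1) \<le> K" "norm (?w $ 2) \<le> K"
    unfolding K_def using powr_bound_aux[OF assms(2) D pos] by blast+
  then have "norm ?w \<le> 2 * K"
    using sqrt_sum_squares_le_sum[of "norm (?w$1)" "norm (?w$2)"]
    by (simp add: norm_vec2)
  then show "\<exists>\<gamma>. det \<gamma> = 1 \<and> norm (cz \<gamma> *v u) \<le> 2 * (8 * (D / \<epsilon>)\<^sup>2)"
    using \<gamma>(1) by (auto simp: K_def)
qed

section \<open>The semigroup in coordinates\<close>

text \<open>The upper left entry of \<open>conj(g)\<^sup>-\<^sup>1 g\<close>, for \<open>g\<close> of determinant 1.  This product is invariant under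
  left multiplication by real matrices; it is \<open>exp (2 i X)\<close> for \<open>g = h exp (i X)\<close> with real \<open>h\<close>, so that
  half its trace, the real part of this entry, is \<open>cosh (2 \<theta>)\<close>, where \<open>X\<close> has eigenvalues \<open>\<plusminus> i \<theta>\<close>.\<close>

definition p11 :: "complex ^ 2 ^ 2 \<Rightarrow> complex" where
  "p11 g = g$1$1 * cnj (g$2$2) - cnj (g$1$2) * g$2$1"

definition Sset :: "real \<Rightarrow> (complex ^ 2 ^ 2) set" where
  "Sset \<epsilon> = {g. det g = 1 \<and> Re (p11 g) > 1 \<and> \<epsilon> * orient (column 2 g) > 0}"

lemma orient_column: "orient (column j g) = Im (g$1$j * cnj (g$2$j))"
  by (simp add: orient_def column_def)

text \<open>This is \<open>det (conj(g)\<^sup>-\<^sup>1 g) = 1\<close>: the off-diagonal entries of the matrix are \<open>\<plusminus> 2 i\<close> times the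
  orientations of the columns, and its diagonal entries are conjugate to each other.\<close>

lemma norm_p11_sq:
  assumes "det g = 1"
  shows "(Re (p11 g))\<^sup>2 + (Im (p11 g))\<^sup>2 = 1 + 4 * orient (column 1 g) * orient (column 2 g)"
proof -
  obtain a b c d where g: "a = g$1$1" "b = g$1$2" "c = g$2$1" "d = g$2$2" by blast
  have det: "Re (a * d - b * c) = 1" "Im (a * d - b * c) = 0"
    using assms by (auto simp: det_2 g)
  have "(Re (p11 g))\<^sup>2 + (Im (p11 g))\<^sup>2 =
     (Re (a * d - b * c))\<^sup>2 + (Im (a * d - b * c))\<^sup>2 + 4 * orient (column 1 g) * orient (column 2 g)"
    unfolding p11_def orient_column g[symmetric] by (simp add: algebra_simps power2_eq_square)
  then show ?thesis by (simp only: det) simp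
qed

abbreviation vmat :: "'a::zero \<Rightarrow> 'a \<Rightarrow> 'a \<Rightarrow> 'a \<Rightarrow> 'a ^ 2 ^ 2" where
  "vmat a b c d \<equiv> vector [vector [a, b], vector [c, d]]"

lemma mat2_eq_iff: "(A :: 'a ^ 2 ^ 2) = B \<longleftrightarrow>
   A$1$1 = B$1$1 \<and> A$1$2 = B$1$2 \<and> A$2$1 = B$2$1 \<and> A$2$2 = B$2$2"
  by (auto simp: vec_eq_iff forall_2)

lemma mat2_mult_nth: "(A ** B) $ i $ j = A$i$1 * B$1$j + A$i$2 * B$2$j"
  for A B :: "'a::comm_ring_1 ^ 2 ^ 2"
  by (simp add: matrix_matrix_mult_def sum_2)

lemma mat2_mat1_nth: "(mat 1 :: 'a::comm_ring_1 ^ 2 ^ 2) $ i $ j = (if i = j then 1 else 0)"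
  by (simp add: mat_def)

lemma scaleR_mat1_nth: "(r *\<^sub>R (mat 1 :: complex ^ 2 ^ 2)) $ i $ j = (if i = j then of_real r else 0)"
  by (simp add: mat2_mat1_nth of_real_def)

lemma map_matrix_nth: "map_matrix f A $ i $ j = f (A $ i $ j)"
  by (simp add: map_matrix_def)

lemma sl_2: "X \<in> sl \<longleftrightarrow> X$2$2 = - X$1$1" for X :: "'a::comm_ring_1 ^ 2 ^ 2"
  by (auto simp: sl_def trace_def sum_2 add_eq_0_iff2 add.commute)

lemma matrix_scaleR_right: "A ** (r *\<^sub>R B) = r *\<^sub>R (A ** (B :: complex ^ 'n ^ 'n))"
  by (simp add: matrix_matrix_mult_def vec_eq_iff scaleR_sum_right)

text \<open>The powers of \<open>Y\<close> alternate between multiples of the identity and of \<open>Y\<close>, so the exponential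
  series splits into those of \<open>cosh\<close> and \<open>sinh\<close>.\<close>

lemma matrix_exp_involution:
  fixes Y :: "complex ^ 2 ^ 2"
  assumes Y: "Y ** Y = \<theta>\<^sup>2 *\<^sub>R mat 1" and "\<theta> \<noteq> 0"
  shows "matrix_exp Y = cosh \<theta> *\<^sub>R mat 1 + (sinh \<theta> / \<theta>) *\<^sub>R Y"
proof -
  define c d where "c k = (\<theta> ^ k + (- \<theta>) ^ k) / 2" and "d k = (\<theta> ^ k - (- \<theta>) ^ k) / (2 * \<theta>)" for k :: nat
  have pow: "((**) Y ^^ k) (mat 1) = c k *\<^sub>R mat 1 + d k *\<^sub>R Y" for k
  proof (induction k)
    case (Suc k)
    have "((**) Y ^^ Suc k) (mat 1) = Y ** (c k *\<^sub>R mat 1 + d k *\<^sub>R Y)" using Suc by simp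
    also have "\<dots> = (d k * \<theta>\<^sup>2) *\<^sub>R mat 1 + c k *\<^sub>R Y"
      by (simp add: matrix_add_ldistrib matrix_scaleR_right Y)
    also have "d k * \<theta>\<^sup>2 = c (Suc k)" using assms(2) by (simp add: c_def d_def power2_eq_square field_simps)
    also have "c k = d (Suc k)" using assms(2) by (simp add: c_def d_def field_simps)
    finally show ?case .
  qed (simp add: c_def d_def)
  have e: "(\<lambda>k. x ^ k /\<^sub>R fact k) sums exp x" for x :: real by (rule exp_converges)
  have "(\<lambda>k. (\<theta> ^ k /\<^sub>R fact k + (- \<theta>) ^ k /\<^sub>R fact k) / 2) sums ((exp \<theta> + exp (- \<theta>)) / 2)"
    by (intro sums_divide sums_add e)
  then have sc: "(\<lambda>k. c k / fact k) sums cosh \<theta>"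
    by (simp add: c_def cosh_def field_simps)
  have "(\<lambda>k. (\<theta> ^ k /\<^sub>R fact k - (- \<theta>) ^ k /\<^sub>R fact k) / (2 * \<theta>)) sums ((exp \<theta> - exp (- \<theta>)) / (2 * \<theta>))"
    by (intro sums_divide sums_diff e)
  then have sd: "(\<lambda>k. d k / fact k) sums (sinh \<theta> / \<theta>)"
    by (simp add: d_def sinh_def field_simps)
  have "(\<lambda>k. (c k / fact k) *\<^sub>R (mat 1 :: complex ^ 2 ^ 2) + (d k / fact k) *\<^sub>R Y)
      sums (cosh \<theta> *\<^sub>R mat 1 + (sinh \<theta> / \<theta>) *\<^sub>R Y)"
    by (intro sums_add bounded_linear.sums[OF bounded_linear_scaleR_left] sc sd)
  also have "(\<lambda>k. (c k / fact k) *\<^sub>R (mat 1 :: complex ^ 2 ^ 2) + (d k / fact k) *\<^sub>R Y) =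
      (\<lambda>k. (((**) Y ^^ k) (mat 1)) /\<^sub>R fact k)"
    by (simp add: pow fun_eq_iff scaleR_add_right field_simps)
  finally show ?thesis unfolding matrix_exp_def by (simp add: sums_iff)
qed

lemma matrix_exp_elliptic:
  fixes X :: "real ^ 2 ^ 2"
  assumes X: "X \<in> sl" and \<theta>: "det X = \<theta>\<^sup>2" "\<theta> \<noteq> 0"
  shows "matrix_exp (cscale \<i> (complexify X)) =
    vmat (of_real (cosh \<theta>) + \<i> * of_real (sinh \<theta> / \<theta> * X$1$1)) (\<i> * of_real (sinh \<theta> / \<theta> * X$1$2))
         (\<i> * of_real (sinh \<theta> / \<theta> * X$2$1)) (of_real (cosh \<theta>) - \<i> * of_real (sinh \<theta> / \<theta> * X$1$1))"
proof -
  let ?Y = "cscale \<i> (complexify X)"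
  have x22: "X$2$2 = - X$1$1" using X by (simp add: sl_2)
  have d: "- (X$1$1 * X$1$1) - X$1$2 * X$2$1 = \<theta>\<^sup>2" using \<theta>(1) by (simp add: det_2 x22)
  have "?Y ** ?Y = \<theta>\<^sup>2 *\<^sub>R mat 1"
  proof -
    have "complex_of_real \<theta> ^ 2 = of_real (\<theta>\<^sup>2)" by simp
    also have "\<dots> = - (complex_of_real (X$1$1) * of_real (X$1$1)) - of_real (X$1$2) * of_real (X$2$1)"
      unfolding d[symmetric] by simp
    finally have "- (complex_of_real (X$1$1) * of_real (X$1$1)) = of_real \<theta> ^ 2 + of_real (X$1$2) * of_real (X$2$1)"
      by simp
    then show ?thesis
      unfolding mat2_eq_iff mat2_mult_nth scaleR_mat1_nth map_matrix_nth x22 by (simp add: algebra_simps)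
  qed
  from matrix_exp_involution[OF this \<theta>(2)] show ?thesis
    by (simp add: mat2_eq_iff mat2_mat1_nth map_matrix_nth x22 vector_scaleR_component of_real_def)
qed

lemma real_left_invariance:
  assumes "det h = 1"
  shows "p11 (complexify h ** g) = p11 g"
    and "orient (column j (complexify h ** g)) = orient (column j g)"
    and "det (complexify h ** g) = det g"
proof -
  have h: "h$1$1 * h$2$2 - h$1$2 * h$2$1 = 1" using assms by (simp add: det_2)
  then have hc: "complex_of_real (h$1$1) * of_real (h$2$2) - of_real (h$1$2) * of_real (h$2$1) = 1"
    by (metis of_real_1 of_real_diff of_real_mult)
  have "p11 (complexify h ** g) =
     (complex_of_real (h$1$1) * of_real (h$2$2) - of_real (h$1$2) * of_real (h$2$1)) * p11 g"
    by (simp add: p11_def mat2_mult_nth map_matrix_def algebra_simps)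
  then show "p11 (complexify h ** g) = p11 g" by (simp add: hc)
  have "orient (column j (complexify h ** g)) =
      (h$1$1 * h$2$2 - h$1$2 * h$2$1) * orient (column j g)"
    by (simp add: orient_column mat2_mult_nth map_matrix_def algebra_simps)
  then show "orient (column j (complexify h ** g)) = orient (column j g)" by (simp add: h)
  have "det (complexify h) = complex_of_real (h$1$1) * of_real (h$2$2) - of_real (h$1$2) * of_real (h$2$1)"
    by (simp add: det_2 map_matrix_def)
  then show "det (complexify h ** g) = det g" by (simp add: det_mul hc)
qed

lemma exp_in_Sset:
  fixes X :: "real ^ 2 ^ 2"
  assumes X: "X \<in> sl" "det X > 0" "\<epsilon> * X$1$2 > 0"
  shows "matrix_exp (cscale \<i> (complexify X)) \<in> Sset \<epsilon>"
proof -
  define \<theta> where "\<theta> = sqrt (det X)"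
  have \<theta>: "\<theta> > 0" "det X = \<theta>\<^sup>2" using X(2) by (auto simp: \<theta>_def)
  define C s x y z where "C = cosh \<theta>" and "s = sinh \<theta> / \<theta>" and "x = X$1$1" and "y = X$1$2" and "z = X$2$1"
  have s: "s > 0" and C: "C > 0" using \<theta>(1) by (auto simp: s_def C_def)
  have st: "s * \<theta> = sinh \<theta>" using \<theta>(1) by (simp add: s_def)
  have d: "- (x * x) - y * z = \<theta>\<^sup>2" using X(1) \<theta>(2) by (simp add: det_2 sl_2 x_def y_def z_def)
  let ?E = "vmat (of_real C + \<i> * of_real (s * x)) (\<i> * of_real (s * y))
                (\<i> * of_real (s * z)) (of_real C - \<i> * of_real (s * x))"
  have E: "matrix_exp (cscale \<i> (complexify X)) = ?E"
    using matrix_exp_elliptic[OF X(1) \<theta>(2)] \<theta>(1) by (simp add: C_def s_def x_def y_def z_def)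
  have "det ?E = of_real (C\<^sup>2 - s\<^sup>2 * (- (x * x) - y * z))"
    by (simp add: det_2 algebra_simps power2_eq_square complex_eq_iff)
  also have "C\<^sup>2 - s\<^sup>2 * (- (x * x) - y * z) = cosh \<theta> ^ 2 - sinh \<theta> ^ 2"
    by (simp only: d C_def st[symmetric] power_mult_distrib)
  also have "\<dots> = 1" by (simp add: cosh_square_eq)
  finally have 1: "det ?E = 1" by simp
  have "Re (p11 ?E) = C\<^sup>2 + s\<^sup>2 * (- (x * x) - y * z)"
    by (simp add: p11_def algebra_simps power2_eq_square)
  also have "\<dots> = 1 + 2 * sinh \<theta> ^ 2"
    by (simp only: d C_def st[symmetric] power_mult_distrib[symmetric]) (simp add: st cosh_square_eq)
  finally have 2: "Re (p11 ?E) > 1" using \<theta>(1) by simp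
  have "\<epsilon> * orient (column 2 ?E) = (\<epsilon> * y) * (s * C)"
    by (simp add: orient_column algebra_simps)
  also have "\<dots> > 0" using X(3) s C by (simp add: y_def)
  finally show ?thesis using 1 2 by (simp add: Sset_def E)
qed

text \<open>Polar decomposition by hand.  The imaginary part of \<open>conj(g)\<^sup>-\<^sup>1 g = exp (2 i X)\<close> is a positive
  multiple of \<open>X\<close>, and its trace determines the length of \<open>X\<close>; then \<open>h = g exp (- i X)\<close> turns out to be
  the entrywise real part of \<open>g\<close> divided by \<open>cosh \<theta>\<close>.\<close>

lemma Sset_polar:
  assumes g: "g \<in> Sset \<epsilon>"
  obtains h :: "real ^ 2 ^ 2" and X where "det h = 1" "X \<in> sl" "det X > 0" "\<epsilon> * X$1$2 > 0"
    "g = complexify h ** matrix_exp (cscale \<i> (complexify X))"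
proof -
  define p0 m H1 H2 where "p0 = Re (p11 g)" and "m = Im (p11 g)"
    and "H1 = orient (column 1 g)" and "H2 = orient (column 2 g)"
  have det: "det g = 1" and p0: "p0 > 1" and H2: "\<epsilon> * H2 > 0"
    using g by (auto simp: Sset_def p0_def H2_def)
  have pm: "p0\<^sup>2 + m\<^sup>2 = 1 + 4 * H1 * H2"
    using norm_p11_sq[OF det] by (simp add: p0_def m_def H1_def H2_def)
  define C S where "C = sqrt ((p0 + 1) / 2)" and "S = sqrt ((p0 - 1) / 2)"
  have C2: "C\<^sup>2 = (p0 + 1) / 2" and S2: "S\<^sup>2 = (p0 - 1) / 2" and CS: "C > 0" "S > 0"
    using p0 by (auto simp: C_def S_def)
  define \<theta> where "\<theta> = arsinh S"
  have sh: "sinh \<theta> = S" by (simp add: \<theta>_def)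
  have \<theta>: "\<theta> > 0" using CS(2) sh by (metis sinh_real_pos_iff)
  have ch: "cosh \<theta> = C"
  proof (rule power2_eq_imp_eq)
    show "(cosh \<theta>)\<^sup>2 = C\<^sup>2" using C2 S2 by (simp add: cosh_square_eq sh)
  qed (use CS in auto)
  define k where "k = \<theta> / (2 * C * S)"
  have k: "k > 0" using CS \<theta> by (simp add: k_def)
  define X :: "real ^ 2 ^ 2" where "X = vmat (k * m) (k * (2 * H2)) (k * (-2 * H1)) (- (k * m))"
  have X: "X \<in> sl" by (simp add: sl_2 X_def)
  have "det X = k\<^sup>2 * (4 * H1 * H2 - m\<^sup>2)"
    by (simp add: X_def det_2 algebra_simps power2_eq_square)
  also have "4 * H1 * H2 - m\<^sup>2 = (2 * C * S)\<^sup>2"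
  proof -
    have "(2 * C * S)\<^sup>2 = 4 * C\<^sup>2 * S\<^sup>2" by (simp add: power_mult_distrib)
    also have "\<dots> = p0\<^sup>2 - 1" unfolding C2 S2 by (simp add: field_simps power2_eq_square)
    finally show ?thesis using pm by simp
  qed
  also have "k\<^sup>2 * (2 * C * S)\<^sup>2 = \<theta>\<^sup>2"
    using CS by (simp add: k_def power_mult_distrib[symmetric])
  finally have dX: "det X = \<theta>\<^sup>2" .
  have sk: "sinh \<theta> / \<theta> * k = 1 / (2 * C)" using CS \<theta> by (simp add: sh k_def)
  have E: "matrix_exp (cscale \<i> (complexify X)) =
     vmat (of_real C + \<i> * of_real (m / (2 * C))) (\<i> * of_real (H2 / C))
          (\<i> * of_real (- H1 / C)) (of_real C - \<i> * of_real (m / (2 * C)))"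
  proof -
    have e: "sinh \<theta> / \<theta> * (k * x) = x / (2 * C)" for x
      using sk by (metis mult.assoc mult.commute mult.right_neutral times_divide_eq_right)
    have "sinh \<theta> / \<theta> * X$1$1 = m / (2 * C)" "sinh \<theta> / \<theta> * X$1$2 = H2 / C" "sinh \<theta> / \<theta> * X$2$1 = - H1 / C"
      using e[of m] e[of "2 * H2"] e[of "-2 * H1"] by (simp_all add: X_def)
    then show ?thesis using matrix_exp_elliptic[OF X dX] \<theta> by (simp only: ch)
  qed
  obtain a b c d where abcd: "a = g$1$1" "b = g$1$2" "c = g$2$1" "d = g$2$2" by blast
  have dt: "a * d - b * c = 1" using det by (simp add: det_2 abcd)
  then have dt': "cnj a * cnj d - cnj b * cnj c = 1"
    by (metis complex_cnj_diff complex_cnj_mult complex_cnj_one)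
  define h :: "real ^ 2 ^ 2" where "h = vmat (Re a / C) (Re b / C) (Re c / C) (Re d / C)"
  define P P' where "P = a * cnj d - cnj b * c" and "P' = cnj a * d - b * cnj c"
  have PP: "of_real p0 + \<i> * of_real m = P"
    by (simp add: p0_def m_def p11_def abcd complex_eq_iff P_def)
  have PP': "of_real p0 - \<i> * of_real m = P'"
    by (simp add: p0_def m_def p11_def abcd complex_eq_iff P'_def)
  have H1: "2 * \<i> * of_real H1 = a * cnj c - cnj a * c"
    by (simp add: H1_def orient_column abcd complex_eq_iff)
  have H2': "2 * \<i> * of_real H2 = b * cnj d - cnj b * d"
    by (simp add: H2_def orient_column abcd complex_eq_iff)
  define c0 where "c0 = complex_of_real C"
  have c0: "c0 \<noteq> 0" using CS by (simp add: c0_def)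
  have "2 * (c0 * c0) = of_real (2 * (C * C))" by (simp add: c0_def)
  also have "2 * (C * C) = p0 + 1" using C2 by (simp add: power2_eq_square)
  finally have cc: "2 * (c0 * c0) = of_real p0 + 1" by simp
  have cc4: "4 * (c0 * c0) = 2 + P + P'"
  proof -
    have "4 * (c0 * c0) = 2 * (2 * (c0 * c0))" by simp
    also have "\<dots> = 2 * (of_real p0 + 1)" by (simp only: cc)
    also have "\<dots> = 2 + P + P'" unfolding PP[symmetric] PP'[symmetric] by simp
    finally show ?thesis .
  qed
  have comb1: "of_real (Re v / C) * (of_real C + \<i> * of_real (m / (2 * C))) + of_real (Re w / C) * (\<i> * of_real (- H1 / C)) = x"
    if "(v + cnj v) * (1 + P) - (w + cnj w) * (a * cnj c - cnj a * c) = x * (2 + P + P')" for v w x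
  proof -
    have "of_real (Re v / C) * (of_real C + \<i> * of_real (m / (2 * C))) + of_real (Re w / C) * (\<i> * of_real (- H1 / C))
       = ((v + cnj v) * (2 * (c0 * c0) + \<i> * of_real m) - (w + cnj w) * (2 * \<i> * of_real H1)) / (4 * (c0 * c0))"
      using c0 by (simp add: complex_add_cnj c0_def field_simps)
    also have "2 * (c0 * c0) + \<i> * of_real m = 1 + P" unfolding cc PP[symmetric] by simp
    also have "((v + cnj v) * (1 + P) - (w + cnj w) * (2 * \<i> * of_real H1)) / (4 * (c0 * c0)) = x"
      unfolding H1 that cc4[symmetric] using c0 by simp
    finally show ?thesis .
  qed
  have comb2: "of_real (Re v / C) * (\<i> * of_real (H2 / C)) + of_real (Re w / C) * (of_real C - \<i> * of_real (m / (2 * C))) = x"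
    if "(v + cnj v) * (b * cnj d - cnj b * d) + (w + cnj w) * (1 + P') = x * (2 + P + P')" for v w x
  proof -
    have "of_real (Re v / C) * (\<i> * of_real (H2 / C)) + of_real (Re w / C) * (of_real C - \<i> * of_real (m / (2 * C)))
       = ((v + cnj v) * (2 * \<i> * of_real H2) + (w + cnj w) * (2 * (c0 * c0) - \<i> * of_real m)) / (4 * (c0 * c0))"
      using c0 by (simp add: complex_add_cnj c0_def field_simps)
    also have "2 * (c0 * c0) - \<i> * of_real m = 1 + P'" unfolding cc PP'[symmetric] by simp
    also have "((v + cnj v) * (2 * \<i> * of_real H2) + (w + cnj w) * (1 + P')) / (4 * (c0 * c0)) = x"
      unfolding H2' that cc4[symmetric] using c0 by simp
    finally show ?thesis .
  qed
  \<comment> \<open>conjugates are treated as independent variables, which makes the identities polynomial\<close>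
  have poly:
    "(a + a') * (1 + (a * d' - b' * c)) - (b + b') * (a * c' - a' * c) = a * (2 + (a * d' - b' * c) + (a' * d - b * c'))"
    "(c + c') * (1 + (a * d' - b' * c)) - (d + d') * (a * c' - a' * c) = c * (2 + (a * d' - b' * c) + (a' * d - b * c'))"
    "(a + a') * (b * d' - b' * d) + (b + b') * (1 + (a' * d - b * c')) = b * (2 + (a * d' - b' * c) + (a' * d - b * c'))"
    "(c + c') * (b * d' - b' * d) + (d + d') * (1 + (a' * d - b * c')) = d * (2 + (a * d' - b' * c) + (a' * d - b * c'))"
    if "a * d - b * c = 1" "a' * d' - b' * c' = 1" for a b c d a' b' c' d' :: complex
    using that by algebra+
  note poly' = poly[OF dt dt', folded P_def P'_def]
  have gE: "g = complexify h ** matrix_exp (cscale \<i> (complexify X))"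
    unfolding E mat2_eq_iff mat2_mult_nth
    using comb1[OF poly'(1)] comb1[OF poly'(2)] comb2[OF poly'(3)] comb2[OF poly'(4)]
    by (simp add: h_def map_matrix_def abcd)
  have X12: "\<epsilon> * X$1$2 > 0" using H2 k by (simp add: X_def mult.left_commute[of \<epsilon>])
  have "det X > 0" using dX \<theta> by simp
  from exp_in_Sset[OF X this X12] have "det (matrix_exp (cscale \<i> (complexify X))) = 1" by (simp add: Sset_def)
  then have "det (complexify h) = 1" using det by (simp add: gE det_mul)
  then have "complex_of_real (det h) = 1" by (simp add: det_2 map_matrix_def)
  then have "det h = 1" by simp
  then show ?thesis using that X \<open>det X > 0\<close> X12 gE by blast
qed

section \<open>Elliptic cones\<close>

lemma matrix_inv_eqI:
  fixes A :: "'a::field ^ 'n ^ 'n"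
  assumes "A ** B = mat 1" "B ** A = mat 1"
  shows "matrix_inv A = B"
proof -
  have "A ** matrix_inv A = mat 1 \<and> matrix_inv A ** A = mat 1"
    unfolding matrix_inv_def by (rule someI[of "\<lambda>C. A ** C = mat 1 \<and> C ** A = mat 1"]) (use assms in simp)
  then have "B ** (A ** matrix_inv A) = B" by simp
  then show ?thesis by (simp add: matrix_mul_assoc assms)
qed

text \<open>If \<open>m\<close> and \<open>- m\<close> are the real eigenvalues of \<open>X\<close>, a right eigenvector for \<open>m\<close> times a left eigenvector
  for \<open>- m\<close> is an eigenvector of \<open>ad X\<close> for \<open>2 m\<close>.  Each of the two cases picks eigenvectors that do not
  vanish.\<close>

lemma exists_eigenvector_ad:
  fixes X :: "real ^ 2 ^ 2"
  assumes X: "X \<in> sl" and "det X < 0"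
  shows "\<exists>c\<in>ad_spectrum X. Re c \<noteq> 0"
proof -
  define \<mu> where "\<mu> = sqrt (- det X)"
  have \<mu>: "\<mu> > 0" "\<mu>\<^sup>2 = - det X" using assms(2) by (auto simp: \<mu>_def)
  define x y z m where "x = complex_of_real (X$1$1)" and "y = complex_of_real (X$1$2)"
    and "z = complex_of_real (X$2$1)" and "m = complex_of_real \<mu>"
  have x22: "X$2$2 = - X$1$1" using X by (simp add: sl_2)
  have "m * m = of_real (\<mu>\<^sup>2)" by (simp add: m_def power2_eq_square)
  also have "\<mu>\<^sup>2 = X$1$1 * X$1$1 + X$1$2 * X$2$1" using \<mu>(2) by (simp add: det_2 x22)
  finally have mm: "m * m = x * x + y * z" by (simp add: x_def y_def z_def)
  have m0: "m \<noteq> 0" using \<mu> by (simp add: m_def)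
  have cX: "complexify X $ 1 $ 1 = x" "complexify X $ 1 $ 2 = y" "complexify X $ 2 $ 1 = z" "complexify X $ 2 $ 2 = - x"
    by (simp_all add: map_matrix_def x_def y_def z_def x22)
  have ad: "ad (complexify X) Y = cscale (2 * m) Y" "Y \<in> sl"
    if "Y$2$2 = - Y$1$1" "y * Y$2$1 - Y$1$2 * z = 2 * m * Y$1$1"
       "x * Y$1$2 - y * Y$1$1 = m * Y$1$2" "z * Y$1$1 - x * Y$2$1 = m * Y$2$1" for Y
    unfolding ad_def mat2_eq_iff vector_minus_component mat2_mult_nth cX map_matrix_nth[of "(*) (2 * m)"] sl_2
    using that by (simp_all add: algebra_simps)
  have "2 * m \<in> ad_spectrum X"
  proof (cases "z = 0 \<and> x = - m")
    case True
    let ?Y = "vmat (y * (x - m)) (y * y) (- ((x - m) * (x - m))) (y * (m - x))"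
    have "?Y \<noteq> 0" using True m0 by (auto simp: mat2_eq_iff)
    moreover have "ad (complexify X) ?Y = cscale (2 * m) ?Y"
    proof -
      have "y * - ((x - m) * (x - m)) - y * y * z = 2 * m * (y * (x - m))" using mm by algebra
      moreover have "z * (y * (x - m)) - x * - ((x - m) * (x - m)) = m * - ((x - m) * (x - m))" using mm by algebra
      moreover have "y * (m - x) = - (y * (x - m))" "x * (y * y) - y * (y * (x - m)) = m * (y * y)"
        by (simp_all add: algebra_simps)
      ultimately show ?thesis by (intro ad(1)) (simp_all only: vector_2)
    qed
    moreover have "?Y \<in> sl" by (simp add: sl_2 algebra_simps)
    ultimately show ?thesis unfolding ad_spectrum_def by blast
  next
    case False
    let ?Y = "vmat ((m + x) * z) (- ((m + x) * (m + x))) (z * z) (- (z * (m + x)))"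
    have "?Y \<noteq> 0" using False by (auto simp: mat2_eq_iff add_eq_0_iff2)
    moreover have "ad (complexify X) ?Y = cscale (2 * m) ?Y"
    proof -
      have "y * (z * z) - - ((m + x) * (m + x)) * z = 2 * m * ((m + x) * z)" using mm by algebra
      moreover have "x * - ((m + x) * (m + x)) - y * ((m + x) * z) = m * - ((m + x) * (m + x))" using mm by algebra
      moreover have "z * ((m + x) * z) - x * (z * z) = m * (z * z)" "- (z * (m + x)) = - ((m + x) * z)"
        by (simp_all add: algebra_simps)
      ultimately show ?thesis by (intro ad(1)) (simp_all only: vector_2)
    qed
    moreover have "?Y \<in> sl" by (simp add: sl_2 algebra_simps)
    ultimately show ?thesis unfolding ad_spectrum_def by blast
  qed
  then show ?thesis using \<mu> by (intro bexI[of _ "2 * m"]) (auto simp: m_def)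
qed

text \<open>Elements of negative determinant have real \<open>ad\<close>-eigenvalues.  An element of determinant 0 has
  neighbours of negative determinant, so an open set of elliptic elements avoids it as well.\<close>

lemma elliptic_det_pos:
  fixes W :: "(real ^ 2 ^ 2) set"
  assumes W: "W \<subseteq> sl" "openin (top_of_set sl) W" "\<forall>X\<in>W. elliptic X" and X: "X \<in> W"
  shows "det X > 0"
proof (rule ccontr)
  have nonneg: "det Y \<ge> 0" if "Y \<in> W" for Y
    using exists_eigenvector_ad[of Y] that W by (force simp: elliptic_def not_less[symmetric])
  assume "\<not> det X > 0"
  then have d: "det X = 0" using nonneg[OF X] by simp
  define x y z where "x = X$1$1" and "y = X$1$2" and "z = X$2$1"
  have x22: "X$2$2 = - x" using X W by (auto simp: sl_2 x_def)
  have d': "x * x + y * z = 0" using d by (simp add: det_2 x22 flip: x_def y_def z_def)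
  \<comment> \<open>a direction in which the determinant decreases; the transpose of \<open>X\<close> unless \<open>X = 0\<close>\<close>
  define Y :: "real ^ 2 ^ 2" where "Y = (if X = 0 then vmat 1 0 0 (-1) else vmat x z y (- x))"
  obtain T where T: "open T" "W = sl \<inter> T" using W(2) by (auto simp: openin_open)
  have "((\<lambda>t. X + t *\<^sub>R Y) \<longlongrightarrow> X + 0 *\<^sub>R Y) (at_right 0)" by (intro tendsto_intros)
  then have "\<forall>\<^sub>F t in at_right 0. X + t *\<^sub>R Y \<in> T"
    using topological_tendstoD[of _ "X + 0 *\<^sub>R Y" _ T] T X by auto
  moreover have "\<forall>\<^sub>F t in at_right (0::real). t > 0" by (simp add: eventually_at_right_less)
  ultimately have "\<forall>\<^sub>F t in at_right 0. X + t *\<^sub>R Y \<in> T \<and> t > 0" by (rule eventually_conj)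
  then obtain t where t: "X + t *\<^sub>R Y \<in> T" "t > 0"
    using eventually_happens'[of "at_right (0::real)"] trivial_limit_at_right_real by blast
  have "X + t *\<^sub>R Y \<in> sl" using x22 by (simp add: sl_2 Y_def x_def)
  then have "det (X + t *\<^sub>R Y) \<ge> 0" using t T(2) by (intro nonneg) auto
  moreover have "det (X + t *\<^sub>R Y) < 0"
  proof (cases "X = 0")
    case False
    have pos: "2 * (x * x) + y * y + z * z > 0"
    proof (rule ccontr)
      assume "\<not> ?thesis"
      then have "x * x = 0 \<and> y * y = 0 \<and> z * z = 0"
        using zero_le_square[of x] zero_le_square[of y] zero_le_square[of z] by linarith
      then show False using False x22 by (simp add: mat2_eq_iff x_def y_def z_def)
    qed
    have "det (X + t *\<^sub>R Y) = - (1 + t * t) * (x * x + y * z) - t * (2 * (x * x) + y * y + z * z)"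
      using False x22 by (simp add: Y_def det_2 algebra_simps flip: x_def y_def z_def)
    also have "\<dots> < 0" using pos t(2) by (simp add: d')
    finally show ?thesis .
  qed (use t in \<open>simp add: Y_def det_2\<close>)
  ultimately show False by simp
qed

text \<open>Upper triangular matrices already act transitively on each sheet of the hyperboloid \<open>det X = \<theta>\<^sup>2\<close>;
  the entries \<open>p, q\<close> are found by comparing the lower rows.\<close>

lemma conjugate_to_rotation:
  fixes X :: "real ^ 2 ^ 2"
  assumes X: "X \<in> sl" "det X = \<theta>\<^sup>2" "\<theta> > 0" and \<epsilon>: "\<epsilon> * X$1$2 > 0" "\<epsilon> = 1 \<or> \<epsilon> = -1"
  obtains g :: "real ^ 2 ^ 2" where "det g = 1" "X = g ** vmat 0 (\<epsilon> * \<theta>) (- \<epsilon> * \<theta>) 0 ** matrix_inv g"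
proof -
  define x y z where "x = X$1$1" and "y = X$1$2" and "z = X$2$1"
  have x22: "X$2$2 = - x" using X by (simp add: sl_2 x_def)
  have d: "- (x * x) - y * z = \<theta>\<^sup>2" using X(2) by (simp add: det_2 x22 flip: x_def y_def z_def)
  have yz: "y * z < 0"
  proof -
    have "\<theta>\<^sup>2 > 0" using X(3) by simp
    then show ?thesis using d zero_le_square[of x] by linarith
  qed
  have ez: "\<epsilon> * z < 0" using yz \<epsilon> by (auto simp: mult_less_0_iff y_def)
  define p where "p = sqrt (\<theta> / (- \<epsilon> * z))"
  define q where "q = - \<epsilon> * p * x / \<theta>"
  have p: "p > 0" using ez X(3) by (simp add: p_def divide_pos_neg)
  have ee: "\<epsilon> * \<epsilon> = 1" using \<epsilon>(2) by auto
  have z0: "z \<noteq> 0" using ez by auto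
  have pp: "p * p = \<theta> / (- \<epsilon> * z)" using ez X(3) by (simp add: p_def divide_nonneg_neg)
  have pz: "\<epsilon> * z * (p * p) = - \<theta>"
  proof -
    have "- \<epsilon> * z \<noteq> 0" using ez by auto
    then have "p * p * (- \<epsilon> * z) = \<theta>" unfolding pp by (rule nonzero_eq_divide_eq[THEN iffD1, OF _ refl])
    then show ?thesis by (simp add: algebra_simps)
  qed
  define g gi where "g = vmat p q 0 (1/p)" and "gi = vmat (1/p) (- q) 0 p"
  have inv: "g ** gi = mat 1" "gi ** g = mat 1"
    using p by (auto simp: g_def gi_def mat2_eq_iff mat2_mult_nth mat2_mat1_nth)
  then have mi: "matrix_inv g = gi" by (rule matrix_inv_eqI)
  have "X = g ** vmat 0 (\<epsilon> * \<theta>) (- \<epsilon> * \<theta>) 0 ** gi"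
  proof -
    have 1: "- (\<epsilon> * \<theta> * q / p) = x"
    proof -
      have "\<epsilon> * \<theta> * q / p = - (\<epsilon> * \<epsilon>) * x" using p X(3) by (simp add: q_def)
      then show ?thesis by (simp add: ee)
    qed
    have 2: "- (\<epsilon> * \<theta> / (p * p)) = z"
    proof -
      have "\<epsilon> * \<theta> = - (\<epsilon> * \<epsilon>) * z * (p * p)" using pz by (simp add: mult.assoc)
      then show ?thesis using p by (simp add: ee)
    qed
    have 3: "\<epsilon> * \<theta> * (p * p + q * q) = y"
    proof -
      have "\<epsilon> * \<theta> * (p * p + q * q) = \<epsilon> * (p * p) * (\<theta>\<^sup>2 + (\<epsilon> * \<epsilon>) * (x * x)) / \<theta>"
        using X(3) by (simp add: q_def field_simps power2_eq_square)
      also have "\<theta>\<^sup>2 + (\<epsilon> * \<epsilon>) * (x * x) = - y * z" using d by (simp add: ee)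
      also have "\<epsilon> * (p * p) * (- y * z) / \<theta> = - y * (\<epsilon> * z * (p * p)) / \<theta>" by simp
      also have "\<dots> = y" unfolding pz using X(3) by simp
      finally show ?thesis .
    qed
    show ?thesis
      using p 1 2 3 x22
      by (simp add: mat2_eq_iff mat2_mult_nth g_def gi_def x_def[symmetric] y_def[symmetric] z_def[symmetric] algebra_simps)
  qed
  moreover have "det g = 1" using p by (simp add: g_def det_2)
  ultimately show ?thesis using that mi by blast
qed

text \<open>The upper right entry vanishes nowhere on the cone, so by convexity it has constant sign; and all
  elements of one sign are conjugate to multiples of one rotation, so the cone contains them all.\<close>

theorem elliptic_cone_classification:
  fixes W :: "(real ^ 2 ^ 2) set"
  assumes W: "W \<subseteq> sl" "W \<noteq> {}" "openin (top_of_set sl) W" "convex W"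
    "closed_under_pos_scaling W" "Ad_invariant W" "\<forall>X\<in>W. elliptic X"
  obtains \<epsilon> :: real where "\<epsilon> = 1 \<or> \<epsilon> = -1" "W = {X \<in> sl. det X > 0 \<and> \<epsilon> * X$1$2 > 0}"
proof -
  note pos = elliptic_det_pos[OF W(1,3,7)]
  have ne: "X$1$2 \<noteq> 0" if "X \<in> W" for X
  proof
    assume z: "X$1$2 = 0"
    have "X$2$2 = - X$1$1" using that W(1) by (auto simp: sl_2)
    then have "det X = - (X$1$1 * X$1$1)" using z by (simp add: det_2)
    then show False using pos[OF that] zero_le_square[of "X$1$1"] by linarith
  qed
  have same_sign: "X$1$2 * Y$1$2 > 0" if XY: "X \<in> W" "Y \<in> W" for X Y
  proof (rule ccontr)
    define a b where "a = X$1$2" and "b = Y$1$2"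
    assume "\<not> X$1$2 * Y$1$2 > 0"
    then have ab: "a * b < 0" using ne[OF XY(1)] ne[OF XY(2)] by (auto simp: a_def b_def not_less order_le_less)
    define t where "t = a / (a - b)"
    have "a \<noteq> b" using ab zero_le_square[of a] by auto
    have t: "0 \<le> t" "t \<le> 1" using ab by (auto simp: t_def mult_less_0_iff divide_simps)
    have "(1 - t) *\<^sub>R X + t *\<^sub>R Y \<in> W" using convexD_alt[OF W(4) XY] t by blast
    moreover have "((1 - t) *\<^sub>R X + t *\<^sub>R Y) $1$2 = 0"
      using \<open>a \<noteq> b\<close> by (simp add: t_def field_simps flip: a_def b_def)
    ultimately show False using ne by blast
  qed
  obtain X0 where X0: "X0 \<in> W" using W(2) by blast
  define \<epsilon> where "\<epsilon> = sgn (X0$1$2)"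
  have \<epsilon>: "\<epsilon> = 1 \<or> \<epsilon> = -1" using ne[OF X0] by (auto simp: \<epsilon>_def sgn_if)
  have \<epsilon>X: "\<epsilon> * X$1$2 > 0" if "X \<in> W" for X
    using same_sign[OF X0 that] ne[OF X0] by (auto simp: \<epsilon>_def sgn_if zero_less_mult_iff split: if_splits)
  define R :: "real \<Rightarrow> real ^ 2 ^ 2" where "R t = vmat 0 (\<epsilon> * t) (- \<epsilon> * t) 0" for t
  have conj: "\<exists>g :: real ^ 2 ^ 2. det g = 1 \<and> X = g ** R (sqrt (det X)) ** matrix_inv g"
    if "X \<in> sl" "det X > 0" "\<epsilon> * X$1$2 > 0" for X :: "real ^ 2 ^ 2"
    using conjugate_to_rotation[of X "sqrt (det X)" \<epsilon>] that \<epsilon> unfolding R_def by (metis real_sqrt_gt_0_iff real_sqrt_pow2 less_imp_le)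
  obtain g :: "real ^ 2 ^ 2" where g: "det g = 1" "X0 = g ** R (sqrt (det X0)) ** matrix_inv g"
    using conj[OF _ pos[OF X0] \<epsilon>X[OF X0]] X0 W(1) by blast
  define gi where "gi = matrix_inv g"
  have "invertible g" using g(1) by (simp add: invertible_det_nz)
  then obtain g' where "g ** g' = mat 1" "g' ** g = mat 1" by (auto simp: invertible_def)
  then have gi: "g ** gi = mat 1" "gi ** g = mat 1" using matrix_inv_eqI by (auto simp: gi_def)
  have dgi: "det gi = 1" using g(1) arg_cong[OF gi(1), of det] by (simp add: det_mul)
  have gii: "matrix_inv gi = g" by (rule matrix_inv_eqI) (use gi in auto)
  have "gi ** X0 ** matrix_inv gi \<in> W"
    using W(6) X0 dgi by (auto simp: Ad_invariant_def SL_def)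
  also have "gi ** X0 ** matrix_inv gi = (gi ** g) ** R (sqrt (det X0)) ** (gi ** g)"
    by (subst g(2)) (simp only: gii gi_def[symmetric] matrix_mul_assoc)
  also have "\<dots> = R (sqrt (det X0))" by (simp add: gi)
  finally have R0: "R (sqrt (det X0)) \<in> W" .
  have "W = {X \<in> sl. det X > 0 \<and> \<epsilon> * X$1$2 > 0}"
  proof (intro equalityI subsetI)
    fix X :: "real ^ 2 ^ 2" assume "X \<in> {X \<in> sl. det X > 0 \<and> \<epsilon> * X$1$2 > 0}"
    then have X: "X \<in> sl" "det X > 0" "\<epsilon> * X$1$2 > 0" by auto
    obtain h :: "real ^ 2 ^ 2" where h: "det h = 1" "X = h ** R (sqrt (det X)) ** matrix_inv h" using conj[OF X] by blast
    define t where "t = sqrt (det X) / sqrt (det X0)"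
    have t: "t > 0" using X(2) pos[OF X0] by (simp add: t_def)
    have "R (sqrt (det X)) = t *\<^sub>R R (sqrt (det X0))"
      using pos[OF X0] by (simp add: R_def t_def mat2_eq_iff)
    then have "R (sqrt (det X)) \<in> W" using W(5) R0 t by (simp add: closed_under_pos_scaling_def)
    then have "h ** R (sqrt (det X)) ** matrix_inv h \<in> W"
      using W(6) h(1) by (auto simp: Ad_invariant_def SL_def)
    then show "X \<in> W" using h(2) by simp
  qed (use pos \<epsilon>X W(1) in auto)
  then show ?thesis using that \<epsilon> by blast
qed

theorem olshanskii_eq_Sset:
  assumes "\<epsilon> = 1 \<or> \<epsilon> = -1" "W = {X \<in> sl. det X > 0 \<and> \<epsilon> * X$1$2 > 0}"
  shows "olshanskii W = Sset \<epsilon>"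
proof (intro equalityI subsetI)
  fix s assume "s \<in> olshanskii W"
  then obtain g X where gX: "det g = 1" "X \<in> W" "s = complexify g ** matrix_exp (cscale \<i> (complexify X))"
    by (auto simp: olshanskii_def SL_def)
  then have "matrix_exp (cscale \<i> (complexify X)) \<in> Sset \<epsilon>" using assms(2) by (intro exp_in_Sset) auto
  then show "s \<in> Sset \<epsilon>" using gX by (simp add: Sset_def real_left_invariance)
next
  fix s assume "s \<in> Sset \<epsilon>"
  then show "s \<in> olshanskii W"
    using Sset_polar[of s \<epsilon>] assms(2) unfolding olshanskii_def SL_def
    by (smt (verit) mem_Collect_eq partial_object.select_convs(1))
qed

section \<open>Charts of the special linear group and integer matrices\<close>

lemma continuous_on_vecI:
  fixes f :: "'a::topological_space \<Rightarrow> 'b::topological_space ^ 'n"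
  assumes "\<And>i. continuous_on S (\<lambda>x. f x $ i)"
  shows "continuous_on S f"
proof -
  have "continuous_on S (\<lambda>x. \<chi> i. f x $ i)" by (intro continuous_on_vec_lambda assms)
  then show ?thesis by (simp add: vec_lambda_eta)
qed

lemma continuous_on_matI:
  fixes f :: "'a::topological_space \<Rightarrow> 'b::topological_space ^ 'n ^ 'm"
  assumes "\<And>i j. continuous_on S (\<lambda>x. f x $ i $ j)"
  shows "continuous_on S f"
  by (intro continuous_on_vecI assms)

lemma continuous_on_mat2_mult:
  fixes f g :: "'a::topological_space \<Rightarrow> complex ^ 2 ^ 2"
  assumes "continuous_on S f" "continuous_on S g"
  shows "continuous_on S (\<lambda>x. f x ** g x)"
  by (rule continuous_on_matI) (auto simp: mat2_mult_nth intro!: continuous_intros assms)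

text \<open>The inverse on matrices of determinant 1, but continuous everywhere.\<close>

definition adj2 :: "complex ^ 2 ^ 2 \<Rightarrow> complex ^ 2 ^ 2" where
  "adj2 A = vmat (A$2$2) (- A$1$2) (- A$2$1) (A$1$1)"

lemma adj2_right: "det A = 1 \<Longrightarrow> A ** adj2 A = mat 1"
  by (simp add: mat2_eq_iff mat2_mult_nth mat2_mat1_nth adj2_def det_2 algebra_simps)

lemma continuous_on_adj2: "continuous_on S f \<Longrightarrow> continuous_on S (\<lambda>x. adj2 (f x))"
proof (rule continuous_on_matI)
  fix i j :: 2 assume "continuous_on S f"
  then show "continuous_on S (\<lambda>x. adj2 (f x) $ i $ j)"
    using exhaust_2[of i] exhaust_2[of j] by (elim disjE) (simp_all add: adj2_def continuous_intros)
qed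

lemma group_SLZ: "group (SL :: (int ^ 2 ^ 2) monoid)"
proof (rule groupI)
  fix x :: "int ^ 2 ^ 2" assume "x \<in> carrier SL"
  then obtain y where "det y = 1" "y ** x = mat 1" using det1_inverse[of x] by (auto simp: SL_def)
  then show "\<exists>y\<in>carrier SL. y \<otimes>\<^bsub>SL\<^esub> x = \<one>\<^bsub>SL\<^esub>" by (auto simp: SL_def)
qed (auto simp: SL_def det_mul matrix_mul_assoc)

lemma closed_integer_matrices:
  fixes C :: "(int ^ 2 ^ 2) set"
  shows "closed (cz ` C)"
proof (rule discrete_imp_closed[of 1])
  have "cz \<gamma> = cz \<delta>" if "dist (cz \<gamma>) (cz \<delta>) < 1" for \<gamma> \<delta>
  proof -
    have "norm ((cz \<gamma> - cz \<delta>) $ i $ j) < 1" for i j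
      using that Finite_Cartesian_Product.norm_nth_le[of "cz \<gamma> - cz \<delta>" i]
        Finite_Cartesian_Product.norm_nth_le[of "(cz \<gamma> - cz \<delta>) $ i" j] by (simp only: dist_norm)
    then have "\<bar>real_of_int (\<gamma>$i$j - \<delta>$i$j)\<bar> < 1" for i j
      by (simp add: cz_nth flip: of_int_diff)
    then have "\<gamma>$i$j = \<delta>$i$j" for i j by (metis abs_if eq_iff_diff_eq_0 of_int_abs of_int_less_1_iff zabs_less_one_iff)
    then show ?thesis by (simp add: cz_inject vec_eq_iff)
  qed
  then show "\<forall>x\<in>cz ` C. \<forall>y\<in>cz ` C. dist y x < 1 \<longrightarrow> y = x" by blast
qed simp

lemma second_countable_euclidean: "second_countable (euclidean :: 'a::second_countable_topology topology)"
proof -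
  obtain B :: "'a set set" where B: "countable B" "topological_basis B" using ex_countable_basis by blast
  show ?thesis unfolding second_countable_def
  proof (intro exI[of _ B] conjI ballI allI impI B(1))
    show "openin euclidean V" if "V \<in> B" for V using that B(2) topological_basis_open by auto
    show "\<exists>V\<in>B. x \<in> V \<and> V \<subseteq> U" if "openin euclidean U \<and> x \<in> U" for U x
      using that topological_basisE[OF B(2), of U x] by auto
  qed
qed

lemma cz_real: "cz \<gamma> = complexify (map_matrix real_of_int \<gamma>)"
  by (simp add: map_matrix_def)

lemma det_real_of_int: "det (map_matrix real_of_int \<gamma>) = real_of_int (det (\<gamma> :: int ^ 2 ^ 2))"
  by (simp add: det_2 map_matrix_def)

lemma cz_Sset: "det \<gamma> = 1 \<Longrightarrow> cz \<gamma> ** s \<in> Sset \<epsilon> \<longleftrightarrow> s \<in> Sset \<epsilon>"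
  by (simp add: Sset_def cz_real real_left_invariance det_real_of_int)

lemma Sset_open: "\<exists>T. open T \<and> Sset \<epsilon> = {g. det g = 1} \<inter> T"
proof (intro exI conjI)
  show "open {g. Re (p11 g) > 1 \<and> \<epsilon> * orient (column 2 g) > 0}"
    unfolding p11_def orient_column
    by (intro open_Collect_conj open_Collect_less continuous_intros)
qed (auto simp: Sset_def)

text \<open>The inverse \<open>\<psi>\<close> of a chart solves \<open>det A = 1\<close> for the missing entry, a rational function of the
  others.  The coordinates of \<open>\<phi>\<close> itself are matrix entries; this form of its holomorphy is the one
  used for transition functions.\<close>

lemma SL2C_chart:
  assumes "(U, \<phi>) \<in> SL2C_atlas"
  obtains \<psi> D where "open D" "\<forall>A\<in>U. \<phi> A \<in> D \<and> \<psi> (\<phi> A) = A"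
    "\<forall>z\<in>D. \<psi> z \<in> U \<and> \<phi> (\<psi> z) = z"
    "\<forall>z\<in>D. \<forall>i j. cdiff (\<lambda>z. \<psi> z $ i $ j) z"
    "\<forall>k. \<exists>i j. \<forall>A. \<phi> A $ k = A $ i $ j"
proof -
  consider "U = {A \<in> carrier SL. A $ 1 $ 1 \<noteq> 0}" "\<phi> = (\<lambda>A. vector [A $ 1 $ 1, A $ 1 $ 2, A $ 2 $ 1])"
    | "U = {A \<in> carrier SL. A $ 1 $ 2 \<noteq> 0}" "\<phi> = (\<lambda>A. vector [A $ 1 $ 1, A $ 1 $ 2, A $ 2 $ 2])"
    using assms by (auto simp: SL2C_atlas_def)
  then show thesis
  proof cases
    case 1
    define \<psi> where "\<psi> z = vmat (z$1) (z$2) (z$3) ((1 + z$2 * z$3) / z$1)" for z :: "complex ^ 3"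
    show ?thesis
    proof (rule that[of "{z. z$1 \<noteq> 0}" \<psi>])
      show "open {z :: complex ^ 3. z $ 1 \<noteq> 0}" by (intro open_Collect_neq continuous_intros)
      show "\<forall>A\<in>U. \<phi> A \<in> {z. z $ 1 \<noteq> 0} \<and> \<psi> (\<phi> A) = A"
        by (auto simp: 1 \<psi>_def mat2_eq_iff SL_def det_2 field_simps)
      show "\<forall>z\<in>{z. z $ 1 \<noteq> 0}. \<psi> z \<in> U \<and> \<phi> (\<psi> z) = z"
        by (auto simp: 1 \<psi>_def SL_def det_2 vec_eq_iff forall_3)
      have "cdiff (\<lambda>z. \<psi> z $ i $ j) z" if "z \<in> {z. z $ 1 \<noteq> 0}" for z i j
        using that exhaust_2[of i] exhaust_2[of j]
        by (elim disjE) (simp_all add: \<psi>_def cdiff_nth cdiff_divide cdiff_add cdiff_diff cdiff_mult cdiff_const)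
      then show "\<forall>z\<in>{z. z $ 1 \<noteq> 0}. \<forall>i j. cdiff (\<lambda>z. \<psi> z $ i $ j) z" by blast
      have "\<exists>i j. \<forall>A. \<phi> A $ k = A $ i $ j" for k
        using exhaust_3[of k] by (elim disjE; simp add: 1; blast)
      then show "\<forall>k. \<exists>i j. \<forall>A. \<phi> A $ k = A $ i $ j" by blast
    qed
  next
    case 2
    define \<psi> where "\<psi> z = vmat (z$1) (z$2) ((z$1 * z$3 - 1) / z$2) (z$3)" for z :: "complex ^ 3"
    show ?thesis
    proof (rule that[of "{z. z$2 \<noteq> 0}" \<psi>])
      show "open {z :: complex ^ 3. z $ 2 \<noteq> 0}" by (intro open_Collect_neq continuous_intros)
      show "\<forall>A\<in>U. \<phi> A \<in> {z. z $ 2 \<noteq> 0} \<and> \<psi> (\<phi> A) = A"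
        by (auto simp: 2 \<psi>_def mat2_eq_iff SL_def det_2 field_simps)
      show "\<forall>z\<in>{z. z $ 2 \<noteq> 0}. \<psi> z \<in> U \<and> \<phi> (\<psi> z) = z"
        by (auto simp: 2 \<psi>_def SL_def det_2 vec_eq_iff forall_3)
      have "cdiff (\<lambda>z. \<psi> z $ i $ j) z" if "z \<in> {z. z $ 2 \<noteq> 0}" for z i j
        using that exhaust_2[of i] exhaust_2[of j]
        by (elim disjE) (simp_all add: \<psi>_def cdiff_nth cdiff_divide cdiff_add cdiff_diff cdiff_mult cdiff_const)
      then show "\<forall>z\<in>{z. z $ 2 \<noteq> 0}. \<forall>i j. cdiff (\<lambda>z. \<psi> z $ i $ j) z" by blast
      have "\<exists>i j. \<forall>A. \<phi> A $ k = A $ i $ j" for k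
        using exhaust_3[of k] by (elim disjE; simp add: 2; blast)
      then show "\<forall>k. \<exists>i j. \<forall>A. \<phi> A $ k = A $ i $ j" by blast
    qed
  qed
qed

lemma abs_orient_le: "\<bar>orient u\<bar> \<le> (norm u)\<^sup>2"
proof -
  have "\<bar>orient u\<bar> \<le> norm (u$1) * norm (u$2)"
    using abs_Im_le_cmod[of "u$1 * cnj (u$2)"] by (simp add: orient_def norm_mult)
  also have "\<dots> \<le> norm u * norm u"
    by (intro mult_mono Finite_Cartesian_Product.norm_nth_le) auto
  finally show ?thesis by (simp add: power2_eq_square)
qed

lemma norm_mat2_le: "norm (A :: complex ^ 2 ^ 2) \<le> norm (A$1$1) + norm (A$1$2) + (norm (A$2$1) + norm (A$2$2))"
proof -
  have "norm v \<le> norm (v$1) + norm (v$2)" for v :: "complex ^ 2"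
    unfolding norm_vec2 by (rule sqrt_sum_squares_le_sum) auto
  moreover have "norm A \<le> norm (A$1) + norm (A$2)"
    using sqrt_sum_squares_le_sum[of "norm (A$1)" "norm (A$2)"] by (simp add: norm_vec_def[of A] L2_set_def sum_2)
  ultimately show ?thesis by (meson add_mono order_trans)
qed

lemma column_eq: "s *v rvec 1 0 = column 1 s" "s *v rvec 0 1 = column 2 s"
  by (simp_all add: vec_eq_iff matrix_vector_mult_def column_def sum_2)

lemma column_mult: "column j (A ** B) = A *v column j (B :: complex ^ 2 ^ 2)"
  by (simp add: vec_eq_iff column_def matrix_matrix_mult_def matrix_vector_mult_def)

lemma lattice_rows_norm: "\<rho> \<in> lattice_rows \<Longrightarrow> 1 \<le> norm \<rho>"
proof -
  assume "\<rho> \<in> lattice_rows"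
  then obtain m n :: int where mn: "m \<noteq> 0 \<or> n \<noteq> 0" "\<rho> = rvec (of_int m) (of_int n)" by (auto simp: lattice_rows_def)
  then have "1 \<le> \<bar>real_of_int m\<bar> \<or> 1 \<le> \<bar>real_of_int n\<bar>" by linarith
  then show ?thesis unfolding mn(2)
    using abs_le_norm_rvec[where x = "real_of_int m" and y = "real_of_int n"] by linarith
qed

lemma finite_norm_bounded: "finite {\<tau> :: int ^ 2 ^ 2. det \<tau> = 1 \<and> norm (cz \<tau>) \<le> B}"
proof (rule finite_subset[OF _ finite_bounded_matrices[of B]], safe)
  fix \<tau> :: "int ^ 2 ^ 2" and i :: 2 assume "norm (cz \<tau>) \<le> B"
  moreover have "cz \<tau> $ i = rvec (\<tau>$i$1) (\<tau>$i$2)" by (simp add: vec_eq_iff forall_2 cz_nth)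
  ultimately show "norm (rvec (\<tau>$i$1) (\<tau>$i$2)) \<le> B"
    using Finite_Cartesian_Product.norm_nth_le[of "cz \<tau>" i] by simp
qed

section \<open>Estimates on the semigroup\<close>

lemma norm_matrix_vector_le: "norm (A *v x) \<le> norm A * norm (x :: complex ^ 'n)"
  for A :: "complex ^ 'n ^ 'm"
proof -
  have "norm ((A *v x) $ i) \<le> norm (A $ i) * norm x" for i
    using norm_bil_le[of "A $ i" x] by (simp add: bil_def matrix_vector_mult_def)
  then have "norm (A *v x) \<le> L2_set (\<lambda>i. norm (A $ i) * norm x) UNIV"
    unfolding norm_vec_def[of "A *v x"] by (intro L2_set_mono) auto
  also have "\<dots> = norm A * norm x"
    by (simp add: norm_vec_def[of A] L2_set_left_distrib)
  finally show ?thesis .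
qed

text \<open>The orientation of \<open>s v\<close> is a quadratic form in the real vector \<open>v\<close>, with discriminant
  governed by \<open>norm_p11_sq\<close>.\<close>

lemma orient_vector: "orient (s *v rvec x y) =
    x\<^sup>2 * orient (column 1 s) + y\<^sup>2 * orient (column 2 s) + x * y * Im (p11 s)"
  unfolding orient_column by (simp add: orient_def matrix_vector_mult_def sum_2 p11_def algebra_simps power2_eq_square)

locale orientation_sign =
  fixes \<epsilon> :: real assumes \<epsilon>: "\<epsilon> = 1 \<or> \<epsilon> = -1"
begin

lemma eps_sq: "\<epsilon> * \<epsilon> = 1" using \<epsilon> by auto

lemma Sset_orient_pos:
  assumes "s \<in> Sset \<epsilon>"
  shows "\<epsilon> * orient (column 1 s) > 0" "\<epsilon> * orient (column 2 s) > 0"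
    "4 * (\<epsilon> * orient (column 1 s)) * (\<epsilon> * orient (column 2 s)) - (Im (p11 s))\<^sup>2 = (Re (p11 s))\<^sup>2 - 1"
    "(Re (p11 s))\<^sup>2 > 1"
proof -
  have s: "det s = 1" "Re (p11 s) > 1" "\<epsilon> * orient (column 2 s) > 0" using assms by (auto simp: Sset_def)
  show 4: "(Re (p11 s))\<^sup>2 > 1" using s(2) by (simp add: one_less_power)
  show "\<epsilon> * orient (column 2 s) > 0" by fact
  have "4 * (\<epsilon> * orient (column 1 s)) * (\<epsilon> * orient (column 2 s)) =
      (\<epsilon> * \<epsilon>) * (4 * orient (column 1 s) * orient (column 2 s))" by simp
  then show 3: "4 * (\<epsilon> * orient (column 1 s)) * (\<epsilon> * orient (column 2 s)) - (Im (p11 s))\<^sup>2 = (Re (p11 s))\<^sup>2 - 1"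
    using norm_p11_sq[OF s(1)] by (simp only: eps_sq)
  have "4 * (\<epsilon> * orient (column 1 s)) * (\<epsilon> * orient (column 2 s)) > 0"
    using 3 4 zero_le_power2[of "Im (p11 s)"] by linarith
  then show "\<epsilon> * orient (column 1 s) > 0" using s(3) by (simp add: zero_less_mult_iff)
qed

definition orient_trace :: "complex ^ 2 ^ 2 \<Rightarrow> real" where
  "orient_trace s = \<epsilon> * orient (column 1 s) + \<epsilon> * orient (column 2 s)"

text \<open>The smallest eigenvalue of a positive definite binary form is at least its determinant divided by its
  trace.\<close>

lemma orient_lower_bound:
  assumes "s \<in> Sset \<epsilon>"
  shows "((Re (p11 s))\<^sup>2 - 1) * (norm (rvec x y))\<^sup>2 \<le> 4 * orient_trace s * (\<epsilon> * orient (s *v rvec x y))"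
proof -
  define A B m where "A = \<epsilon> * orient (column 1 s)" and "B = \<epsilon> * orient (column 2 s)" and "m = \<epsilon> * Im (p11 s)"
  have mm: "m\<^sup>2 = (Im (p11 s))\<^sup>2" using \<epsilon> by (auto simp: m_def)
  have "(Re (p11 s))\<^sup>2 - 1 = 4 * A * B - m\<^sup>2" using Sset_orient_pos(3)[OF assms] by (simp add: A_def B_def mm)
  moreover have "\<epsilon> * orient (s *v rvec x y) = A * x\<^sup>2 + m * x * y + B * y\<^sup>2"
    by (simp add: orient_vector A_def B_def m_def algebra_simps)
  moreover have "4 * (A + B) * (A * x\<^sup>2 + m * x * y + B * y\<^sup>2) =
     (4 * A * B - m\<^sup>2) * (x\<^sup>2 + y\<^sup>2) + (2 * A * x + m * y)\<^sup>2 + (m * x + 2 * B * y)\<^sup>2"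
    by (simp add: algebra_simps power2_eq_square)
  ultimately show ?thesis
    using zero_le_power2[of "2 * A * x + m * y"] zero_le_power2[of "m * x + 2 * B * y"]
    by (simp add: orient_trace_def norm_rvec A_def[symmetric] B_def[symmetric])
qed

lemma Sset_orient_vector_pos:
  assumes "s \<in> Sset \<epsilon>" "x \<noteq> 0 \<or> y \<noteq> 0"
  shows "\<epsilon> * orient (s *v rvec x y) > 0"
proof -
  have "0 < ((Re (p11 s))\<^sup>2 - 1) * (norm (rvec x y))\<^sup>2"
    using Sset_orient_pos(4)[OF assms(1)] assms(2) by auto
  then have "0 < 4 * orient_trace s * (\<epsilon> * orient (s *v rvec x y))"
    using orient_lower_bound[OF assms(1), of x y] by linarith
  moreover have "orient_trace s > 0" using Sset_orient_pos[OF assms(1)] by (simp add: orient_trace_def)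
  ultimately show ?thesis by (simp add: zero_less_mult_iff)
qed

lemma separation_pointwise:
  assumes s: "s \<in> Sset \<epsilon>"
  shows "((Re (p11 s))\<^sup>2 - 1) * (norm (rvec m n) * norm (rvec x y)) \<le>
    4 * orient_trace s * norm s * norm (bil (rvec m n) (s *v rvec x y))"
proof (cases "x = 0 \<and> y = 0")
  case True
  then have n: "norm (rvec x y) = 0" by (simp add: norm_rvec)
  from True have "s *v rvec x y = 0" by (simp add: matrix_vector_mult_def vec_eq_iff sum_2)
  then have "bil (rvec m n) (s *v rvec x y) = 0" by (simp only: bil_2) simp
  then show ?thesis unfolding n by simp
next
  case False
  define u D where "u = s *v rvec x y" and "D = (Re (p11 s))\<^sup>2 - 1"
  have v: "norm (rvec x y) > 0" using False by auto
  have tr: "orient_trace s > 0" using Sset_orient_pos[OF s] by (simp add: orient_trace_def)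
  have pos: "\<epsilon> * orient u > 0" using Sset_orient_vector_pos[OF s] False by (auto simp: u_def)
  have au: "\<bar>orient u\<bar> = \<epsilon> * orient u" using pos \<epsilon> by auto
  have "(D * (norm (rvec x y))\<^sup>2) * norm (rvec m n) \<le> (4 * orient_trace s * \<bar>orient u\<bar>) * norm (rvec m n)"
  proof (rule mult_right_mono)
    show "D * (norm (rvec x y))\<^sup>2 \<le> 4 * orient_trace s * \<bar>orient u\<bar>"
      unfolding au using orient_lower_bound[OF s, of x y] by (simp only: D_def u_def)
  qed simp
  also have "\<dots> = 4 * orient_trace s * (\<bar>orient u\<bar> * norm (rvec m n))" by simp
  also have "\<dots> \<le> 4 * orient_trace s * (norm u * norm (bil (rvec m n) u))"
    using norm_bil_rvec_ge[of u m n] tr by (intro mult_left_mono) auto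
  also have "\<dots> \<le> 4 * orient_trace s * ((norm s * norm (rvec x y)) * norm (bil (rvec m n) u))"
    using norm_matrix_vector_le[of s "rvec x y"] tr unfolding u_def
    by (intro mult_left_mono mult_right_mono) auto
  finally have "(D * (norm (rvec m n) * norm (rvec x y))) * norm (rvec x y) \<le>
      (4 * orient_trace s * norm s * norm (bil (rvec m n) u)) * norm (rvec x y)"
    by (simp add: power2_eq_square algebra_simps)
  then show ?thesis using v unfolding D_def u_def by simp
qed

lemma continuous_on_orient_trace: "continuous_on A orient_trace"
  unfolding orient_trace_def orient_column by (intro continuous_intros)

lemma continuous_on_p11: "continuous_on A p11"
  unfolding p11_def by (intro continuous_intros)

text \<open>The constant is the minimum over \<open>K\<close> of the continuous positive function of \<open>s\<close> read off from
  \<open>separation_pointwise\<close>; it serves all real vectors at once.\<close>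

lemma uniform_separation:
  assumes K: "compact K" "K \<subseteq> Sset \<epsilon>"
  obtains c where "c > 0" "\<And>s m n x y. s \<in> K \<Longrightarrow>
    c * norm (rvec m n) * norm (rvec x y) \<le> norm (bil (rvec m n) (s *v rvec x y))"
proof (cases "K = {}")
  case True
  then show ?thesis using that[of 1] by auto
next
  case False
  define f where "f s = ((Re (p11 s))\<^sup>2 - 1) / (4 * orient_trace s * norm s)" for s
  have tr: "orient_trace s > 0" "norm s > 0" if "s \<in> K" for s
  proof -
    have "s \<in> Sset \<epsilon>" using that K(2) by blast
    then show "orient_trace s > 0" using Sset_orient_pos[of s] by (simp add: orient_trace_def)
    have "s \<noteq> 0" using \<open>s \<in> Sset \<epsilon>\<close> by (auto simp: Sset_def det_2)
    then show "norm s > 0" by simp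
  qed
  have "continuous_on K f"
    unfolding f_def using tr
    by (intro continuous_intros continuous_on_orient_trace continuous_on_p11) (auto simp: less_imp_neq[symmetric])
  then obtain s0 where s0: "s0 \<in> K" "\<And>s. s \<in> K \<Longrightarrow> f s0 \<le> f s"
    using continuous_attains_inf[OF K(1) False] by blast
  show ?thesis
  proof (rule that[of "f s0"])
    show "f s0 > 0" using tr[OF s0(1)] Sset_orient_pos(4)[of s0] s0(1) K(2)
      unfolding f_def by (intro divide_pos_pos mult_pos_pos) auto
    fix s m n x y assume s: "s \<in> K"
    then have sS: "s \<in> Sset \<epsilon>" using K(2) by blast
    have pos: "4 * orient_trace s * norm s > 0" using tr[OF s] by simp
    have "f s0 * norm (rvec m n) * norm (rvec x y) \<le> f s * (norm (rvec m n) * norm (rvec x y))"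
      using mult_right_mono[OF s0(2)[OF s], of "norm (rvec m n) * norm (rvec x y)"] by simp
    also have "\<dots> \<le> norm (bil (rvec m n) (s *v rvec x y))"
      using separation_pointwise[OF sS, of m n x y] pos
      unfolding f_def times_divide_eq_left by (subst pos_divide_le_eq) (auto simp: mult.commute)
    finally show "f s0 * norm (rvec m n) * norm (rvec x y) \<le> norm (bil (rvec m n) (s *v rvec x y))" .
  qed
qed

text \<open>Cut out by closed conditions; for \<open>p > 1\<close> they still force membership in the semigroup
  (\<open>Scompact_subset\<close>), although the orientation is only required to be nonnegative.\<close>

definition Scompact :: "real \<Rightarrow> real \<Rightarrow> (complex ^ 2 ^ 2) set" where
  "Scompact R p = {g. det g = 1 \<and> norm g \<le> R \<and> p \<le> Re (p11 g) \<and> 0 \<le> \<epsilon> * orient (column 2 g)}"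

lemma compact_Scompact: "compact (Scompact R p)"
proof -
  have "closed {g :: complex ^ 2 ^ 2. det g = 1 \<and> p \<le> Re (p11 g) \<and> 0 \<le> \<epsilon> * orient (column 2 g)}"
    unfolding det_2 p11_def orient_column
    by (intro closed_Collect_conj closed_Collect_eq closed_Collect_le continuous_intros)
  moreover have "Scompact R p = cball 0 R \<inter> {g. det g = 1 \<and> p \<le> Re (p11 g) \<and> 0 \<le> \<epsilon> * orient (column 2 g)}"
    by (auto simp: Scompact_def)
  ultimately show ?thesis by (simp add: compact_Int_closed)
qed

lemma Scompact_subset:
  assumes "p > 1" shows "Scompact R p \<subseteq> Sset \<epsilon>"
proof
  fix g assume g: "g \<in> Scompact R p"
  then have "1 < Re (p11 g)" using assms by (auto simp: Scompact_def)
  then have "1 < (Re (p11 g))\<^sup>2" by (simp add: one_less_power)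
  have "orient (column 2 g) \<noteq> 0"
  proof
    assume "orient (column 2 g) = 0"
    then have "(Re (p11 g))\<^sup>2 + (Im (p11 g))\<^sup>2 = 1" using norm_p11_sq[of g] g by (simp add: Scompact_def)
    then show False using \<open>1 < (Re (p11 g))\<^sup>2\<close> zero_le_power2[of "Im (p11 g)"] by linarith
  qed
  then have "\<epsilon> * orient (column 2 g) \<noteq> 0" using \<epsilon> by auto
  moreover have "0 \<le> \<epsilon> * orient (column 2 g)" using g by (simp add: Scompact_def)
  ultimately have "0 < \<epsilon> * orient (column 2 g)" by linarith
  then show "g \<in> Sset \<epsilon>" using g \<open>1 < Re (p11 g)\<close> by (auto simp: Scompact_def Sset_def)
qed

text \<open>A lower bound for the form bounds its determinant from below, hence keeps \<open>Re (p11 s)\<close> away from 1.\<close>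

lemma p11_lower_bound:
  assumes s: "s \<in> Sset \<epsilon>" and c: "c > 0"
    and low: "\<And>x y. c * (norm (rvec x y))\<^sup>2 \<le> \<epsilon> * orient (s *v rvec x y)"
  shows "sqrt (1 + c\<^sup>2) \<le> Re (p11 s)"
proof -
  define A B m where "A = \<epsilon> * orient (column 1 s)" and "B = \<epsilon> * orient (column 2 s)" and "m = \<epsilon> * Im (p11 s)"
  have mm: "m\<^sup>2 = (Im (p11 s))\<^sup>2" using \<epsilon> by (auto simp: m_def)
  have q: "c * (x\<^sup>2 + y\<^sup>2) \<le> A * x\<^sup>2 + m * x * y + B * y\<^sup>2" for x y
    using low[of x y] by (simp add: orient_vector A_def B_def m_def norm_rvec algebra_simps)
  have A: "A \<ge> c" and B: "B \<ge> c" using q[of 1 0] q[of 0 1] by auto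
  \<comment> \<open>half of the bound is subtracted, so that the leading coefficient stays positive\<close>
  define a b where "a = A - c / 2" and "b = B - c / 2"
  have a: "a > 0" and b: "b \<ge> c / 2" using A B c by (auto simp: a_def b_def)
  have q': "0 \<le> a * x\<^sup>2 + m * x * y + b * y\<^sup>2" for x y
  proof -
    have "c / 2 * (x\<^sup>2 + y\<^sup>2) \<le> c * (x\<^sup>2 + y\<^sup>2)" using c by (intro mult_right_mono) auto
    with q[of x y] show ?thesis by (simp add: a_def b_def algebra_simps)
  qed
  have "0 \<le> a * (4 * a * b - m\<^sup>2)"
    using q'[of "- m" "2 * a"] by (simp add: algebra_simps power2_eq_square)
  then have m4: "m\<^sup>2 \<le> 4 * a * b" using a by (simp add: zero_le_mult_iff)
  have "(Re (p11 s))\<^sup>2 - 1 = 4 * A * B - m\<^sup>2" using Sset_orient_pos(3)[OF s] by (simp add: A_def B_def mm)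
  also have "\<dots> \<ge> 4 * A * B - 4 * a * b" using m4 by simp
  also have "4 * A * B - 4 * a * b = 2 * c * (A + B) - c\<^sup>2" by (simp add: a_def b_def algebra_simps power2_eq_square)
  finally have "(Re (p11 s))\<^sup>2 \<ge> 1 + 2 * c * (A + B) - c\<^sup>2" by simp
  moreover have "2 * c * (A + B) \<ge> 2 * c * (c + c)" using A B c by (intro mult_left_mono) auto
  moreover have "2 * c * (c + c) = 4 * c\<^sup>2" by (simp add: power2_eq_square)
  ultimately have "1 + c\<^sup>2 \<le> (Re (p11 s))\<^sup>2" using zero_le_power2[of c] by linarith
  then show ?thesis
    using s by (intro real_le_lsqrt) (auto simp: Sset_def)
qed

text \<open>The equations \<open>a d - b c = 1\<close> and \<open>conj(a) d - b conj(c) = conj(p11 g)\<close> are linear in the second column,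
  and their determinant is a multiple of the orientation of the first one.\<close>

lemma second_column_bound:
  assumes "det g = 1" "\<bar>orient (column 1 g)\<bar> \<ge> h" "h > 0" "norm (column 1 g) \<le> R" "norm (p11 g) \<le> P"
  shows "norm (g $ i $ 2) \<le> R * (1 + P) / (2 * h)"
proof -
  obtain a b c d where g: "a = g$1$1" "b = g$1$2" "c = g$2$1" "d = g$2$2" by blast
  have dt: "a * d - b * c = 1" using assms(1) by (simp add: det_2 g)
  have pc: "cnj (p11 g) = cnj a * d - b * cnj c" by (simp add: p11_def g)
  have H: "2 * \<i> * of_real (orient (column 1 g)) = a * cnj c - cnj a * c"
    by (simp add: orient_column g complex_eq_iff)
  have solve: "(a * c' - a' * c) * b = a' - a * p" "(a * c' - a' * c) * d = c' - c * p"
    if "a * d - b * c = 1" "p = a' * d - b * c'" for a b c d a' c' p :: complex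
    using that by algebra+
  have nc: "norm a \<le> R" "norm c \<le> R"
    using Finite_Cartesian_Product.norm_nth_le[of "column 1 g" 1]
      Finite_Cartesian_Product.norm_nth_le[of "column 1 g" 2] assms(4) by (auto simp: column_def g)
  have bound: "norm z \<le> R * (1 + P) / (2 * h)"
    if "(2 * \<i> * of_real (orient (column 1 g))) * z = cnj w - w * cnj (p11 g)" "norm w \<le> R" for z w
  proof -
    have "2 * h * norm z \<le> 2 * \<bar>orient (column 1 g)\<bar> * norm z"
      using assms(2) by (intro mult_right_mono) auto
    also have "\<dots> = norm (cnj w - w * cnj (p11 g))"
      unfolding that(1)[symmetric] by (simp add: norm_mult)
    also have "\<dots> \<le> norm w + norm w * norm (p11 g)"
      using norm_triangle_ineq4[of "cnj w" "w * cnj (p11 g)"] by (simp add: norm_mult)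
    also have "\<dots> \<le> R + R * P"
      using that(2) assms(5) by (intro add_mono mult_mono) (auto intro: order_trans[OF norm_ge_zero])
    finally show ?thesis using assms(3) by (simp add: field_simps)
  qed
  have "norm b \<le> R * (1 + P) / (2 * h)"
    by (rule bound[OF _ nc(1)]) (simp only: H solve(1)[OF dt pc])
  moreover have "norm d \<le> R * (1 + P) / (2 * h)"
    by (rule bound[OF _ nc(2)]) (simp only: H solve(2)[OF dt pc])
  ultimately show ?thesis using exhaust_2[of i] g by auto
qed

section \<open>Rows of Poincare series\<close>

text \<open>The row \<open>(1, \<epsilon> r i)\<close> times \<open>\<delta>\<close>.  Paired with a vector of orientation \<open>\<epsilon>\<close> this row cannot vanish:
  the sign makes the cross term in \<open>norm_bil_poincare_row_ge\<close> nonnegative.\<close>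

definition poincare_row :: "real \<Rightarrow> int ^ 2 ^ 2 \<Rightarrow> complex ^ 2" where
  "poincare_row r \<delta> = vector [1, of_real (\<epsilon> * r) * \<i>] v* cz \<delta>"

lemma poincare_row_mult: "poincare_row r \<delta> v* cz \<gamma> = poincare_row r (\<delta> ** \<gamma>)"
  by (simp add: poincare_row_def vector_matrix_assoc cz_mult)

lemma poincare_row_nth: "poincare_row r \<delta> $ j = of_int (\<delta>$1$j) + of_real (\<epsilon> * r) * \<i> * of_int (\<delta>$2$j)"
  by (simp add: poincare_row_def vector_matrix_mult_def sum_2 cz_nth)

lemma bil_poincare_row: "bil (poincare_row r \<delta>) u = (cz \<delta> *v u) $ 1 + of_real (\<epsilon> * r) * \<i> * (cz \<delta> *v u) $ 2"
  unfolding poincare_row_def bil_matrix_vector[symmetric] by (simp add: bil_2)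

lemma inj_poincare_row: "r \<ge> 1 \<Longrightarrow> inj (poincare_row r)"
proof (rule injI)
  fix \<gamma> \<delta> assume r: "r \<ge> 1" and eq: "poincare_row r \<gamma> = poincare_row r \<delta>"
  have "poincare_row r \<gamma> $ j = poincare_row r \<delta> $ j" for j using eq by simp
  then have "\<gamma>$1$j = \<delta>$1$j \<and> \<epsilon> * r * of_int (\<gamma>$2$j) = \<epsilon> * r * of_int (\<delta>$2$j)" for j
    unfolding poincare_row_nth complex_eq_iff by simp
  moreover have "\<epsilon> * r \<noteq> 0" using r \<epsilon> by auto
  ultimately show "\<gamma> = \<delta>" by (simp add: mat2_eq_iff)
qed

lemma norm_mat2_sq: "(norm (A :: complex ^ 2 ^ 2))\<^sup>2 = (norm (A$1$1))\<^sup>2 + (norm (A$1$2))\<^sup>2 + (norm (A$2$1))\<^sup>2 + (norm (A$2$2))\<^sup>2"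
proof -
  have "norm A = sqrt ((norm (A$1))\<^sup>2 + (norm (A$2))\<^sup>2)" by (simp add: norm_vec_def[of A] L2_set_def sum_2)
  then show ?thesis by (simp add: norm_vec2_sq)
qed

lemma norm_poincare_row_ge: "r \<ge> 1 \<Longrightarrow> norm (cz \<delta>) \<le> norm (poincare_row r \<delta>)"
proof (rule power2_le_imp_le)
  assume r: "r \<ge> 1"
  have "(norm (poincare_row r \<delta> $ j))\<^sup>2 = (of_int (\<delta>$1$j))\<^sup>2 + r\<^sup>2 * (of_int (\<delta>$2$j))\<^sup>2" for j
    unfolding cmod_power2 poincare_row_nth using \<epsilon> by (auto simp: power_mult_distrib)
  moreover have "(of_int (\<delta>$2$j))\<^sup>2 \<le> r\<^sup>2 * (of_int (\<delta>$2$j) :: real)\<^sup>2" for j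
    using mult_right_mono[of 1 "r\<^sup>2" "(of_int (\<delta>$2$j) :: real)\<^sup>2"] r by (simp add: one_le_power)
  ultimately show "(norm (cz \<delta>))\<^sup>2 \<le> (norm (poincare_row r \<delta>))\<^sup>2"
    unfolding norm_mat2_sq norm_vec2_sq by (simp add: cz_nth add_mono algebra_simps)
qed simp

lemma norm_poincare_row_le:
  assumes "r \<ge> 1" shows "norm (poincare_row r \<delta>) \<le> (1 + r) * norm (cz \<delta>)"
proof -
  have "norm (poincare_row r \<delta>) \<le> norm (cz \<delta> $ 1) + norm ((of_real (\<epsilon> * r) * \<i>) *s (cz \<delta> $ 2))"
  proof -
    have "poincare_row r \<delta> = cz \<delta> $ 1 + (of_real (\<epsilon> * r) * \<i>) *s (cz \<delta> $ 2)"
      by (simp add: vec_eq_iff poincare_row_nth cz_nth)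
    then show ?thesis by (simp only: norm_triangle_ineq)
  qed
  also have "norm ((of_real (\<epsilon> * r) * \<i>) *s (cz \<delta> $ 2)) = r * norm (cz \<delta> $ 2)"
    using \<epsilon> assms by (auto simp: norm_smult norm_mult)
  also have "norm (cz \<delta> $ 1) + r * norm (cz \<delta> $ 2) \<le> norm (cz \<delta>) + r * norm (cz \<delta>)"
    using assms by (intro add_mono mult_left_mono Finite_Cartesian_Product.norm_nth_le) auto
  finally show ?thesis by (simp add: algebra_simps)
qed

lemma norm_bil_poincare_row_ge:
  assumes "r \<ge> 1" "det \<delta> = 1" "\<epsilon> * orient u \<ge> 0"
  shows "norm (cz \<delta> *v u) \<le> norm (bil (poincare_row r \<delta>) u)"
proof (rule power2_le_imp_le)
  define z w where "z = (cz \<delta> *v u) $ 1" and "w = (cz \<delta> *v u) $ 2"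
  have o: "orient u = Im (z * cnj w)" using orient_cz[of \<delta> u] assms(2) by (simp add: orient_def z_def w_def)
  have "(norm (bil (poincare_row r \<delta>) u))\<^sup>2 = (norm z)\<^sup>2 + (\<epsilon> * \<epsilon>) * r\<^sup>2 * (norm w)\<^sup>2 + 2 * r * (\<epsilon> * orient u)"
    unfolding bil_poincare_row z_def[symmetric] w_def[symmetric] o cmod_power2
    by (simp add: algebra_simps power2_eq_square)
  moreover have "(norm w)\<^sup>2 \<le> r\<^sup>2 * (norm w)\<^sup>2"
    using mult_right_mono[of 1 "r\<^sup>2" "(norm w)\<^sup>2"] assms(1) by (simp add: one_le_power)
  moreover have "2 * r * (\<epsilon> * orient u) \<ge> 0" using assms by simp
  moreover have "(norm (cz \<delta> *v u))\<^sup>2 = (norm z)\<^sup>2 + (norm w)\<^sup>2" by (simp only: norm_vec2_sq z_def w_def)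
  ultimately show "(norm (cz \<delta> *v u))\<^sup>2 \<le> (norm (bil (poincare_row r \<delta>) u))\<^sup>2"
    unfolding eps_sq by linarith
qed simp

lemma norm_cz_vector_ge:
  assumes "\<And>m n. c * norm (rvec m n) \<le> norm (bil (rvec m n) u)" "c \<ge> 0"
  shows "c * norm (cz \<delta>) \<le> norm (cz \<delta> *v u)"
proof (rule power2_le_imp_le)
  have 1: "(c * norm (cz \<delta> $ i))\<^sup>2 \<le> (norm ((cz \<delta> *v u) $ i))\<^sup>2" for i
  proof -
    have "cz \<delta> $ i = rvec (\<delta>$i$1) (\<delta>$i$2)" by (simp add: vec_eq_iff forall_2 cz_nth)
    then show ?thesis using assms by (intro power_mono) (auto simp: cz_row)
  qed
  have "(c * norm (cz \<delta>))\<^sup>2 = (c * norm (cz \<delta> $ 1))\<^sup>2 + (c * norm (cz \<delta> $ 2))\<^sup>2"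
    by (simp add: power_mult_distrib norm_mat2_sq norm_vec2_sq algebra_simps)
  then show "(c * norm (cz \<delta>))\<^sup>2 \<le> (norm (cz \<delta> *v u))\<^sup>2"
    unfolding norm_vec2_sq using 1[of 1] 1[of 2] by linarith
qed simp

lemma det1_norm_ge_1: "det \<delta> = 1 \<Longrightarrow> 1 \<le> norm (cz \<delta>)"
proof (rule ccontr)
  assume d: "det \<delta> = 1" and "\<not> 1 \<le> norm (cz \<delta>)"
  then have "norm (cz \<delta> $ i $ j) < 1" for i j
    using Finite_Cartesian_Product.norm_nth_le[of "cz \<delta>" i] Finite_Cartesian_Product.norm_nth_le[of "cz \<delta> $ i" j]
    by linarith
  then have "\<bar>real_of_int (\<delta>$i$j)\<bar> < 1" for i j by (simp add: cz_nth)
  then have "\<delta>$i$j = 0" for i j by (metis of_int_abs of_int_less_1_iff zabs_less_one_iff)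
  then show False using d by (simp add: det_2)
qed

lemma norm_inverse_matrix:
  fixes \<gamma> \<delta> :: "int ^ 2 ^ 2"
  assumes "det \<gamma> = 1" "\<gamma> ** \<delta> = mat 1"
  shows "norm (cz \<delta>) = norm (cz \<gamma>)"
proof -
  let ?\<delta> = "vmat (\<gamma>$2$2) (- \<gamma>$1$2) (- \<gamma>$2$1) (\<gamma>$1$1)"
  have "?\<delta> ** \<gamma> = mat 1" using assms(1)
    by (simp add: mat2_eq_iff mat2_mult_nth mat2_mat1_nth det_2 algebra_simps)
  then have "?\<delta> ** (\<gamma> ** \<delta>) = \<delta>" by (simp add: matrix_mul_assoc)
  then have "\<delta> = ?\<delta>" by (simp add: assms(2))
  then have "(norm (cz \<delta>))\<^sup>2 = (norm (cz \<gamma>))\<^sup>2" by (simp add: norm_mat2_sq cz_nth)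
  then show ?thesis by simp
qed

text \<open>Integer matrices form a lattice of rank 4; the exponent 8 is shared between their two rows.\<close>

lemma poincare_row_summable:
  assumes r: "r \<ge> 1" and D: "\<And>\<delta>. \<delta> \<in> D \<Longrightarrow> det \<delta> = 1" and k: "k \<ge> 8"
  shows "(\<lambda>\<rho>. 1 / norm \<rho> ^ k) summable_on (poincare_row r ` D)"
proof -
  let ?g = "\<lambda>(m::int, n::int). (1 + \<bar>real_of_int m\<bar> + \<bar>real_of_int n\<bar>) powr (-4)"
  let ?h = "\<lambda>\<delta> :: int ^ 2 ^ 2. ((\<delta>$1$1, \<delta>$1$2), (\<delta>$2$1, \<delta>$2$2))"
  have "(\<lambda>(p, q). ?g p * ?g q) summable_on UNIV"
    by (rule summable_on_prod_mult) (auto intro: summable_int_pair_powr)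
  then have "(\<lambda>(p, q). ?g p * ?g q) summable_on (?h ` D)" by (rule summable_on_subset) auto
  moreover have "inj_on ?h D" by (auto simp: inj_on_def mat2_eq_iff)
  ultimately have s: "((\<lambda>(p, q). ?g p * ?g q) \<circ> ?h) summable_on D" by (simp add: summable_on_reindex)
  have inj: "inj_on (poincare_row r) D" using inj_poincare_row[OF r] by (rule inj_on_subset) auto
  show ?thesis unfolding summable_on_reindex[OF inj]
  proof (rule summable_on_comparison_test)
    show "(\<lambda>\<delta>. 3 ^ 8 * ((\<lambda>(p, q). ?g p * ?g q) \<circ> ?h) \<delta>) summable_on D"
      by (rule summable_on_cmult_right[OF s])
    fix \<delta> assume \<delta>: "\<delta> \<in> D"
    define N where "N = norm (cz \<delta>)"
    have N1: "N \<ge> 1" using det1_norm_ge_1[OF D[OF \<delta>]] by (simp add: N_def)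
    have e: "\<bar>real_of_int (\<delta>$i$j)\<bar> \<le> N" for i j
      using Finite_Cartesian_Product.norm_nth_le[of "cz \<delta>" i] Finite_Cartesian_Product.norm_nth_le[of "cz \<delta> $ i" j]
      by (simp add: N_def cz_nth)
    define a b where "a = 1 + \<bar>real_of_int (\<delta>$1$1)\<bar> + \<bar>real_of_int (\<delta>$1$2)\<bar>"
      and "b = 1 + \<bar>real_of_int (\<delta>$2$1)\<bar> + \<bar>real_of_int (\<delta>$2$2)\<bar>"
    have ab: "a > 0" "b > 0" "a / 3 \<le> N" "b / 3 \<le> N"
      using e[of 1 1] e[of 1 2] e[of 2 1] e[of 2 2] N1 by (auto simp: a_def b_def)
    have "N \<le> norm (poincare_row r \<delta>)" using norm_poincare_row_ge[OF r] by (simp add: N_def)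
    then have "N ^ k \<le> norm (poincare_row r \<delta>) ^ k" using N1 by (intro power_mono) auto
    moreover have "N ^ 8 \<le> N ^ k" using N1 k by (intro power_increasing) auto
    moreover have "(a / 3) ^ 4 * (b / 3) ^ 4 \<le> N ^ 4 * N ^ 4"
      using ab by (intro mult_mono power_mono) auto
    ultimately have le: "(a / 3) ^ 4 * (b / 3) ^ 4 \<le> norm (poincare_row r \<delta>) ^ k"
      by (simp add: power_add[symmetric])
    have pos: "(a / 3) ^ 4 * (b / 3) ^ 4 > 0" using ab by simp
    have "1 / norm (poincare_row r \<delta>) ^ k \<le> 1 / ((a / 3) ^ 4 * (b / 3) ^ 4)"
      using le pos by (intro divide_left_mono mult_pos_pos) auto
    also have "\<dots> = 3 ^ 8 * (1 / a ^ 4 * (1 / b ^ 4))" by (simp add: power_divide)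
    also have "1 / a ^ 4 = a powr (-4)"
      using powr_realpow[OF ab(1), of 4] by (simp only: powr_minus_divide) simp
    also have "1 / b ^ 4 = b powr (-4)"
      using powr_realpow[OF ab(2), of 4] by (simp only: powr_minus_divide) simp
    finally show "((\<lambda>\<rho>. 1 / norm \<rho> ^ k) \<circ> poincare_row r) \<delta> \<le> 3 ^ 8 * ((\<lambda>(p, q). ?g p * ?g q) \<circ> ?h) \<delta>"
      by (simp add: a_def b_def)
  qed auto
qed

lemma poincare_row_nonzero:
  assumes "r \<ge> 1" "\<And>\<delta>. \<delta> \<in> D \<Longrightarrow> det \<delta> = 1" shows "0 \<notin> poincare_row r ` D"
proof
  assume "0 \<in> poincare_row r ` D"
  then obtain \<delta> where "\<delta> \<in> D" "poincare_row r \<delta> = 0" by auto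
  then show False using norm_poincare_row_ge[OF assms(1), of \<delta>] det1_norm_ge_1[OF assms(2)[of \<delta>]] by simp
qed

lemma poincare_row_lower_bound:
  assumes "r \<ge> 1" "det \<delta> = 1" "\<epsilon> * orient u \<ge> 0" "c \<ge> 0"
    and "\<And>m n. c * norm (rvec m n) \<le> norm (bil (rvec m n) u)"
  shows "c * norm (cz \<delta>) \<le> norm (bil (poincare_row r \<delta>) u)"
    and "c / (1 + r) * norm (poincare_row r \<delta>) \<le> norm (bil (poincare_row r \<delta>) u)"
proof -
  show 1: "c * norm (cz \<delta>) \<le> norm (bil (poincare_row r \<delta>) u)"
    using norm_cz_vector_ge[OF assms(5,4)] norm_bil_poincare_row_ge[OF assms(1-3)] by (rule order_trans)
  have "c / (1 + r) * norm (poincare_row r \<delta>) \<le> c / (1 + r) * ((1 + r) * norm (cz \<delta>))"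
    using norm_poincare_row_le[OF assms(1)] assms(1,4) by (intro mult_left_mono) auto
  also have "\<dots> = c * norm (cz \<delta>)" using assms(1) by simp
  finally show "c / (1 + r) * norm (poincare_row r \<delta>) \<le> norm (bil (poincare_row r \<delta>) u)" using 1 by simp
qed

lemma poincare_row_separated:
  assumes "r \<ge> 1" "\<And>\<delta>. \<delta> \<in> D \<Longrightarrow> det \<delta> = 1" "\<epsilon> * orient u > 0"
  shows "separated_from (poincare_row r ` D) u"
proof -
  have "orient u \<noteq> 0" using assms(3) by auto
  then obtain c where c: "c > 0" "\<And>x y. c * norm (rvec x y) \<le> norm (bil (rvec x y) u)"
    using norm_bil_rvec_ge' by blast
  show ?thesis unfolding separated_from_def
  proof (intro exI[of _ "c / (1 + r)"] conjI ballI)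
    fix \<rho> assume "\<rho> \<in> poincare_row r ` D"
    then show "c / (1 + r) * norm \<rho> \<le> norm (bil \<rho> u)"
      using poincare_row_lower_bound(2)[OF assms(1) _ less_imp_le[OF assms(3)] less_imp_le[OF c(1)] c(2)] assms(2) by blast
  qed (use c assms(1) in auto)
qed

end

section \<open>The quotient manifold\<close>

locale semigroup_quotient = orientation_sign +
  fixes \<Gamma> :: "(int ^ 2 ^ 2) set"
  assumes sg: "subgroup \<Gamma> SL"
begin

abbreviation (input) q where "q \<equiv> left_orbit \<Gamma>"
abbreviation (input) S where "S \<equiv> Sset \<epsilon>"
abbreviation (input) M where "M \<equiv> quotient_topology (top_of_set S) q"
abbreviation (input) \<A> where "\<A> \<equiv> quotient_atlas (top_of_set S) SL2C_atlas q"

lemma Gamma_det: "\<gamma> \<in> \<Gamma> \<Longrightarrow> det \<gamma> = 1"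
  using subgroup.subset[OF sg] by (auto simp: SL_def)

lemma Gamma_one: "mat 1 \<in> \<Gamma>"
  using subgroup.one_closed[OF sg] by (simp add: SL_def)

lemma Gamma_mult: "\<gamma> \<in> \<Gamma> \<Longrightarrow> \<delta> \<in> \<Gamma> \<Longrightarrow> \<gamma> ** \<delta> \<in> \<Gamma>"
  using subgroup.m_closed[OF sg] by (simp add: SL_def)

lemma Gamma_inverse:
  assumes "\<gamma> \<in> \<Gamma>"
  obtains \<delta> where "\<delta> \<in> \<Gamma>" "\<delta> ** \<gamma> = mat 1" "\<gamma> ** \<delta> = mat 1"
proof
  have c: "\<gamma> \<in> carrier SL" using assms subgroup.subset[OF sg] by blast
  show "inv\<^bsub>SL\<^esub> \<gamma> \<in> \<Gamma>" by (rule subgroup.m_inv_closed[OF sg assms])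
  show "inv\<^bsub>SL\<^esub> \<gamma> ** \<gamma> = mat 1" using group.l_inv[OF group_SLZ c] by (simp add: SL_def)
  show "\<gamma> ** inv\<^bsub>SL\<^esub> \<gamma> = mat 1" using group.r_inv[OF group_SLZ c] by (simp add: SL_def)
qed

lemma orbit_eq_iff: "q s = q t \<longleftrightarrow> (\<exists>\<gamma>\<in>\<Gamma>. t = cz \<gamma> ** s)"
proof
  assume "q s = q t"
  moreover have "t \<in> q t" unfolding left_orbit_def using Gamma_one by (force simp: cz_mat1)
  ultimately show "\<exists>\<gamma>\<in>\<Gamma>. t = cz \<gamma> ** s" unfolding left_orbit_def by blast
next
  have sub: "q (cz \<gamma> ** s) \<subseteq> q s" if "\<gamma> \<in> \<Gamma>" for \<gamma> s
    using Gamma_mult that by (auto simp: left_orbit_def matrix_mul_assoc cz_mult[symmetric])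
  assume "\<exists>\<gamma>\<in>\<Gamma>. t = cz \<gamma> ** s"
  then obtain \<gamma> where \<gamma>: "\<gamma> \<in> \<Gamma>" "t = cz \<gamma> ** s" by blast
  obtain \<delta> where \<delta>: "\<delta> \<in> \<Gamma>" "\<delta> ** \<gamma> = mat 1" using Gamma_inverse[OF \<gamma>(1)] by blast
  have "cz \<delta> ** t = s" by (simp add: \<gamma>(2) matrix_mul_assoc cz_mult[symmetric] \<delta> cz_mat1)
  then show "q s = q t" using sub[OF \<gamma>(1), of s] sub[OF \<delta>(1), of t] \<gamma>(2) by auto
qed

lemma orbit_act: "\<gamma> \<in> \<Gamma> \<Longrightarrow> q (cz \<gamma> ** s) = q s"
  using orbit_eq_iff by metis

lemma continuous_on_cz: "continuous_on A (\<lambda>s :: complex ^ 2 ^ 2. cz \<gamma> ** s)"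
  by (intro continuous_on_mat2_mult continuous_intros)

lemma openin_image_orbit:
  assumes V: "openin (top_of_set S) V" shows "openin M (q ` V)"
  unfolding openin_quotient_topology
proof
  show "q ` V \<subseteq> q ` topspace (top_of_set S)" using openin_subset[OF V] by blast
  have "{x \<in> topspace (top_of_set S). q x \<in> q ` V} = (\<Union>\<gamma>\<in>\<Gamma>. S \<inter> (\<lambda>s. cz \<gamma> ** s) -` V)"
  proof (intro equalityI subsetI)
    fix x assume "x \<in> {x \<in> topspace (top_of_set S). q x \<in> q ` V}"
    then obtain v where "x \<in> S" "v \<in> V" "q x = q v" by auto
    then show "x \<in> (\<Union>\<gamma>\<in>\<Gamma>. S \<inter> (\<lambda>s. cz \<gamma> ** s) -` V)" using orbit_eq_iff[of x v] by auto
  next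
    fix x assume "x \<in> (\<Union>\<gamma>\<in>\<Gamma>. S \<inter> (\<lambda>s. cz \<gamma> ** s) -` V)"
    then obtain \<gamma> where \<gamma>: "\<gamma> \<in> \<Gamma>" "x \<in> S" "cz \<gamma> ** x \<in> V" by blast
    have "q x = q (cz \<gamma> ** x)" using orbit_act[OF \<gamma>(1)] by simp
    then show "x \<in> {x \<in> topspace (top_of_set S). q x \<in> q ` V}" using \<gamma>(2,3) by auto
  qed
  moreover have "openin (top_of_set S) (S \<inter> (\<lambda>s. cz \<gamma> ** s) -` V)" if "\<gamma> \<in> \<Gamma>" for \<gamma>
    by (rule continuous_openin_preimage[OF continuous_on_cz _ V])
       (use cz_Sset Gamma_det[OF that] in auto)
  then have "openin (top_of_set S) (\<Union>\<gamma>\<in>\<Gamma>. S \<inter> (\<lambda>s. cz \<gamma> ** s) -` V)"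
    by (intro openin_Union) blast
  ultimately show "openin (top_of_set S) {x \<in> topspace (top_of_set S). q x \<in> q ` V}" by (simp only:)
qed

lemma Sset_det: "s \<in> S \<Longrightarrow> det s = 1" by (simp add: Sset_def)

lemma act_eq_adj: "s \<in> S \<Longrightarrow> t = cz \<gamma> ** s \<Longrightarrow> t ** adj2 s = cz \<gamma>"
  using adj2_right[OF Sset_det] by (simp add: matrix_mul_assoc[symmetric])

text \<open>The set of integer matrices is closed, and equivalent points \<open>s, t\<close> satisfy that \<open>t s\<^sup>-\<^sup>1\<close> lies in it.  A
  continuity argument in \<open>(s, t)\<close> then serves both freeness on small sets and the Hausdorff property.\<close>

lemma separate_by_integer_matrices:
  assumes "t ** adj2 s \<notin> cz ` C"
  obtains A B where "open A" "open B" "s \<in> A" "t \<in> B" "\<And>a b. a \<in> A \<Longrightarrow> b \<in> B \<Longrightarrow> b ** adj2 a \<notin> cz ` C"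
proof -
  have "open ((\<lambda>p. snd p ** adj2 (fst p)) -` (- cz ` C))"
    by (intro open_vimage continuous_on_mat2_mult continuous_on_adj2 continuous_intros)
       (use closed_integer_matrices in \<open>auto simp: open_Compl\<close>)
  moreover have "(s, t) \<in> (\<lambda>p. snd p ** adj2 (fst p)) -` (- cz ` C)" using assms by simp
  ultimately obtain A B where AB: "open A" "open B" "(s, t) \<in> A \<times> B"
    and sub: "A \<times> B \<subseteq> (\<lambda>p. snd p ** adj2 (fst p)) -` (- cz ` C)"
    by (rule open_prod_elim)
  have "b ** adj2 a \<notin> cz ` C" if "a \<in> A" "b \<in> B" for a b using subsetD[OF sub, of "(a, b)"] that by simp
  then show ?thesis using that[of A B] AB by blast
qed

lemma exists_injective_neighbourhood:
  assumes "s \<in> S"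
  obtains V where "openin (top_of_set S) V" "s \<in> V" "inj_on q V"
proof -
  have "s ** adj2 s \<notin> cz ` (\<Gamma> - {mat 1})"
    using adj2_right[OF Sset_det[OF assms]] by (auto simp: cz_mat1[symmetric] cz_inject)
  from separate_by_integer_matrices[OF this] obtain A B where AB: "open A" "open B" "s \<in> A" "s \<in> B"
    "\<And>a b. a \<in> A \<Longrightarrow> b \<in> B \<Longrightarrow> b ** adj2 a \<notin> cz ` (\<Gamma> - {mat 1})" by metis
  show ?thesis
  proof (rule that[of "S \<inter> (A \<inter> B)"])
    show "openin (top_of_set S) (S \<inter> (A \<inter> B))" using AB by (intro openin_open_Int) auto
    show "inj_on q (S \<inter> (A \<inter> B))"
    proof (rule inj_onI)
      fix x y assume x: "x \<in> S \<inter> (A \<inter> B)" and y: "y \<in> S \<inter> (A \<inter> B)" and "q x = q y"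
      then obtain \<gamma> where \<gamma>: "\<gamma> \<in> \<Gamma>" "y = cz \<gamma> ** x" using orbit_eq_iff by blast
      then have "y ** adj2 x = cz \<gamma>" using act_eq_adj x by blast
      then have "\<gamma> = mat 1" using AB(5)[of x y] x y \<gamma>(1) by (metis DiffI IntE image_eqI singletonD)
      then show "x = y" using \<gamma>(2) by (simp add: cz_mat1)
    qed
  qed (use assms AB in auto)
qed

lemma Hausdorff_quotient: "Hausdorff_space M"
  unfolding Hausdorff_space_def
proof (intro allI impI)
  fix X Y assume XY: "X \<in> topspace M \<and> Y \<in> topspace M \<and> X \<noteq> Y"
  then obtain s t where st: "s \<in> S" "t \<in> S" "X = q s" "Y = q t" by (auto simp: topspace_quotient_topology)
  have "t ** adj2 s \<notin> cz ` \<Gamma>"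
  proof
    assume "t ** adj2 s \<in> cz ` \<Gamma>"
    then obtain \<gamma> where \<gamma>: "\<gamma> \<in> \<Gamma>" "t ** adj2 s = cz \<gamma>" by blast
    have "adj2 s ** s = mat 1" using adj2_right[OF Sset_det[OF st(1)]] matrix_left_right_inverse by blast
    then have "t = cz \<gamma> ** s" by (simp add: \<gamma>(2)[symmetric] matrix_mul_assoc[symmetric])
    then show False using XY st orbit_act[OF \<gamma>(1)] by simp
  qed
  from separate_by_integer_matrices[OF this] obtain A B where AB: "open A" "open B" "s \<in> A" "t \<in> B"
    "\<And>a b. a \<in> A \<Longrightarrow> b \<in> B \<Longrightarrow> b ** adj2 a \<notin> cz ` \<Gamma>" by metis
  have "q x \<noteq> q y" if "x \<in> S \<inter> A" "y \<in> S \<inter> B" for x y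
    using AB(5)[of x y] that act_eq_adj[of x y] orbit_eq_iff[of x y] by blast
  then have "disjnt (q ` (S \<inter> A)) (q ` (S \<inter> B))" by (auto simp: disjnt_def)
  moreover have "openin M (q ` (S \<inter> A))" "openin M (q ` (S \<inter> B))"
    using AB by (auto intro!: openin_image_orbit openin_open_Int)
  ultimately show "\<exists>U V. openin M U \<and> openin M V \<and> X \<in> U \<and> Y \<in> V \<and> disjnt U V"
    using st AB by blast
qed

lemma continuous_orbit: "continuous_map (top_of_set S) M q"
  by (rule quotient_imp_continuous_map[OF quotient_map_quotient_topology])

lemma second_countable_quotient: "second_countable M"
proof (rule second_countable_open_map_image[OF continuous_orbit])
  show "open_map (top_of_set S) M q" using openin_image_orbit by (auto simp: open_map_def)
  show "q ` topspace (top_of_set S) = topspace M" by (simp add: topspace_quotient_topology)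
  show "second_countable (top_of_set S)" by (intro second_countable_subtopology second_countable_euclidean)
qed

text \<open>A chart of the quotient is a chart \<open>\<phi>\<close> of \<open>SL(2,\<complex>)\<close> precomposed with a section of the
  projection over a small set \<open>V\<close>.  Its inverse is computed by \<open>\<psi>\<close>, the inverse of \<open>\<phi>\<close>, followed by
  the projection; keeping \<open>\<psi>\<close> explicit avoids all further reasoning about sections.\<close>

definition adapted_chart where
  "adapted_chart N \<kappa> V \<phi> \<psi> \<longleftrightarrow>
    N = q ` V \<and> \<kappa> = \<phi> \<circ> inv_into V q \<and> openin (top_of_set S) V \<and> inj_on q V \<and>
    open (\<phi> ` V) \<and> \<kappa> ` N = \<phi> ` V \<and>
    (\<forall>z\<in>\<phi> ` V. \<psi> z \<in> V \<and> \<phi> (\<psi> z) = z \<and> inv_into N \<kappa> z = q (\<psi> z)) \<and>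
    (\<forall>v\<in>V. \<psi> (\<phi> v) = v) \<and>
    (\<forall>z\<in>\<phi> ` V. \<forall>i j. cdiff (\<lambda>z. \<psi> z $ i $ j) z) \<and>
    continuous_on (\<phi> ` V) \<psi> \<and>
    (\<forall>k. \<exists>i j. \<forall>A. \<phi> A $ k = A $ i $ j)"

lemma adapted_chartD:
  fixes \<phi> :: "complex ^ 2 ^ 2 \<Rightarrow> complex ^ 3"
  assumes "adapted_chart N \<kappa> V \<phi> \<psi>"
  shows "N = q ` V" "\<kappa> = \<phi> \<circ> inv_into V q" "openin (top_of_set S) V" "inj_on q V"
    "open (\<phi> ` V)" "\<kappa> ` N = \<phi> ` V"
    "\<And>z. z \<in> \<phi> ` V \<Longrightarrow> \<psi> z \<in> V \<and> \<phi> (\<psi> z) = z \<and> inv_into N \<kappa> z = q (\<psi> z)"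
    "\<And>v. v \<in> V \<Longrightarrow> \<psi> (\<phi> v) = v"
    "\<And>z i j. z \<in> \<phi> ` V \<Longrightarrow> cdiff (\<lambda>z. \<psi> z $ i $ j) z"
    "continuous_on (\<phi> ` V) \<psi>"
    "\<And>k. \<exists>i j. \<forall>A. \<phi> A $ k = A $ i $ j"
  using assms unfolding adapted_chart_def by blast+

lemma quotient_chart:
  assumes "(N, \<kappa>) \<in> \<A>"
  obtains V \<phi> \<psi> where "adapted_chart N \<kappa> V \<phi> \<psi>"
proof -
  obtain V \<phi> U where V: "N = q ` V" "\<kappa> = \<phi> \<circ> inv_into V q" "openin (top_of_set S) V" "inj_on q V"
    and U: "(U, \<phi>) \<in> SL2C_atlas" "V \<subseteq> U"
    using assms unfolding quotient_atlas_def by blast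
  obtain \<psi> D where D: "open D" "\<forall>A\<in>U. \<phi> A \<in> D \<and> \<psi> (\<phi> A) = A"
    "\<forall>z\<in>D. \<psi> z \<in> U \<and> \<phi> (\<psi> z) = z"
    "\<forall>z\<in>D. \<forall>i j. cdiff (\<lambda>z. \<psi> z $ i $ j) z"
    "\<forall>k. \<exists>i j. \<forall>A. \<phi> A $ k = A $ i $ j"
    by (rule SL2C_chart[OF U(1)])
  note D = D(1) D(2-4)[rule_format] D(5)[rule_format]
  have USL: "U \<subseteq> {g. det g = 1}" using U(1) by (auto simp: SL2C_atlas_def SL_def)
  have cont: "continuous_on D \<psi>"
    by (rule continuous_on_matI) (intro continuous_at_imp_continuous_on ballI cdiff_isCont D(4))
  obtain T where T: "open T" "V = S \<inter> T" using V(3) by (auto simp: openin_open)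
  obtain T' where T': "open T'" "S = {g. det g = 1} \<inter> T'" using Sset_open by blast
  have VD: "\<phi> ` V = D \<inter> \<psi> -` (T \<inter> T')"
  proof (intro equalityI subsetI)
    fix z assume "z \<in> \<phi> ` V"
    then show "z \<in> D \<inter> \<psi> -` (T \<inter> T')" using D(2) U(2) T T' by auto
  next
    fix z assume z: "z \<in> D \<inter> \<psi> -` (T \<inter> T')"
    then have "\<psi> z \<in> V" using D(3)[of z] USL T T' by blast
    then show "z \<in> \<phi> ` V" using D(3)[of z] z by (metis IntE image_eqI)
  qed
  have op: "open (\<phi> ` V)"
    unfolding VD using T(1) T'(1) by (intro continuous_open_preimage[OF cont D(1)]) auto
  have r: "inv_into V q (q v) = v" if "v \<in> V" for v using V(4) that by simp
  then have im: "\<kappa> ` N = \<phi> ` V" by (auto simp: V image_iff)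
  have inv: "\<psi> z \<in> V \<and> \<phi> (\<psi> z) = z \<and> inv_into N \<kappa> z = q (\<psi> z)" if zV: "z \<in> \<phi> ` V" for z
  proof -
    obtain v where v: "v \<in> V" "z = \<phi> v" using zV by blast
    then have pv: "\<psi> z = v" using D(2) U(2) by blast
    have "inv_into N \<kappa> z = q v"
    proof (rule inv_into_f_eq)
      show "inj_on \<kappa> N"
      proof (rule inj_onI)
        fix x y assume "x \<in> N" "y \<in> N" "\<kappa> x = \<kappa> y"
        then obtain a b where "x = q a" "y = q b" "a \<in> V" "b \<in> V" "\<phi> a = \<phi> b" using r by (auto simp: V)
        then show "x = y" using D(2) U(2) by (metis subsetD)
      qed
      show "q v \<in> N" using v by (simp add: V)
      show "\<kappa> (q v) = z" using v r by (simp add: V)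
    qed
    then show ?thesis using pv v by simp
  qed
  have "adapted_chart N \<kappa> V \<phi> \<psi>"
    unfolding adapted_chart_def
  proof (intro conjI V op im)
    show "\<forall>z\<in>\<phi> ` V. \<psi> z \<in> V \<and> \<phi> (\<psi> z) = z \<and> inv_into N \<kappa> z = q (\<psi> z)" using inv by blast
    show "\<forall>v\<in>V. \<psi> (\<phi> v) = v" using D(2) U(2) by blast
    show "\<forall>z\<in>\<phi> ` V. \<forall>i j. cdiff (\<lambda>z. \<psi> z $ i $ j) z" using D(4) VD by blast
    show "continuous_on (\<phi> ` V) \<psi>" using cont VD continuous_on_subset by blast
    show "\<forall>k. \<exists>i j. \<forall>A. \<phi> A $ k = A $ i $ j" using D(5) by blast
  qed
  then show ?thesis by (rule that)
qed

lemma topspace_quotient_covered: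
  "topspace M \<subseteq> (\<Union>(U, \<phi>)\<in>\<A>. U)"
proof
  fix X assume "X \<in> topspace M"
  then obtain s where s: "s \<in> S" "X = q s" by (auto simp: topspace_quotient_topology)
  have dt: "s$1$1 * s$2$2 - s$1$2 * s$2$1 = 1" using Sset_det[OF s(1)] by (simp add: det_2)
  then have "s$1$1 \<noteq> 0 \<or> s$1$2 \<noteq> 0" by auto
  then obtain U \<phi> O' where U: "(U, \<phi>) \<in> SL2C_atlas" "U = {A \<in> carrier SL. A \<in> O'}" "open O'" "s \<in> O'"
  proof
    assume "s$1$1 \<noteq> 0"
    then show thesis
      by (intro that[of "{A \<in> carrier SL. A $ 1 $ 1 \<noteq> 0}" "\<lambda>A. vector [A $ 1 $ 1, A $ 1 $ 2, A $ 2 $ 1]" "{A. A$1$1 \<noteq> 0}"])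
         (auto simp: SL2C_atlas_def intro!: open_Collect_neq continuous_intros)
  next
    assume "s$1$2 \<noteq> 0"
    then show thesis
      by (intro that[of "{A \<in> carrier SL. A $ 1 $ 2 \<noteq> 0}" "\<lambda>A. vector [A $ 1 $ 1, A $ 1 $ 2, A $ 2 $ 2]" "{A. A$1$2 \<noteq> 0}"])
         (auto simp: SL2C_atlas_def intro!: open_Collect_neq continuous_intros)
  qed
  obtain V where V: "openin (top_of_set S) V" "s \<in> V" "inj_on q V"
    using exists_injective_neighbourhood[OF s(1)] by blast
  have "openin (top_of_set S) (V \<inter> O')" using V(1) U(3) by (metis openin_Int_open)
  moreover have "inj_on q (V \<inter> O')" using V(3) by (rule inj_on_subset) auto
  moreover have "V \<inter> O' \<subseteq> U" using openin_subset[OF V(1)] Sset_det by (auto simp: U(2) SL_def)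
  ultimately have "(q ` (V \<inter> O'), \<phi> \<circ> inv_into (V \<inter> O') q) \<in> \<A>"
    using U(1) unfolding quotient_atlas_def by blast
  moreover have "X \<in> q ` (V \<inter> O')" using s(2) V(2) U(4) by blast
  ultimately show "X \<in> (\<Union>(U, \<phi>)\<in>\<A>. U)" by blast
qed

lemma quotient_chart_homeomorphic:
  assumes "(N, \<kappa>) \<in> \<A>"
  shows "openin M N" "open (\<kappa> ` N)" "homeomorphic_map (subtopology M N) (top_of_set (\<kappa> ` N)) \<kappa>"
proof -
  obtain V \<phi> \<psi> where "adapted_chart N \<kappa> V \<phi> \<psi>" by (rule quotient_chart[OF assms])
  note c = adapted_chartD[OF this]
  show N: "openin M N" unfolding c(1) by (rule openin_image_orbit[OF c(3)])
  show "open (\<kappa> ` N)" using c by simp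
  have VS: "V \<subseteq> S" using openin_subset[OF c(3)] by simp
  have top: "topspace (subtopology M N) = N"
    using openin_subset[OF N] by auto
  have \<kappa>q: "\<kappa> (q v) = \<phi> v" if "v \<in> V" for v using that c(4) by (simp add: c(2))
  have cont\<phi>: "continuous_on V \<phi>"
  proof (rule continuous_on_vecI)
    fix k obtain i j where "\<And>A. \<phi> A $ k = A $ i $ j" using c(11) by blast
    then show "continuous_on V (\<lambda>A. \<phi> A $ k)" by (simp add: continuous_intros)
  qed
  have "homeomorphic_maps (subtopology M N) (top_of_set (\<phi> ` V)) \<kappa> (q \<circ> \<psi>)"
    unfolding homeomorphic_maps_def
  proof (intro conjI ballI)
    show "continuous_map (subtopology M N) (top_of_set (\<phi> ` V)) \<kappa>"
      unfolding continuous_map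
    proof (intro conjI allI impI)
      show "\<kappa> ` topspace (subtopology M N) \<subseteq> topspace (top_of_set (\<phi> ` V))" unfolding top using c(6) by simp
      fix T assume T: "openin (top_of_set (\<phi> ` V)) T"
      have eq: "{x \<in> topspace (subtopology M N). \<kappa> x \<in> T} = q ` (V \<inter> \<phi> -` T)"
        unfolding top using \<kappa>q by (auto simp: c(1))
      have "openin (top_of_set V) (V \<inter> \<phi> -` T)"
        by (rule continuous_openin_preimage[OF cont\<phi> _ T]) auto
      then have "openin (top_of_set S) (V \<inter> \<phi> -` T)" using c(3) openin_trans by blast
      then have "openin M (q ` (V \<inter> \<phi> -` T))" by (rule openin_image_orbit)
      moreover have "q ` (V \<inter> \<phi> -` T) \<inter> N = q ` (V \<inter> \<phi> -` T)" by (auto simp: c(1))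
      ultimately show "openin (subtopology M N) {x \<in> topspace (subtopology M N). \<kappa> x \<in> T}"
        unfolding eq openin_subtopology by blast
    qed
    show "continuous_map (top_of_set (\<phi> ` V)) (subtopology M N) (q \<circ> \<psi>)"
    proof (rule continuous_map_into_subtopology)
      show "continuous_map (top_of_set (\<phi> ` V)) M (q \<circ> \<psi>)"
        by (rule continuous_map_compose[OF _ continuous_orbit])
           (use c(7,10) VS in \<open>auto simp: continuous_map_in_subtopology\<close>)
      show "(q \<circ> \<psi>) \<in> topspace (top_of_set (\<phi> ` V)) \<rightarrow> N" using c(7) by (auto simp: c(1))
    qed
    show "(q \<circ> \<psi>) (\<kappa> x) = x" if "x \<in> topspace (subtopology M N)" for x
      using that \<kappa>q c(8) unfolding top by (auto simp: c(1))
    show "\<kappa> ((q \<circ> \<psi>) y) = y" if "y \<in> topspace (top_of_set (\<phi> ` V))" for y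
      using that c(7)[of y] \<kappa>q by auto
  qed
  then show "homeomorphic_map (subtopology M N) (top_of_set (\<kappa> ` N)) \<kappa>"
    unfolding c(6) by (auto simp: homeomorphic_map_maps)
qed

text \<open>Locally, a change of charts is multiplication by a fixed element of the group, read in charts of
  \<open>SL(2,\<complex>)\<close>.\<close>

lemma quotient_transition:
  assumes "(N, \<kappa>) \<in> \<A>"
    and "(N', \<kappa>') \<in> \<A>"
  shows "holomorphic_Cn (\<kappa> ` (N \<inter> N')) (\<lambda>z. \<kappa>' (inv_into N \<kappa> z) $ k)"
proof -
  obtain V \<phi> \<psi> where "adapted_chart N \<kappa> V \<phi> \<psi>" by (rule quotient_chart[OF assms(1)])
  note c = adapted_chartD[OF this]
  obtain V' \<phi>' \<psi>' where "adapted_chart N' \<kappa>' V' \<phi>' \<psi>'" by (rule quotient_chart[OF assms(2)])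
  note c' = adapted_chartD[OF this]
  have VS: "V \<subseteq> S" using openin_subset[OF c(3)] by simp
  obtain T' where T': "open T'" "V' = S \<inter> T'" using c'(3) by (auto simp: openin_open)
  have E: "\<kappa> ` (N \<inter> N') = {z \<in> \<phi> ` V. q (\<psi> z) \<in> N'}"
  proof (intro equalityI subsetI)
    fix z assume "z \<in> \<kappa> ` (N \<inter> N')"
    then obtain v where v: "v \<in> V" "q v \<in> N'" "z = \<kappa> (q v)" by (auto simp: c(1))
    then have "z = \<phi> v" using c(4) by (simp add: c(2))
    then show "z \<in> {z \<in> \<phi> ` V. q (\<psi> z) \<in> N'}" using v c(8) by auto
  next
    fix z assume z: "z \<in> {z \<in> \<phi> ` V. q (\<psi> z) \<in> N'}"
    then have "z = \<kappa> (q (\<psi> z))" using c(7)[of z] c(4) by (simp add: c(2))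
    then show "z \<in> \<kappa> ` (N \<inter> N')" using z c(7)[of z] by (auto simp: c(1) intro!: image_eqI[of z])
  qed
  obtain i j where ij: "\<And>A. \<phi>' A $ k = A $ i $ j" using c'(11) by blast
  have local: "\<exists>B. open B \<and> z \<in> B \<and> B \<subseteq> \<kappa> ` (N \<inter> N') \<and> cdiff (\<lambda>z. \<kappa>' (inv_into N \<kappa> z) $ k) z"
    if z: "z \<in> \<kappa> ` (N \<inter> N')" for z
  proof -
    have z1: "z \<in> \<phi> ` V" "q (\<psi> z) \<in> N'" using z E by auto
    then obtain v' where v': "v' \<in> V'" "q (\<psi> z) = q v'" by (auto simp: c'(1))
    then obtain \<gamma> where \<gamma>: "\<gamma> \<in> \<Gamma>" "v' = cz \<gamma> ** \<psi> z" using orbit_eq_iff by blast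
    define B where "B = \<phi> ` V \<inter> (\<lambda>z. cz \<gamma> ** \<psi> z) -` T'"
    have "open B" unfolding B_def
      by (intro continuous_open_preimage continuous_on_mat2_mult c(5,10) T'(1) continuous_intros)
    moreover have "z \<in> B" using z1(1) v'(1) \<gamma>(2) T'(2) by (auto simp: B_def)
    moreover have BV: "cz \<gamma> ** \<psi> w \<in> V'" if "w \<in> B" for w
    proof -
      have "\<psi> w \<in> S" using that c(7) VS by (auto simp: B_def)
      then show ?thesis using that cz_Sset[OF Gamma_det[OF \<gamma>(1)]] T'(2) by (simp add: B_def)
    qed
    moreover have "B \<subseteq> \<kappa> ` (N \<inter> N')"
    proof
      fix w assume w: "w \<in> B"
      have "q (\<psi> w) = q (cz \<gamma> ** \<psi> w)" using orbit_act[OF \<gamma>(1)] by simp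
      then have "q (\<psi> w) \<in> N'" using BV[OF w] by (auto simp: c'(1))
      then show "w \<in> \<kappa> ` (N \<inter> N')" using w unfolding E by (auto simp: B_def)
    qed
    moreover have "\<kappa>' (inv_into N \<kappa> w) $ k = (cz \<gamma> ** \<psi> w) $ i $ j" if w: "w \<in> B" for w
    proof -
      have "inv_into N \<kappa> w = q (\<psi> w)" using c(7)[of w] w by (auto simp: B_def)
      also have "\<dots> = q (cz \<gamma> ** \<psi> w)" using orbit_act[OF \<gamma>(1)] by simp
      finally show ?thesis using BV[OF w] c'(4) ij by (simp add: c'(2))
    qed
    moreover have "cdiff (\<lambda>w. (cz \<gamma> ** \<psi> w) $ i $ j) z"
      unfolding mat2_mult_nth by (intro cdiff_add cdiff_mult cdiff_const c(9) z1(1))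
    ultimately show ?thesis using cdiff_transform[of "\<lambda>w. (cz \<gamma> ** \<psi> w) $ i $ j" z B] by metis
  qed
  then have "open (\<kappa> ` (N \<inter> N'))" by (subst open_subopen) blast
  then show ?thesis unfolding holomorphic_Cn_iff_cdiff using local by blast
qed

theorem complex_manifold_quotient:
  "complex_manifold M (\<A>)"
  unfolding complex_manifold_def
  using Hausdorff_quotient topspace_quotient_covered quotient_chart_homeomorphic quotient_transition
  by (auto simp: case_prod_unfold)

lemma HolI:
  assumes "\<And>s. s \<in> S \<Longrightarrow> f (q s) = \<Phi> (s *v v)" "\<And>s. s \<in> S \<Longrightarrow> cdiff \<Phi> (s *v v)"
  shows "f \<in> Hol (\<A>)"
  unfolding Hol_def
proof (clarify)
  fix N \<kappa> assume "(N, \<kappa>) \<in> \<A>"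
  then have *: "(N, \<kappa>) \<in> \<A>" .
  obtain V \<phi> \<psi> where "adapted_chart N \<kappa> V \<phi> \<psi>" by (rule quotient_chart[OF *])
  note c = adapted_chartD[OF this]
  have VS: "V \<subseteq> S" using openin_subset[OF c(3)] by simp
  show "holomorphic_Cn (\<kappa> ` N) (\<lambda>z. f (inv_into N \<kappa> z))"
    unfolding holomorphic_Cn_iff_cdiff c(6)
  proof (intro conjI ballI c(5))
    fix z assume z: "z \<in> \<phi> ` V"
    have "cdiff (\<lambda>z. \<Phi> (\<psi> z *v v)) z"
    proof (rule cdiff_compose)
      show "cdiff \<Phi> (\<psi> z *v v)" using c(7)[OF z] VS assms(2) by blast
      show "cdiff (\<lambda>z. (\<psi> z *v v) $ i) z" for i
        unfolding matrix_vector_mult_def vec_lambda_beta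
        by (intro cdiff_sum cdiff_mult cdiff_const c(9) z)
    qed
    then show "cdiff (\<lambda>z. f (inv_into N \<kappa> z)) z"
    proof (rule cdiff_transform[OF _ c(5) z])
      fix w assume w: "w \<in> \<phi> ` V"
      show "\<Phi> (\<psi> w *v v) = f (inv_into N \<kappa> w)" using c(7)[OF w] VS assms(1) by auto
    qed
  qed
qed

text \<open>The value of \<open>f\<close> at an orbit is computed at a chosen representative; invariance makes it
  independent of the choice.\<close>

lemma invariant_function_Hol:
  fixes \<Phi> :: "complex ^ 2 \<Rightarrow> complex"
  assumes "\<And>s. s \<in> S \<Longrightarrow> cdiff \<Phi> (s *v v)" "\<And>\<gamma> u. \<gamma> \<in> \<Gamma> \<Longrightarrow> \<Phi> (cz \<gamma> *v u) = \<Phi> u"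
  obtains f where "f \<in> Hol (\<A>)"
    "\<And>s. s \<in> S \<Longrightarrow> f (q s) = \<Phi> (s *v v)"
proof -
  define f where "f X = \<Phi> ((SOME s. s \<in> S \<and> q s = X) *v v)" for X
  have "f (q s) = \<Phi> (s *v v)" if "s \<in> S" for s
  proof -
    define t where "t = (SOME t. t \<in> S \<and> q t = q s)"
    have t: "t \<in> S \<and> q t = q s" unfolding t_def by (rule someI[of _ s]) (use that in simp)
    then obtain \<gamma> where "\<gamma> \<in> \<Gamma>" "s = cz \<gamma> ** t" using orbit_eq_iff by blast
    then have "\<Phi> (s *v v) = \<Phi> (t *v v)" using assms(2) by (simp add: matrix_vector_mul_assoc[symmetric])
    then show ?thesis by (simp add: f_def t_def)
  qed
  moreover from this have "f \<in> Hol (\<A>)" using HolI assms(1) by blast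
  ultimately show ?thesis using that by blast
qed

section \<open>Holomorphic hulls and separation of points\<close>

text \<open>Read in a chart, a holomorphic function is complex differentiable, hence continuous.\<close>

lemma Hol_continuous:
  assumes f: "f \<in> Hol \<A>" and T: "open T"
  shows "openin M {x \<in> topspace M. f x \<in> T}"
proof (subst openin_subopen, intro ballI)
  fix x assume x: "x \<in> {x \<in> topspace M. f x \<in> T}"
  then obtain N \<kappa> where N: "(N, \<kappa>) \<in> \<A>" "x \<in> N" using topspace_quotient_covered by blast
  note ch = quotient_chart_homeomorphic[OF N(1)]
  have top: "topspace (subtopology M N) = N" using openin_subset[OF ch(1)] by auto
  have inj: "inj_on \<kappa> N" using homeomorphic_imp_injective_map[OF ch(3)] unfolding top .
  define g where "g = (\<lambda>z. f (inv_into N \<kappa> z))"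
  have "holomorphic_Cn (\<kappa> ` N) g" using f N(1) unfolding Hol_def g_def by blast
  then have "continuous_on (\<kappa> ` N) g"
    unfolding holomorphic_Cn_iff_cdiff by (intro continuous_at_imp_continuous_on ballI cdiff_isCont) auto
  then have "openin (top_of_set (\<kappa> ` N)) (\<kappa> ` N \<inter> g -` T)" using T by (rule continuous_openin_preimage_gen)
  then have "openin (subtopology M N) {y \<in> topspace (subtopology M N). \<kappa> y \<in> \<kappa> ` N \<inter> g -` T}"
    using homeomorphic_imp_continuous_map[OF ch(3)] by (auto simp: continuous_map_def)
  also have "{y \<in> topspace (subtopology M N). \<kappa> y \<in> \<kappa> ` N \<inter> g -` T} = {y \<in> N. f y \<in> T}"
  proof -
    have "g (\<kappa> y) = f y" if "y \<in> N" for y using that inj by (simp add: g_def)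
    then have "\<kappa> y \<in> \<kappa> ` N \<inter> g -` T \<longleftrightarrow> f y \<in> T" if "y \<in> N" for y
      using that imageI[OF that, of \<kappa>] by (simp only: Int_iff vimage_eq simp_thms)
    then show ?thesis unfolding top by blast
  qed
  finally have "openin M {y \<in> N. f y \<in> T}" using openin_trans_full[OF _ ch(1)] by blast
  moreover have "{y \<in> N. f y \<in> T} \<subseteq> {x \<in> topspace M. f x \<in> T}" using openin_subset[OF ch(1)] by blast
  ultimately show "\<exists>U. openin M U \<and> x \<in> U \<and> U \<subseteq> {x \<in> topspace M. f x \<in> T}" using x N(2) by blast
qed

lemma closedin_hull: "closedin M (holomorphic_hull M \<A> K)"
proof -
  have cl: "closedin M {z \<in> topspace M. cmod (f z) \<le> r}" if "f \<in> Hol \<A>" for f r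
  proof -
    have "openin M {x \<in> topspace M. f x \<in> - cball 0 r}" by (rule Hol_continuous[OF that]) auto
    moreover have "topspace M - {z \<in> topspace M. cmod (f z) \<le> r} = {x \<in> topspace M. f x \<in> - cball 0 r}" by auto
    ultimately show ?thesis by (simp add: closedin_def)
  qed
  have eq: "holomorphic_hull M \<A> K = \<Inter>(insert (topspace M)
      ((\<lambda>f. {z \<in> topspace M. cmod (f z) \<le> (SUP w\<in>K. cmod (f w))}) ` Hol \<A>))"
    by (auto simp: holomorphic_hull_def)
  show ?thesis unfolding eq by (rule closedin_Inter) (use cl in auto)
qed

text \<open>The projection is open and the semigroup is locally compact, so finitely many images of small
  compact balls cover \<open>K\<close>.\<close>

lemma compactin_lift:
  assumes K: "compactin M K"
  obtains C where "compact C" "C \<subseteq> S" "K \<subseteq> q ` C"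
proof -
  obtain T where T: "open T" "S = {g. det g = 1} \<inter> T" using Sset_open by blast
  have "\<exists>e>0. cball s e \<inter> {g. det g = 1} \<subseteq> S" if "s \<in> S" for s
    using open_contains_cball[of T] T that by blast
  then obtain e where e: "\<And>s. s \<in> S \<Longrightarrow> e s > 0" "\<And>s. s \<in> S \<Longrightarrow> cball s (e s) \<inter> {g. det g = 1} \<subseteq> S" by metis
  define \<U> where "\<U> = (\<lambda>s. q ` (S \<inter> ball s (e s))) ` S"
  have "K \<subseteq> q ` S" using compactin_subset_topspace[OF K] by (simp add: topspace_quotient_topology)
  have KU: "K \<subseteq> \<Union>\<U>"
  proof
    fix x assume "x \<in> K"
    then obtain s where s: "s \<in> S" "x = q s" using \<open>K \<subseteq> q ` S\<close> by blast
    then have "x \<in> q ` (S \<inter> ball s (e s))" using e(1)[OF s(1)] by simp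
    then show "x \<in> \<Union>\<U>" unfolding \<U>_def using s(1) by blast
  qed
  have op: "openin M U" if "U \<in> \<U>" for U
    using that by (auto simp: \<U>_def intro!: openin_image_orbit openin_open_Int)
  obtain \<F> where \<F>: "finite \<F>" "\<F> \<subseteq> \<U>" "K \<subseteq> \<Union>\<F>"
    using compactinD[OF K op KU] by blast
  then obtain F where F: "finite F" "F \<subseteq> S" "\<F> = (\<lambda>s. q ` (S \<inter> ball s (e s))) ` F"
    using finite_subset_image[OF \<F>(1) \<F>(2)[unfolded \<U>_def]] by blast
  define C where "C = (\<Union>s\<in>F. cball s (e s) \<inter> {g. det g = 1})"
  have "closed {g :: complex ^ 2 ^ 2. det g = 1}"
    unfolding det_2 by (intro closed_Collect_eq continuous_intros)
  then have "compact C" unfolding C_def using F(1) by (intro compact_UN compact_Int_closed) auto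
  moreover have "C \<subseteq> S" using e(2) F(2) by (auto simp: C_def)
  moreover have "K \<subseteq> q ` C"
  proof
    fix x assume "x \<in> K"
    then obtain s t where st: "s \<in> F" "t \<in> S \<inter> ball s (e s)" "x = q t" using \<F>(3) unfolding F(3) by blast
    then have "t \<in> cball s (e s) \<inter> {g. det g = 1}" by (simp add: Sset_def)
    then have "t \<in> C" unfolding C_def using st(1) by blast
    then show "x \<in> q ` C" using st(3) by blast
  qed
  ultimately show ?thesis using that by blast
qed

lemma inv_power_sum_Hol:
  fixes R :: "(complex ^ 2) set"
  assumes "(\<lambda>\<rho>. 1 / norm \<rho> ^ k) summable_on R" "0 \<notin> R" "\<And>s. s \<in> S \<Longrightarrow> separated_from R (s *v v)"
    and "\<And>\<gamma>. \<gamma> \<in> \<Gamma> \<Longrightarrow> act \<gamma> R = R"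
  obtains f where "f \<in> Hol \<A>" "\<And>s. s \<in> S \<Longrightarrow> f (q s) = inv_power_sum k R (s *v v)"
proof (rule invariant_function_Hol)
  show "cdiff (inv_power_sum k R) (s *v v)" if "s \<in> S" for s
    by (rule cdiff_inv_power_sum[OF assms(1) assms(3)[OF that] assms(2)])
  show "inv_power_sum k R (cz \<gamma> *v u) = inv_power_sum k R u" if "\<gamma> \<in> \<Gamma>" for \<gamma> u
    using inv_power_sum_act[OF Gamma_det[OF that]] assms(4)[OF that] by simp
qed (use that in blast)

lemma hull_bound:
  assumes K: "K \<noteq> {}" "K \<subseteq> q ` C" and "x \<in> holomorphic_hull M \<A> K" "f \<in> Hol \<A>"
    and B: "\<And>t. t \<in> C \<Longrightarrow> norm (f (q t)) \<le> B"
  shows "norm (f x) \<le> B"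
proof -
  have "norm (f x) \<le> (SUP w\<in>K. cmod (f w))" using assms by (auto simp: holomorphic_hull_def)
  also have "\<dots> \<le> B" by (rule cSUP_least[OF K(1)]) (use K(2) B in auto)
  finally show ?thesis .
qed

text \<open>The power sums of the inverse forms descend to holomorphic functions on the quotient.  Their bounds on
  \<open>K\<close> carry over to the hull and, by \<open>power_sums_bound\<close>, to each single form.\<close>

lemma hull_rows:
  fixes R :: "(complex ^ 2) set"
  assumes K: "K \<noteq> {}" "K \<subseteq> q ` C" "C \<subseteq> S" and s: "s \<in> S" "q s \<in> holomorphic_hull M \<A> K"
    and sm: "\<And>k. k \<ge> k0 \<Longrightarrow> (\<lambda>\<rho>. 1 / norm \<rho> ^ k) summable_on R" and R0: "0 \<notin> R"
    and sep: "\<And>s. s \<in> S \<Longrightarrow> separated_from R (s *v v)"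
    and inv: "\<And>\<gamma>. \<gamma> \<in> \<Gamma> \<Longrightarrow> act \<gamma> R = R"
    and c: "c > 0" "\<And>t \<rho>. t \<in> C \<Longrightarrow> \<rho> \<in> R \<Longrightarrow> c * norm \<rho> \<le> norm (bil \<rho> (t *v v))"
    and m: "m > 0" "\<And>t \<rho>. t \<in> C \<Longrightarrow> \<rho> \<in> R \<Longrightarrow> m \<le> norm (bil \<rho> (t *v v))"
    and \<rho>: "\<rho> \<in> R"
  shows "m \<le> norm (bil \<rho> (s *v v))"
proof -
  define B where "B = (\<Sum>\<^sub>\<infinity>\<rho>\<in>R. 1 / norm \<rho> ^ k0) / c ^ k0 * m ^ k0"
  have bound: "norm (\<Sum>\<^sub>\<infinity>\<rho>\<in>R. (1 / bil \<rho> (s *v v)) ^ k) \<le> B * (1 / m) ^ k" if k: "k \<ge> k0" for k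
  proof -
    obtain f where f: "f \<in> Hol \<A>" "\<And>s. s \<in> S \<Longrightarrow> f (q s) = inv_power_sum k R (s *v v)"
      using inv_power_sum_Hol[OF sm[OF k] R0 sep inv] by blast
    have "norm (f (q t)) \<le> B * (1 / m) ^ k" if t: "t \<in> C" for t
    proof -
      have tS: "t \<in> S" using t K(3) by blast
      have nz: "norm (bil \<rho> (t *v v)) > 0" if "\<rho> \<in> R" for \<rho> using m(1) m(2)[OF t that] by linarith
      have tb: "norm (1 / bil \<rho> (t *v v) ^ k) \<le> (m ^ k0 / c ^ k0 * (1 / m) ^ k) * (1 / norm \<rho> ^ k0)"
        if \<rho>: "\<rho> \<in> R" for \<rho>
      proof -
        let ?b = "norm (bil \<rho> (t *v v))"
        have "norm \<rho> > 0" using \<rho> R0 by auto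
        then have "(c * norm \<rho>) ^ k0 * m ^ (k - k0) \<le> ?b ^ k0 * ?b ^ (k - k0)"
          using c m \<rho> t by (intro mult_mono power_mono) auto
        also have "\<dots> = ?b ^ k" using k by (simp add: power_add[symmetric])
        finally have "1 / ?b ^ k \<le> 1 / ((c * norm \<rho>) ^ k0 * m ^ (k - k0))"
          using nz[OF \<rho>] \<open>norm \<rho> > 0\<close> c(1) m(1) by (intro divide_left_mono) auto
        also have "m ^ (k - k0) = m ^ k / m ^ k0" using m(1) k by (simp add: power_diff)
        finally show ?thesis
          using m(1) by (simp add: norm_divide norm_power power_mult_distrib power_divide field_simps)
      qed
      have s1: "(\<lambda>\<rho>. norm (1 / bil \<rho> (t *v v) ^ k)) summable_on R"
        by (rule inv_power_sum_abs_summable[OF sm[OF k] sep[OF tS] R0])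
      have "norm (f (q t)) \<le> (\<Sum>\<^sub>\<infinity>\<rho>\<in>R. norm (1 / bil \<rho> (t *v v) ^ k))"
        unfolding f(2)[OF tS] inv_power_sum_def by (rule norm_infsum_bound[OF s1])
      also have "\<dots> \<le> (\<Sum>\<^sub>\<infinity>\<rho>\<in>R. (m ^ k0 / c ^ k0 * (1 / m) ^ k) * (1 / norm \<rho> ^ k0))"
        by (rule infsum_mono[OF s1 summable_on_cmult_right[OF sm[OF order_refl]] tb])
      also have "\<dots> = (m ^ k0 / c ^ k0 * (1 / m) ^ k) * (\<Sum>\<^sub>\<infinity>\<rho>\<in>R. 1 / norm \<rho> ^ k0)"
        by (rule infsum_cmult_right) (use sm in auto)
      finally show ?thesis by (simp add: B_def mult_ac)
    qed
    from hull_bound[OF K(1,2) s(2) f(1) this] show ?thesis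
      by (simp add: f(2)[OF s(1)] inv_power_sum_def power_one_over)
  qed
  have ss: "(\<lambda>\<rho>. norm (1 / bil \<rho> (s *v v)) ^ k0) summable_on R"
    using inv_power_sum_abs_summable[OF sm[OF order_refl] sep[OF s(1)] R0] by (simp add: norm_divide norm_power power_divide)
  have "norm (1 / bil \<rho> (s *v v)) \<le> 1 / m"
    by (rule power_sums_bound[OF ss bound _ \<rho>]) (use m(1) in auto)
  moreover have "bil \<rho> (s *v v) \<noteq> 0"
  proof -
    obtain d where "d > 0" "d * norm \<rho> \<le> norm (bil \<rho> (s *v v))"
      using sep[OF s(1)] \<rho> by (auto simp: separated_from_def)
    moreover have "norm \<rho> > 0" using \<rho> R0 by auto
    ultimately show ?thesis by (smt (verit) mult_pos_pos norm_zero)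
  qed
  ultimately show ?thesis using m(1) by (simp add: norm_divide field_simps)
qed

lemma orient_nonzero: "s \<in> S \<Longrightarrow> x \<noteq> 0 \<or> y \<noteq> 0 \<Longrightarrow> orient (s *v rvec x y) \<noteq> 0"
  using Sset_orient_vector_pos[of s x y] by auto

text \<open>The same argument for the finite family of inverse values at the 3-torsion points.\<close>

lemma hull_torsion:
  assumes K: "K \<noteq> {}" "K \<subseteq> q ` C" "C \<subseteq> S" "compact C" and xy: "x \<noteq> 0 \<or> y \<noteq> 0"
  obtains d where "d > 0" "\<And>s R. \<lbrakk>s \<in> S; q s \<in> holomorphic_hull M \<A> K; R \<in> torsion_cosets\<rbrakk> \<Longrightarrow>
    d \<le> norm (inv_power_sum 3 R (s *v rvec x y))"
proof -
  let ?v = "rvec x y"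
  have sub: "R \<subseteq> third_rows" if "R \<in> torsion_cosets" for R
    using that torsion_rows_third unfolding torsion_cosets_def by blast
  have cd: "cdiff (inv_power_sum 3 R) u" if "R \<in> torsion_cosets" "orient u \<noteq> 0" for R u
    by (rule cdiff_inv_power_sum) (use sub[OF that(1)] third_rows_summable[of 3] third_rows_nonzero separated_real_rows[OF that(2)]
        in \<open>auto intro: summable_on_subset\<close>)
  have nz: "inv_power_sum 3 R (s *v ?v) \<noteq> 0" if "R \<in> torsion_cosets" "s \<in> S" for R s
    using inv_power_sum_torsion_nonzero that orient_nonzero xy by blast
  have "\<exists>d>0. \<forall>t\<in>C. d \<le> norm (inv_power_sum 3 R (t *v ?v))" if R: "R \<in> torsion_cosets" for R
  proof (cases "C = {}")
    case False
    have "continuous_on C (\<lambda>t. norm (inv_power_sum 3 R (t *v ?v)))"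
    proof (intro continuous_on_norm continuous_at_imp_continuous_on ballI)
      fix t assume "t \<in> C"
      then have "isCont (inv_power_sum 3 R) (t *v ?v)" using cd[OF R orient_nonzero] K(3) xy by (intro cdiff_isCont) auto
      moreover have "continuous_on UNIV (\<lambda>t :: complex ^ 2 ^ 2. t *v ?v)"
        by (rule continuous_on_vecI) (simp add: matrix_vector_mult_def sum_2 continuous_intros)
      then have "isCont (\<lambda>t :: complex ^ 2 ^ 2. t *v ?v) t" by (simp add: continuous_on_eq_continuous_at)
      ultimately show "isCont (\<lambda>t. inv_power_sum 3 R (t *v ?v)) t" by (rule isCont_o2[rotated])
    qed
    then obtain t0 where "t0 \<in> C" "\<And>t. t \<in> C \<Longrightarrow> norm (inv_power_sum 3 R (t0 *v ?v)) \<le> norm (inv_power_sum 3 R (t *v ?v))"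
      using continuous_attains_inf[OF K(4) False] by blast
    moreover from this have "norm (inv_power_sum 3 R (t0 *v ?v)) > 0" using nz[OF R] K(3) by auto
    ultimately show ?thesis by blast
  qed (auto intro: exI[of _ 1])
  then obtain dd where dd: "\<And>R. R \<in> torsion_cosets \<Longrightarrow> dd R > 0"
    "\<And>R t. R \<in> torsion_cosets \<Longrightarrow> t \<in> C \<Longrightarrow> dd R \<le> norm (inv_power_sum 3 R (t *v ?v))" by metis
  define d where "d = Min (insert 1 (dd ` torsion_cosets))"
  have d: "d > 0" using dd(1) finite_torsion_cosets by (simp add: d_def)
  have dC: "d \<le> norm (inv_power_sum 3 R (t *v ?v))" if "R \<in> torsion_cosets" "t \<in> C" for R t
  proof -
    have "d \<le> dd R" unfolding d_def using finite_torsion_cosets that by (intro Min_le) auto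
    then show ?thesis using dd(2)[OF that] by simp
  qed
  show ?thesis
  proof (rule that[OF d])
    fix s R assume s: "s \<in> S" "q s \<in> holomorphic_hull M \<A> K" and R: "R \<in> torsion_cosets"
    have "norm (1 / inv_power_sum 3 R (s *v ?v)) \<le> 1 / d"
    proof (rule power_sums_bound[where I = torsion_cosets and ?k0.0 = 0])
      show "(\<lambda>R. norm (1 / inv_power_sum 3 R (s *v ?v)) ^ 0) summable_on torsion_cosets"
        by (rule summable_on_finite[OF finite_torsion_cosets])
      fix k :: nat
      define \<Phi> where "\<Phi> u = (\<Sum>R\<in>torsion_cosets. (1 / inv_power_sum 3 R u) ^ k)" for u
      obtain f where f: "f \<in> Hol \<A>" "\<And>s. s \<in> S \<Longrightarrow> f (q s) = \<Phi> (s *v ?v)"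
      proof (rule invariant_function_Hol)
        show "cdiff \<Phi> (s *v ?v)" if "s \<in> S" for s
          unfolding \<Phi>_def using that nz orient_nonzero xy
          by (intro cdiff_sum cdiff_power cdiff_divide cdiff_const cd) auto
        show "\<Phi> (cz \<gamma> *v u) = \<Phi> u" if "\<gamma> \<in> \<Gamma>" for \<gamma> u
          unfolding \<Phi>_def inv_power_sum_act[OF Gamma_det[OF that]]
          by (rule sum.reindex_bij_betw[OF act_torsion_cosets[OF Gamma_det[OF that]]])
      qed blast
      have "norm (f (q t)) \<le> real (card torsion_cosets) * (1 / d) ^ k" if t: "t \<in> C" for t
      proof -
        have "norm (f (q t)) \<le> (\<Sum>R\<in>torsion_cosets. (1 / d) ^ k)"
          unfolding f(2)[OF subsetD[OF K(3) t]] \<Phi>_def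
        proof (rule order_trans[OF norm_sum sum_mono])
          fix R assume "R \<in> torsion_cosets"
          from dC[OF this t] d show "norm ((1 / inv_power_sum 3 R (t *v ?v)) ^ k) \<le> (1 / d) ^ k"
            unfolding norm_power norm_divide by (intro power_mono frac_le) auto
        qed
        then show ?thesis by simp
      qed
      from hull_bound[OF K(1,2) s(2) f(1) this]
      show "norm (\<Sum>\<^sub>\<infinity>R\<in>torsion_cosets. (1 / inv_power_sum 3 R (s *v ?v)) ^ k) \<le> real (card torsion_cosets) * (1 / d) ^ k"
        by (simp add: f(2)[OF s(1)] \<Phi>_def finite_torsion_cosets)
    qed (use d R in auto)
    then show "d \<le> norm (inv_power_sum 3 R (s *v ?v))" using d nz[OF R s(1)] by (simp add: norm_divide field_simps)
  qed
qed

text \<open>A left coset, because invariance under left multiplication by \<open>\<Gamma>\<close> on the semigroup becomes invariance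
  under right multiplication on the rows.\<close>

definition coset_rows :: "real \<Rightarrow> int ^ 2 ^ 2 \<Rightarrow> (complex ^ 2) set" where
  "coset_rows r \<sigma> = poincare_row r ` ((\<lambda>\<delta>. \<sigma> ** \<delta>) ` \<Gamma>)"

lemma act_coset_rows: "\<gamma> \<in> \<Gamma> \<Longrightarrow> act \<gamma> (coset_rows r \<sigma>) = coset_rows r \<sigma>"
proof -
  assume \<gamma>: "\<gamma> \<in> \<Gamma>"
  then obtain \<gamma>' where \<gamma>': "\<gamma>' \<in> \<Gamma>" "\<gamma>' ** \<gamma> = mat 1" using Gamma_inverse by blast
  have sub: "act \<gamma> (coset_rows r \<sigma>) \<subseteq> coset_rows r \<sigma>" if "\<gamma> \<in> \<Gamma>" for \<gamma>
    using Gamma_mult[OF _ that] by (auto simp: act_def coset_rows_def poincare_row_mult matrix_mul_assoc[symmetric])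
  have "coset_rows r \<sigma> = act \<gamma> (act \<gamma>' (coset_rows r \<sigma>))" by (simp add: act_act \<gamma>' act_mat1)
  also have "\<dots> \<subseteq> act \<gamma> (coset_rows r \<sigma>)" using sub[OF \<gamma>'(1)] by (auto simp: act_def)
  finally show ?thesis using sub[OF \<gamma>] by blast
qed

text \<open>An element \<open>\<sigma>\<close> of \<open>SL(2,\<int>)\<close> giving the lattice of the first column a bounded basis moves \<open>s\<close> into
  \<open>Scompact\<close>: the orientation of the first column is bounded below, \<open>p11\<close> is bounded through the
  covolumes of both columns, and together they bound the second column.  The Poincare series of the
  coset of \<open>\<sigma>\<close> then replaces \<open>\<sigma>\<close> by an element of \<open>\<Gamma>\<close> up to a matrix from a finite set.\<close>

lemma hull_relatively_compact:
  assumes K: "K \<noteq> {}" "K \<subseteq> q ` C" "C \<subseteq> S" "compact C"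
  obtains D where "compact D" "D \<subseteq> S" "holomorphic_hull M \<A> K \<subseteq> q ` D"
proof -
  obtain c where c: "c > 0" "\<And>s m n x y. s \<in> C \<Longrightarrow>
    c * norm (rvec m n) * norm (rvec x y) \<le> norm (bil (rvec m n) (s *v rvec x y))"
    using uniform_separation[OF K(4,3)] by blast
  obtain d1 where d1: "d1 > 0" "\<And>s R. \<lbrakk>s \<in> S; q s \<in> holomorphic_hull M \<A> K; R \<in> torsion_cosets\<rbrakk> \<Longrightarrow>
    d1 \<le> norm (inv_power_sum 3 R (s *v rvec 1 0))"
    using hull_torsion[OF K, of 1 0] by auto
  obtain d2 where d2: "d2 > 0" "\<And>s R. \<lbrakk>s \<in> S; q s \<in> holomorphic_hull M \<A> K; R \<in> torsion_cosets\<rbrakk> \<Longrightarrow>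
    d2 \<le> norm (inv_power_sum 3 R (s *v rvec 0 1))"
    using hull_torsion[OF K, of 0 1] by auto
  define d where "d = min d1 d2"
  have d: "d > 0" using d1 d2 by (simp add: d_def)
  obtain K0 where K0: "\<And>u. \<lbrakk>orient u \<noteq> 0; \<And>\<rho>. \<rho> \<in> lattice_rows \<Longrightarrow> c \<le> norm (bil \<rho> u);
      \<And>R. R \<in> torsion_cosets \<Longrightarrow> d \<le> norm (inv_power_sum 3 R u)\<rbrakk> \<Longrightarrow>
      \<exists>\<gamma>. det \<gamma> = 1 \<and> norm (cz \<gamma> *v u) \<le> K0"
    using bounded_basis[OF c(1) d] by blast
  define k where "k = max K0 1"
  define h where "h = c\<^sup>2 / 2"
  define p where "p = sqrt (1 + h\<^sup>2)"
  define P where "P = 1 + 2 * k\<^sup>2"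
  define Rb where "Rb = 2 * k + 2 * (k * (1 + P) / (2 * h))"
  define B where "B = 2 * k / c + 1"
  have k1: "k \<ge> 1" and h: "h > 0" using c(1) by (auto simp: k_def h_def)
  have p1: "p > 1" using h by (simp add: p_def)
  define F where "F = {\<tau> :: int ^ 2 ^ 2. det \<tau> = 1 \<and> norm (cz \<tau>) \<le> B}"
  define D where "D = (\<Union>\<tau>\<in>F. (\<lambda>g. cz \<tau> ** g) ` Scompact Rb p)"
  have "finite F" unfolding F_def by (rule finite_norm_bounded)
  then have "compact D" unfolding D_def
    by (intro compact_UN compact_continuous_image continuous_on_cz compact_Scompact)
  moreover have "D \<subseteq> S" unfolding D_def F_def using subsetD[OF Scompact_subset[OF p1, of Rb]] by (auto simp: cz_Sset)
  moreover have "holomorphic_hull M \<A> K \<subseteq> q ` D"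
  proof
    fix X assume X: "X \<in> holomorphic_hull M \<A> K"
    then obtain s where s: "s \<in> S" "X = q s" by (auto simp: holomorphic_hull_def topspace_quotient_topology)
    have sh: "q s \<in> holomorphic_hull M \<A> K" using X s by simp
    \<comment> \<open>shortest vectors: inverse powers of the nonzero lattice vectors\<close>
    have lat: "c \<le> norm (bil \<rho> (s *v rvec x y))"
      if xy: "norm (rvec x y) = 1" and \<rho>: "\<rho> \<in> lattice_rows" for x y \<rho>
    proof (rule hull_rows[OF K(1,2,3) s(1) sh, where R = lattice_rows and ?k0.0 = 3 and c = c])
      have ne: "x \<noteq> 0 \<or> y \<noteq> 0" using xy by (auto simp: norm_rvec)
      show "(\<lambda>\<rho>. 1 / norm \<rho> ^ j) summable_on lattice_rows" if "j \<ge> 3" for j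
        by (rule summable_on_subset[OF third_rows_summable[OF that] lattice_rows_third])
      show "0 \<notin> lattice_rows" using lattice_rows_third third_rows_nonzero by blast
      show "separated_from lattice_rows (t *v rvec x y)" if "t \<in> S" for t
        by (rule separated_real_rows[OF orient_nonzero[OF that ne] lattice_rows_third])
      show "act \<gamma> lattice_rows = lattice_rows" if "\<gamma> \<in> \<Gamma>" for \<gamma>
        by (rule act_lattice_rows[OF Gamma_det[OF that]])
      show 1: "c * norm \<rho> \<le> norm (bil \<rho> (t *v rvec x y))" if "t \<in> C" "\<rho> \<in> lattice_rows" for t \<rho>
        using c(2)[OF that(1), of _ _ x y] that(2) xy by (auto simp: lattice_rows_def)
      show "c \<le> norm (bil \<rho> (t *v rvec x y))" if "t \<in> C" "\<rho> \<in> lattice_rows" for t \<rho>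
      proof -
        have "c * 1 \<le> c * norm \<rho>" using c(1) by (intro mult_left_mono lattice_rows_norm that(2)) auto
        then show ?thesis using 1[OF that] by linarith
      qed
    qed (use c \<rho> in auto)
    have unit: "h \<le> \<epsilon> * orient (s *v rvec x y)" if xy: "norm (rvec x y) = 1" for x y
    proof -
      have ne: "x \<noteq> 0 \<or> y \<noteq> 0" using xy by (auto simp: norm_rvec)
      have "\<bar>orient (s *v rvec x y)\<bar> = \<epsilon> * orient (s *v rvec x y)"
        using Sset_orient_vector_pos[OF s(1) ne] \<epsilon> by auto
      then show ?thesis
        using orient_ge_of_shortest[OF orient_nonzero[OF s(1) ne] c(1) lat[OF xy]] by (simp add: h_def)
    qed
    have low: "h * (norm (rvec x y))\<^sup>2 \<le> \<epsilon> * orient (s *v rvec x y)" for x y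
    proof (cases "x = 0 \<and> y = 0")
      case True
      then show ?thesis by (simp add: orient_vector norm_rvec)
    next
      case False
      define n where "n = norm (rvec x y)"
      have n: "n > 0" using False by (simp add: n_def)
      have "norm (rvec (x / n) (y / n)) = 1"
      proof -
        have "rvec (x / n) (y / n) = (1 / n) *\<^sub>R rvec x y"
          by (simp add: vec_eq_iff forall_2 scaleR_conv_of_real[where 'a = complex])
        then show ?thesis using n by (simp add: n_def)
      qed
      from unit[OF this] have "h * n\<^sup>2 \<le> (\<epsilon> * orient (s *v rvec (x / n) (y / n))) * n\<^sup>2"
        by (rule mult_right_mono) simp
      also have "\<dots> = \<epsilon> * orient (s *v rvec x y)"
        using n by (simp add: orient_vector field_simps power2_eq_square)
      finally show ?thesis by (simp add: n_def)
    qed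
    have pp: "p \<le> Re (p11 s)" unfolding p_def by (rule p11_lower_bound[OF s(1) h low])
    \<comment> \<open>bounded bases: inverse values at the 3-torsion points\<close>
    have short: "\<exists>\<gamma>. det \<gamma> = 1 \<and> norm (cz \<gamma> *v (s *v rvec x y)) \<le> k"
      if xy: "norm (rvec x y) = 1" and t: "\<And>R. R \<in> torsion_cosets \<Longrightarrow> d \<le> norm (inv_power_sum 3 R (s *v rvec x y))" for x y
    proof -
      have "x \<noteq> 0 \<or> y \<noteq> 0" using xy by (auto simp: norm_rvec)
      from K0[OF orient_nonzero[OF s(1) this] lat[OF xy] t] show ?thesis unfolding k_def by force
    qed
    have "\<exists>\<gamma>. det \<gamma> = 1 \<and> norm (cz \<gamma> *v (s *v rvec 1 0)) \<le> k"
      using d1(2)[OF s(1) sh] by (intro short) (auto simp: norm_rvec d_def intro: min.coboundedI1)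
    then obtain \<sigma> where \<sigma>: "det \<sigma> = 1" "norm (cz \<sigma> *v column 1 s) \<le> k" unfolding column_eq by blast
    have "\<exists>\<gamma>. det \<gamma> = 1 \<and> norm (cz \<gamma> *v (s *v rvec 0 1)) \<le> k"
      using d2(2)[OF s(1) sh] by (intro short) (auto simp: norm_rvec d_def intro: min.coboundedI2)
    then obtain \<sigma>2 where \<sigma>2: "det \<sigma>2 = 1" "norm (cz \<sigma>2 *v column 2 s) \<le> k" unfolding column_eq by blast
    have sq_le: "\<bar>orient u\<bar> \<le> k\<^sup>2" if "det \<gamma> = 1" "norm (cz \<gamma> *v u) \<le> k" for \<gamma> u
    proof -
      have "\<bar>orient u\<bar> = \<bar>orient (cz \<gamma> *v u)\<bar>" by (simp add: orient_cz that(1))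
      also have "\<dots> \<le> (norm (cz \<gamma> *v u))\<^sup>2" by (rule abs_orient_le)
      also have "\<dots> \<le> k\<^sup>2" using that(2) by (intro power_mono) auto
      finally show ?thesis .
    qed
    define g where "g = cz \<sigma> ** s"
    have gS: "g \<in> S" using s(1) cz_Sset[OF \<sigma>(1)] by (simp add: g_def)
    have inv: "p11 g = p11 s" "orient (column j g) = orient (column j s)" for j
      unfolding g_def cz_real using \<sigma>(1) by (simp_all add: real_left_invariance det_real_of_int)
    have dg: "det g = 1" using gS by (simp add: Sset_def)
    have col1: "norm (column 1 g) \<le> k" using \<sigma>(2) by (simp add: g_def column_mult)
    have nP: "norm (p11 g) \<le> P"
    proof (rule power2_le_imp_le)
      have "(norm (p11 g))\<^sup>2 = 1 + 4 * (orient (column 1 s) * orient (column 2 s))"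
        using norm_p11_sq[OF dg] by (simp add: cmod_power2 inv)
      also have "orient (column 1 s) * orient (column 2 s) \<le> \<bar>orient (column 1 s)\<bar> * \<bar>orient (column 2 s)\<bar>"
        by (simp add: abs_mult[symmetric])
      also have "\<dots> \<le> k\<^sup>2 * k\<^sup>2" using sq_le[OF \<sigma>] sq_le[OF \<sigma>2] by (intro mult_mono) auto
      finally have "(norm (p11 g))\<^sup>2 \<le> 1 + 4 * (k\<^sup>2 * k\<^sup>2)" by simp
      also have "\<dots> \<le> 1 + 4 * (k\<^sup>2 * k\<^sup>2) + 4 * k\<^sup>2" by simp
      also have "\<dots> = P\<^sup>2" by (simp add: P_def power2_eq_square algebra_simps)
      finally show "(norm (p11 g))\<^sup>2 \<le> P\<^sup>2" .
    qed (simp add: P_def)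
    have h1: "\<bar>orient (column 1 g)\<bar> \<ge> h"
      using low[of 1 0] \<epsilon> by (auto simp: inv column_eq norm_rvec)
    have ki: "norm (g $ i $ 1) \<le> k" for i
      using Finite_Cartesian_Product.norm_nth_le[of "column 1 g" i] col1 by (simp add: column_def)
    have "norm g \<le> Rb"
      using ki[of 1] ki[of 2] norm_mat2_le[of g] second_column_bound[OF dg h1 h col1 nP, of 1] second_column_bound[OF dg h1 h col1 nP, of 2]
      unfolding Rb_def by linarith
    then have gC: "g \<in> Scompact Rb p"
      using gS dg pp unfolding Scompact_def by (simp add: Sset_def inv)
    \<comment> \<open>were all elements of the coset large, the form belonging to \<open>\<sigma>\<close> itself would be large at \<open>s\<close>, against the bound on \<open>\<sigma> s\<close>\<close>
    have "\<exists>\<gamma>\<in>\<Gamma>. norm (cz (\<sigma> ** \<gamma>)) \<le> B"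
    proof (rule ccontr)
      assume "\<not> ?thesis"
      then have big: "B < norm (cz (\<sigma> ** \<gamma>))" if "\<gamma> \<in> \<Gamma>" for \<gamma> using that by force
      have Bc: "c * B > 2 * k" using c(1) by (simp add: B_def field_simps)
      have dets: "det \<delta> = 1" if "\<delta> \<in> (\<lambda>\<delta>. \<sigma> ** \<delta>) ` \<Gamma>" for \<delta>
        using that Gamma_det \<sigma>(1) by (auto simp: det_mul)
      have pos: "\<epsilon> * orient (t *v rvec 1 0) > 0" if "t \<in> S" for t
        by (rule Sset_orient_vector_pos[OF that]) simp
      have "c * B \<le> norm (bil (poincare_row 1 \<sigma>) (s *v rvec 1 0))"
      proof (rule hull_rows[OF K(1,2,3) s(1) sh, where R = "coset_rows 1 \<sigma>" and ?k0.0 = 8 and c = "c / (1 + 1)"])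
        show "(\<lambda>\<rho>. 1 / norm \<rho> ^ j) summable_on coset_rows 1 \<sigma>" if "j \<ge> 8" for j
          unfolding coset_rows_def by (rule poincare_row_summable[OF _ dets that]) auto
        show "0 \<notin> coset_rows 1 \<sigma>" unfolding coset_rows_def by (rule poincare_row_nonzero[OF _ dets]) auto
        show "separated_from (coset_rows 1 \<sigma>) (t *v rvec 1 0)" if "t \<in> S" for t
          unfolding coset_rows_def by (rule poincare_row_separated[OF _ dets pos[OF that]]) auto
        show "act \<gamma> (coset_rows 1 \<sigma>) = coset_rows 1 \<sigma>" if "\<gamma> \<in> \<Gamma>" for \<gamma> by (rule act_coset_rows[OF that])
        have lowb: "c * norm (cz \<delta>) \<le> norm (bil (poincare_row 1 \<delta>) (t *v rvec 1 0))"
          "c / (1 + 1) * norm (poincare_row 1 \<delta>) \<le> norm (bil (poincare_row 1 \<delta>) (t *v rvec 1 0))"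
          if t: "t \<in> C" and \<delta>: "det \<delta> = 1" for t \<delta>
        proof -
          have "\<epsilon> * orient (t *v rvec 1 0) \<ge> 0" using pos[of t] t K(3) by auto
          moreover have "c * norm (rvec m n) \<le> norm (bil (rvec m n) (t *v rvec 1 0))" for m n
            using c(2)[OF t, of m n 1 0] by (simp add: norm_rvec)
          ultimately show "c * norm (cz \<delta>) \<le> norm (bil (poincare_row 1 \<delta>) (t *v rvec 1 0))"
            "c / (1 + 1) * norm (poincare_row 1 \<delta>) \<le> norm (bil (poincare_row 1 \<delta>) (t *v rvec 1 0))"
            using poincare_row_lower_bound[OF order_refl \<delta>] c(1) by auto
        qed
        show "c / (1 + 1) * norm \<rho> \<le> norm (bil \<rho> (t *v rvec 1 0))" if "t \<in> C" "\<rho> \<in> coset_rows 1 \<sigma>" for t \<rho>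
          using that(2) lowb(2)[OF that(1)] dets unfolding coset_rows_def by blast
        show "c * B \<le> norm (bil \<rho> (t *v rvec 1 0))" if t: "t \<in> C" and \<rho>: "\<rho> \<in> coset_rows 1 \<sigma>" for t \<rho>
        proof -
          obtain \<gamma> where \<gamma>: "\<gamma> \<in> \<Gamma>" "\<rho> = poincare_row 1 (\<sigma> ** \<gamma>)" using \<rho> by (auto simp: coset_rows_def)
          have "c * B \<le> c * norm (cz (\<sigma> ** \<gamma>))" using big[OF \<gamma>(1)] c(1) by simp
          also have "\<dots> \<le> norm (bil \<rho> (t *v rvec 1 0))"
            unfolding \<gamma>(2) using \<gamma>(1) by (intro lowb(1)[OF t] dets) blast
          finally show ?thesis .
        qed
        show "poincare_row 1 \<sigma> \<in> coset_rows 1 \<sigma>"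
        proof -
          have "\<sigma> ** mat 1 \<in> (\<lambda>\<delta>. \<sigma> ** \<delta>) ` \<Gamma>" using Gamma_one by (rule imageI)
          then show ?thesis unfolding coset_rows_def by simp
        qed
        show "0 < c / (1 + 1)" using c(1) by simp
        show "0 < c * B" using Bc k1 by linarith
      qed
      also have "\<dots> \<le> norm ((cz \<sigma> *v column 1 s) $ 1) + norm ((cz \<sigma> *v column 1 s) $ 2)"
      proof -
        have "norm (of_real (\<epsilon> * 1) * \<i> * z) = norm z" for z :: complex using \<epsilon> by (auto simp: norm_mult)
        then show ?thesis unfolding bil_poincare_row column_eq by (metis norm_triangle_ineq)
      qed
      also have "\<dots> \<le> k + k"
        using \<sigma>(2) by (intro add_mono order_trans[OF Finite_Cartesian_Product.norm_nth_le]) auto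
      finally show False using Bc by simp
    qed
    then obtain \<gamma> where \<gamma>: "\<gamma> \<in> \<Gamma>" "norm (cz (\<sigma> ** \<gamma>)) \<le> B" by blast
    have d1: "det (\<sigma> ** \<gamma>) = 1" using \<sigma>(1) Gamma_det[OF \<gamma>(1)] by (simp add: det_mul)
    obtain \<tau> where \<tau>: "det \<tau> = 1" "\<tau> ** (\<sigma> ** \<gamma>) = mat 1" "(\<sigma> ** \<gamma>) ** \<tau> = mat 1" using det1_inverse[OF d1] by blast
    obtain \<gamma>' where \<gamma>': "\<gamma>' \<in> \<Gamma>" "\<gamma> ** \<gamma>' = mat 1" using Gamma_inverse[OF \<gamma>(1)] by blast
    \<comment> \<open>the inverse \<open>\<tau>\<close> of \<open>\<sigma> \<gamma>\<close> carries \<open>g\<close> back into the orbit of \<open>s\<close>\<close>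
    have "\<tau> ** \<sigma> = (\<tau> ** (\<sigma> ** \<gamma>)) ** \<gamma>'"
      by (simp add: matrix_mul_assoc[symmetric] \<gamma>'(2))
    then have "\<tau> ** \<sigma> = \<gamma>'" by (simp add: \<tau>(2))
    then have "cz \<tau> ** g = cz \<gamma>' ** s" by (simp add: g_def matrix_mul_assoc cz_mult[symmetric])
    then have "q (cz \<tau> ** g) = q s" using orbit_act[OF \<gamma>'(1)] by simp
    moreover have "\<tau> \<in> F" using \<tau>(1) \<gamma>(2) norm_inverse_matrix[OF d1 \<tau>(3)] by (simp add: F_def)
    ultimately show "X \<in> q ` D" unfolding s(2) D_def using gC by (metis (no_types, lifting) UN_I image_eqI)
  qed
  ultimately show ?thesis using that by blast
qed

lemma Hol_const: "(\<lambda>_. a) \<in> Hol \<A>"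
  by (rule HolI[where \<Phi> = "\<lambda>_. a"]) (auto intro: cdiff_const)

text \<open>For empty \<open>K\<close> the supremum in the definition of the hull is an unspecified number, which a large
  constant function exceeds.\<close>

lemma compactin_hull:
  assumes K: "compactin M K"
  shows "compactin M (holomorphic_hull M \<A> K)"
proof (cases "K = {}")
  case True
  have "holomorphic_hull M \<A> K = {}"
  proof (rule ccontr)
    assume "holomorphic_hull M \<A> K \<noteq> {}"
    then obtain x where x: "x \<in> holomorphic_hull M \<A> K" by blast
    define r where "r = \<bar>Sup ({} :: real set)\<bar> + 1"
    have "cmod (of_real r) \<le> (SUP w\<in>K. cmod (of_real r))"
    proof -
      have "\<forall>f\<in>Hol \<A>. cmod (f x) \<le> (SUP w\<in>K. cmod (f w))" using x by (simp add: holomorphic_hull_def)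
      from bspec[OF this Hol_const[of "of_real r"]] show ?thesis .
    qed
    then show False by (simp add: True r_def)
  qed
  then show ?thesis by simp
next
  case False
  obtain C where C: "compact C" "C \<subseteq> S" "K \<subseteq> q ` C" by (rule compactin_lift[OF K])
  obtain D where D: "compact D" "D \<subseteq> S" "holomorphic_hull M \<A> K \<subseteq> q ` D"
    by (rule hull_relatively_compact[OF False C(3,2,1)])
  have "compactin M (q ` D)"
    by (rule image_compactin[OF _ continuous_orbit]) (use D in \<open>simp add: compactin_subtopology\<close>)
  then show ?thesis using closed_compactin D(3) closedin_hull by blast
qed

text \<open>Along the curve of vectors \<open>(1, x)\<close> and rows \<open>(1, \<epsilon> i (1 + x\<^sup>2))\<close> a matrix entering through
  row times matrix times vector is determined: it yields a polynomial of degree 3 in \<open>x\<close> whose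
  coefficients recover all four entries.  The common largest terms give group elements with equal values for
  each \<open>x\<close>, and by countability one pair of them for infinitely many \<open>x\<close>.\<close>

lemma Hol_separates:
  assumes s: "s \<in> S" "t \<in> S" and eq: "\<And>f. f \<in> Hol \<A> \<Longrightarrow> f (q s) = f (q t)"
  shows "q s = q t"
proof -
  define v r where "v x = rvec 1 x" and "r x = 1 + x\<^sup>2" for x :: real
  have r1: "r x \<ge> 1" for x by (simp add: r_def)
  have match: "\<exists>\<gamma>\<in>\<Gamma>. \<exists>\<delta>\<in>\<Gamma>. bil (poincare_row (r x) \<gamma>) (s *v v x) = bil (poincare_row (r x) \<delta>) (t *v v x)" for x
  proof -
    define R where "R = poincare_row (r x) ` \<Gamma>"
    have R: "R = coset_rows (r x) (mat 1)" by (simp add: R_def coset_rows_def)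
    note dets = Gamma_det
    have sm: "(\<lambda>\<rho>. 1 / norm \<rho> ^ j) summable_on R" if "j \<ge> 8" for j
      unfolding R_def by (rule poincare_row_summable[OF r1 dets that])
    have R0: "0 \<notin> R" unfolding R_def by (rule poincare_row_nonzero[OF r1 dets])
    have pos: "\<epsilon> * orient (u *v v x) > 0" if "u \<in> S" for u
      unfolding v_def by (rule Sset_orient_vector_pos[OF that]) simp
    have sep: "separated_from R (u *v v x)" if "u \<in> S" for u
      unfolding R_def by (rule poincare_row_separated[OF r1 dets pos[OF that]])
    have inv: "act \<gamma> R = R" if "\<gamma> \<in> \<Gamma>" for \<gamma> unfolding R by (rule act_coset_rows[OF that])
    have sums: "(\<lambda>\<rho>. norm (1 / bil \<rho> (u *v v x)) ^ 8) summable_on R" if "u \<in> S" for u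
      using inv_power_sum_abs_summable[OF sm[OF order_refl] sep[OF that] R0] by (simp add: norm_divide norm_power power_divide)
    have inv_power_sum_eq: "(\<Sum>\<^sub>\<infinity>\<rho>\<in>R. (1 / bil \<rho> (s *v v x)) ^ k) = (\<Sum>\<^sub>\<infinity>\<rho>\<in>R. (1 / bil \<rho> (t *v v x)) ^ k)"
      if k: "k \<ge> 8" for k
    proof -
      obtain f where f: "f \<in> Hol \<A>" "\<And>u. u \<in> S \<Longrightarrow> f (q u) = inv_power_sum k R (u *v v x)"
        using inv_power_sum_Hol[OF sm[OF k] R0 sep inv] by blast
      show ?thesis using eq[OF f(1)] f(2)[OF s(1)] f(2)[OF s(2)] by (simp add: inv_power_sum_def power_one_over)
    qed
    have nz: "bil \<rho> (u *v v x) \<noteq> 0" if u: "u \<in> S" and \<rho>: "\<rho> \<in> R" for u \<rho>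
    proof -
      obtain d where d: "d > 0" "d * norm \<rho> \<le> norm (bil \<rho> (u *v v x))"
        using sep[OF u] \<rho> by (auto simp: separated_from_def)
      have "\<rho> \<noteq> 0" using \<rho> R0 by metis
      then have "d * norm \<rho> > 0" using d(1) by simp
      then show ?thesis using d(2) by auto
    qed
    have one: "poincare_row (r x) (mat 1) \<in> R" unfolding R_def using Gamma_one by blast
    have "\<exists>\<rho>\<in>R. \<exists>\<rho>'\<in>R. 1 / bil \<rho> (s *v v x) = 1 / bil \<rho>' (t *v v x)"
      by (rule equal_power_sums_common[OF sums[OF s(1)] sums[OF s(2)] inv_power_sum_eq one _ one])
         (use nz[OF s(1) one] nz[OF s(2) one] in auto)
    then show ?thesis unfolding R_def by auto
  qed
  define X where "X p = {x. bil (poincare_row (r x) (fst p)) (s *v v x) = bil (poincare_row (r x) (snd p)) (t *v v x)}" for p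
  have "(UNIV :: real set) = (\<Union>p\<in>\<Gamma> \<times> \<Gamma>. X p)" using match by (force simp: X_def)
  moreover have "countable (\<Gamma> \<times> \<Gamma>)" by simp
  ultimately have "\<exists>p\<in>\<Gamma> \<times> \<Gamma>. uncountable (X p)" using uncountable_UNIV_real by (metis countable_UN)
  then obtain \<gamma> \<delta> where \<gamma>\<delta>: "\<gamma> \<in> \<Gamma>" "\<delta> \<in> \<Gamma>" "uncountable (X (\<gamma>, \<delta>))" by auto
  then have inf: "infinite (X (\<gamma>, \<delta>))" using countable_finite by blast
  define A where "A = cz \<gamma> ** s - cz \<delta> ** t"
  define \<kappa> where "\<kappa> = of_real \<epsilon> * \<i>"
  have \<kappa>: "\<kappa> \<noteq> 0" using \<epsilon> by (auto simp: \<kappa>_def)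
  define pl where "pl = [:A$1$1 + \<kappa> * A$2$1, A$1$2 + \<kappa> * A$2$2, \<kappa> * A$2$1, \<kappa> * A$2$2:]"
  have "poly pl (of_real x) = 0" if x: "x \<in> X (\<gamma>, \<delta>)" for x
  proof -
    have e: "bil (poincare_row (r x) \<gamma>) (u *v v x) = (cz \<gamma> ** u)$1$1 + (cz \<gamma> ** u)$1$2 * of_real x
        + \<kappa> * (1 + (of_real x)\<^sup>2) * ((cz \<gamma> ** u)$2$1 + (cz \<gamma> ** u)$2$2 * of_real x)" for \<gamma> u
      unfolding bil_poincare_row matrix_vector_mul_assoc
      by (simp add: matrix_vector_mult_def sum_2 v_def r_def \<kappa>_def algebra_simps)
    have "bil (poincare_row (r x) \<gamma>) (s *v v x) - bil (poincare_row (r x) \<delta>) (t *v v x) = 0" using x by (simp add: X_def)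
    then show ?thesis unfolding e pl_def A_def by (simp add: algebra_simps power2_eq_square)
  qed
  then have "of_real ` X (\<gamma>, \<delta>) \<subseteq> {z. poly pl z = 0}" by auto
  moreover have "infinite (complex_of_real ` X (\<gamma>, \<delta>))"
    using inf finite_imageD[of complex_of_real "X (\<gamma>, \<delta>)"] by (auto simp: inj_on_def)
  ultimately have "pl = 0" using poly_roots_finite[of pl] finite_subset by blast
  then have "A$2$2 = 0" "A$2$1 = 0" "A$1$2 = 0" "A$1$1 = 0" using \<kappa> by (auto simp: pl_def)
  then have "cz \<gamma> ** s = cz \<delta> ** t" by (simp add: A_def mat2_eq_iff)
  then show ?thesis using orbit_act[OF \<gamma>\<delta>(1)] orbit_act[OF \<gamma>\<delta>(2)] by metis
qed

theorem Stein_quotient: "Stein_manifold M \<A>"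
  unfolding Stein_manifold_def
proof (intro conjI ballI allI impI)
  show "complex_manifold M \<A>" by (rule complex_manifold_quotient)
  show "second_countable M" by (rule second_countable_quotient)
  show "compactin M (holomorphic_hull M \<A> K)" if "compactin M K" for K by (rule compactin_hull[OF that])
  fix x y assume x: "x \<in> topspace M" and y: "y \<in> topspace M" and xy: "x \<noteq> y"
  obtain s where s: "s \<in> S" "x = q s" using x by (auto simp: topspace_quotient_topology)
  obtain t where t: "t \<in> S" "y = q t" using y by (auto simp: topspace_quotient_topology)
  show "\<exists>f\<in>Hol \<A>. f x \<noteq> f y" using Hol_separates[OF s(1) t(1)] xy s(2) t(2) by blast
qed

end

theorem theoremD:
  fixes W :: "(real ^ 2 ^ 2) set" and \<Gamma> :: "(int ^ 2 ^ 2) set"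
  assumes "W \<subseteq> sl" and "W \<noteq> {}"
    and "openin (top_of_set sl) W"
    and "convex W"
    and "closed_under_pos_scaling W"
    and "Ad_invariant W"
    and "\<forall>X\<in>W. elliptic X"
    and "contains_no_line W"
    and "subgroup \<Gamma> SL"
  shows "Stein_manifold
           (quotient_topology (top_of_set (olshanskii W)) (left_orbit \<Gamma>))
           (quotient_atlas (top_of_set (olshanskii W)) SL2C_atlas (left_orbit \<Gamma>))"
proof -
  obtain \<epsilon> :: real where \<epsilon>: "\<epsilon> = 1 \<or> \<epsilon> = -1" and W: "W = {X \<in> sl. det X > 0 \<and> \<epsilon> * X$1$2 > 0}"
    by (rule elliptic_cone_classification[OF assms(1-7)])
  interpret semigroup_quotient \<epsilon> \<Gamma> 
    using \<epsilon> assms(9) by (simp add: semigroup_quotient_def orientation_sign_def semigroup_quotient_axioms_def)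
  show ?thesis
    unfolding olshanskii_eq_Sset[OF \<epsilon> W] by (rule Stein_quotient)
qed

end
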